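(* Let $N\geqslant 1$ be an integer, let $\Gamma$ be a discrete group and let $\Lambda$ be a subgroup of $\Gamma$. There exists a $*$-isomorphism $$\Phi : \mathcal{O}(\widehat{\Gamma}\wr_{\ast, \widehat{\Lambda}}S_{N}^{+})\to \mathcal{O}(H_{N}^{+}(\Gamma, \Lambda))$$ such that the push-forward under $\Phi$ of the coproduct of $\mathcal{O}(\widehat{\Gamma}\wr_{\ast, \widehat{\Lambda}}S_{N}^{+})$ maps $a_{ij}(g)$ to $$\sum_{k=1}^{N} a_{ik}(g)\otimes a_{kj}(g)$$ for all $1\leqslant i,j\leqslant N$ and all $g\in\Gamma$.
   Context: A CQG-algebra is a Hopf $*$-algebra spanned by the coefficients of its finite-dimensional unitary corepresentations. For a discrete group $\Gamma$, $\widehat{\Gamma}$ denotes the compact quantum group with CQG-algebra $\mathcal{O}(\widehat{\Gamma})=\mathbb{C}[\Gamma]$, $\Delta(g)=g\otimes g$, $g^*=g^{-1}$. $\mathcal{O}(S_{N}^{+})$ is the universal unital $*$-algebra generated by $(p_{ij})_{1\leqslant i,j\leqslant N}$ with $p_{ij}^{2}=p_{ij}=p_{ij}^{*}$, $\sum_{k}p_{ik}=1=\sum_{k}p_{kj}$, $p_{ik}p_{jk}=\delta_{ij}p_{ik}$, $p_{ki}p_{kj}=\delta_{ij}p_{kj}$. Let $\mathbb{C}[\Gamma]^{\ast_{\mathbb{C}[\Lambda]}^{N}}$ be the $N$-fold free product of copies of $\mathbb{C}[\Gamma]$ amalgamated over $\mathbb{C}[\Lambda]$ and $\nu_{i}$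 the canonical map of $\mathbb{C}[\Gamma]$ onto the $i$-th copy. $\mathcal{O}(\widehat{\Gamma}\wr_{\ast,\widehat{\Lambda}}S_{N}^{+})$ is the quotient of the free product $\mathbb{C}[\Gamma]^{\ast_{\mathbb{C}[\Lambda]}^{N}}\ast\mathcal{O}(S_{N}^{+})$ by the relations $\nu_{i}(x)p_{ij}=p_{ij}\nu_{i}(x)$ for all $i,j$ and $x\in\mathbb{C}[\Gamma]$, with the coproduct determined by $\Delta(p_{ij})=\sum_{k}p_{ik}\otimes p_{kj}$ and $\Delta(\nu_{i}(g)) = \sum_{k}\nu_{i}(g)p_{ik}\otimes \nu_{k}(g)$ for $g\in\Gamma$. $\mathcal{O}(H_{N}^{+}(\Gamma))$ is the universal unital $*$-algebra generated by elements $a_{ij}(g)$, $1\leqslant i,j\leqslant N$, $g\in\Gamma$, with $a_{ij}(g)^*=a_{ij}(g^{-1})$ and relations $$a_{ij}(g)a_{ik}(h)=\delta_{jk}a_{ij}(gh),\quad a_{ji}(g)a_{ki}(h)=\delta_{jk}a_{ji}(gh),\quad \sum_{k=1}^{N}a_{ik}(e)=1=\sum_{k=1}^{N}a_{kj}(e).$$ It is a CQG-algebra with $\Delta(a_{ij}(g))=\sum_{k}a_{ik}(g)\otimes a_{kj}(g)$. $\mathcal{O}(H_{N}^{+}(\Gamma,\Lambda))$ is the quotient of $\mathcal{O}(H_{N}^{+}(\Gamma))$ by the Hopf $*$-ideal generated by the relations $\sum_{k=1}^{N}a_{ik}(g)=\sum_{k=1}^{N}a_{jk}(g)$ for all $1\leqslant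 i,j\leqslant N$ and $g\in\Lambda$. *)

theory Defs
  imports Complex_Main "HOL-Library.Poly_Mapping" "HOL-Algebra.QuotRing" "HOL-Algebra.Module"
begin

section \<open>Unital *-algebras over the complex numbers\<close>

record 'a star_algebra = "(complex, 'a) module" +
  star :: "'a \<Rightarrow> 'a"

definition star_hom :: "'a star_algebra \<Rightarrow> 'b star_algebra \<Rightarrow> ('a \<Rightarrow> 'b) set" where
  "star_hom A B =
     {f \<in> ring_hom A B.
        (\<forall>c. \<forall>x\<in>carrier A. f (c \<odot>\<^bsub>A\<^esub> x) = c \<odot>\<^bsub>B\<^esub> f x) \<and>
        (\<forall>x\<in>carrier A. f (star A x) = star B (f x))}"

definition star_iso :: "'a star_algebra \<Rightarrow> 'b star_algebra \<Rightarrow> ('a \<Rightarrow> 'b) set" where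
  "star_iso A B = {f \<in> star_hom A B. bij_betw f (carrier A) (carrier B)}"

definition lin_span :: "'a star_algebra \<Rightarrow> 'a set \<Rightarrow> 'a set" where
  "lin_span A S =
     \<Inter>{V. V \<subseteq> carrier A \<and> S \<subseteq> V \<and> \<zero>\<^bsub>A\<^esub> \<in> V \<and>
         (\<forall>x\<in>V. \<forall>y\<in>V. x \<oplus>\<^bsub>A\<^esub> y \<in> V) \<and> (\<forall>c. \<forall>x\<in>V. c \<odot>\<^bsub>A\<^esub> x \<in> V)}"

text \<open>Since the algebras are unital, a ring ideal is automatically a linear subspace.\<close>

definition star_ideal :: "'a set \<Rightarrow> 'a star_algebra \<Rightarrow> bool" where
  "star_ideal I A \<longleftrightarrow> ideal I A \<and> (\<forall>x\<in>I. star A x \<in> I)"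

definition star_ideal_gen :: "'a star_algebra \<Rightarrow> 'a set \<Rightarrow> 'a set" where
  "star_ideal_gen A S = \<Inter>{I. star_ideal I A \<and> S \<subseteq> I}"

definition star_quotient :: "'a star_algebra \<Rightarrow> 'a set \<Rightarrow> 'a set star_algebra" where
  "star_quotient A I =
     \<lparr>carrier = carrier (A Quot I), mult = mult (A Quot I), one = one (A Quot I),
      zero = zero (A Quot I), add = add (A Quot I),
      smult = (\<lambda>c X. \<Union>x\<in>X. I +>\<^bsub>A\<^esub> (c \<odot>\<^bsub>A\<^esub> x)),
      star = (\<lambda>X. \<Union>x\<in>X. I +>\<^bsub>A\<^esub> star A x)\<rparr>"

text \<open>A pair \<open>(l, r)\<close> in a set of relations stands for the equation \<open>l = r\<close>.\<close>

definition differences :: "'a star_algebra \<Rightarrow> ('a \<times> 'a) set \<Rightarrow> 'a set" where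
  "differences A R = {l \<ominus>\<^bsub>A\<^esub> r | l r. (l, r) \<in> R}"

definition impose :: "'a star_algebra \<Rightarrow> ('a \<times> 'a) set \<Rightarrow> 'a set star_algebra" where
  "impose A R = star_quotient A (star_ideal_gen A (differences A R))"

definition impose_proj :: "'a star_algebra \<Rightarrow> ('a \<times> 'a) set \<Rightarrow> 'a \<Rightarrow> 'a set" where
  "impose_proj A R x = star_ideal_gen A (differences A R) +>\<^bsub>A\<^esub> x"


section \<open>Monoid algebras and algebras given by generators and relations\<close>

text \<open>The complex algebra of a monoid \<open>M\<close>; its involution is the antilinear extension of \<open>\<iota>\<close>,
  which is meant to be an involutive anti-automorphism of \<open>M\<close>.\<close>

definition monoid_star_algebra ::
  "('m, 'r) monoid_scheme \<Rightarrow> ('m \<Rightarrow> 'm) \<Rightarrow> ('m \<Rightarrow>\<^sub>0 complex) star_algebra" where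
  "monoid_star_algebra M \<iota> =
     \<lparr>carrier = {f. Poly_Mapping.keys f \<subseteq> carrier M},
      mult = (\<lambda>f g. \<Sum>x\<in>Poly_Mapping.keys f. \<Sum>y\<in>Poly_Mapping.keys g.
                Poly_Mapping.single (x \<otimes>\<^bsub>M\<^esub> y) (Poly_Mapping.lookup f x * Poly_Mapping.lookup g y)),
      one = Poly_Mapping.single \<one>\<^bsub>M\<^esub> 1,
      zero = 0,
      add = (+),
      smult = (\<lambda>c f. Poly_Mapping.map (\<lambda>z. c * z) f),
      star = (\<lambda>f. \<Sum>x\<in>Poly_Mapping.keys f.
                Poly_Mapping.single (\<iota> x) (cnj (Poly_Mapping.lookup f x)))\<rparr>"

definition group_star_algebra :: "('g, 'r) monoid_scheme \<Rightarrow> ('g \<Rightarrow>\<^sub>0 complex) star_algebra" where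
  "group_star_algebra G = monoid_star_algebra G (m_inv G)"

text \<open>Words over \<open>X\<close> and a disjoint copy of \<open>X\<close>: the letter \<open>(x, False)\<close> is the generator \<open>x\<close>
  and \<open>(x, True)\<close> is its adjoint.\<close>

type_synonym 'x free_star = "('x \<times> bool) list \<Rightarrow>\<^sub>0 complex"

definition word_monoid :: "'x set \<Rightarrow> ('x \<times> bool) list monoid" where
  "word_monoid X = \<lparr>carrier = lists (X \<times> UNIV), mult = (@), one = []\<rparr>"

definition word_star :: "('x \<times> bool) list \<Rightarrow> ('x \<times> bool) list" where
  "word_star w = rev (map (map_prod id Not) w)"

definition free_star_algebra :: "'x set \<Rightarrow> 'x free_star star_algebra" where
  "free_star_algebra X = monoid_star_algebra (word_monoid X) word_star"

definition free_gen :: "'x \<Rightarrow> 'x free_star" where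
  "free_gen x = Poly_Mapping.single [(x, False)] 1"

text \<open>The universal unital *-algebra generated by \<open>X\<close> subject to the relations \<open>R\<close>.\<close>

definition presented :: "'x set \<Rightarrow> ('x free_star \<times> 'x free_star) set \<Rightarrow> 'x free_star set star_algebra"
  where "presented X R = impose (free_star_algebra X) R"

definition presented_gen :: "'x set \<Rightarrow> ('x free_star \<times> 'x free_star) set \<Rightarrow> 'x \<Rightarrow> 'x free_star set"
  where "presented_gen X R x = impose_proj (free_star_algebra X) R (free_gen x)"


section \<open>Free products of unital *-algebras\<close>

text \<open>The relations in \<open>F\<close> saying that \<open>u\<close> is a unital *-homomorphism from \<open>A\<close> to \<open>F\<close>.\<close>

definition hom_relations :: "'a star_algebra \<Rightarrow> 'f star_algebra \<Rightarrow> ('a \<Rightarrow> 'f) \<Rightarrow> ('f \<times> 'f) set" where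
  "hom_relations A F u =
     {(u (x \<oplus>\<^bsub>A\<^esub> y), u x \<oplus>\<^bsub>F\<^esub> u y) | x y. x \<in> carrier A \<and> y \<in> carrier A} \<union>
     {(u (c \<odot>\<^bsub>A\<^esub> x), c \<odot>\<^bsub>F\<^esub> u x) | c x. x \<in> carrier A} \<union>
     {(u (x \<otimes>\<^bsub>A\<^esub> y), u x \<otimes>\<^bsub>F\<^esub> u y) | x y. x \<in> carrier A \<and> y \<in> carrier A} \<union>
     {(u \<one>\<^bsub>A\<^esub>, \<one>\<^bsub>F\<^esub>)} \<union>
     {(u (star A x), star F (u x)) | x. x \<in> carrier A}"

definition free_prod_gens :: "'a star_algebra \<Rightarrow> 'b star_algebra \<Rightarrow> ('a + 'b) set" where
  "free_prod_gens A B = carrier A <+> carrier B"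

definition free_prod_rels ::
  "'a star_algebra \<Rightarrow> 'b star_algebra \<Rightarrow> (('a + 'b) free_star \<times> ('a + 'b) free_star) set" where
  "free_prod_rels A B =
     (let F = free_star_algebra (free_prod_gens A B) in
        hom_relations A F (\<lambda>x. free_gen (Inl x)) \<union> hom_relations B F (\<lambda>y. free_gen (Inr y)))"

definition free_prod :: "'a star_algebra \<Rightarrow> 'b star_algebra \<Rightarrow> ('a + 'b) free_star set star_algebra"
  where "free_prod A B = presented (free_prod_gens A B) (free_prod_rels A B)"

definition free_prod_inl :: "'a star_algebra \<Rightarrow> 'b star_algebra \<Rightarrow> 'a \<Rightarrow> ('a + 'b) free_star set"
  where "free_prod_inl A B x = presented_gen (free_prod_gens A B) (free_prod_rels A B) (Inl x)"

definition free_prod_inr :: "'a star_algebra \<Rightarrow> 'b star_algebra \<Rightarrow> 'b \<Rightarrow> ('a + 'b) free_star set"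
  where "free_prod_inr A B y = presented_gen (free_prod_gens A B) (free_prod_rels A B) (Inr y)"

text \<open>The free product of the algebras \<open>A i\<close>, \<open>i \<in> I\<close>, amalgamated over a nonempty index set
  along the maps \<open>j i\<close> from \<open>B\<close> to \<open>A i\<close>.\<close>

definition amalg_gens :: "'i set \<Rightarrow> ('i \<Rightarrow> 'a star_algebra) \<Rightarrow> ('i \<times> 'a) set" where
  "amalg_gens I A = (SIGMA i:I. carrier (A i))"

definition amalg_rels ::
  "'i set \<Rightarrow> ('i \<Rightarrow> 'a star_algebra) \<Rightarrow> 'b star_algebra \<Rightarrow> ('i \<Rightarrow> 'b \<Rightarrow> 'a) \<Rightarrow>
   (('i \<times> 'a) free_star \<times> ('i \<times> 'a) free_star) set" where
  "amalg_rels I A B j =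
     (\<Union>i\<in>I. hom_relations (A i) (free_star_algebra (amalg_gens I A)) (\<lambda>x. free_gen (i, x))) \<union>
     {(free_gen (i, j i b), free_gen (k, j k b)) | i k b. i \<in> I \<and> k \<in> I \<and> b \<in> carrier B}"

definition amalg_free_prod ::
  "'i set \<Rightarrow> ('i \<Rightarrow> 'a star_algebra) \<Rightarrow> 'b star_algebra \<Rightarrow> ('i \<Rightarrow> 'b \<Rightarrow> 'a) \<Rightarrow>
   ('i \<times> 'a) free_star set star_algebra" where
  "amalg_free_prod I A B j = presented (amalg_gens I A) (amalg_rels I A B j)"

definition amalg_inj ::
  "'i set \<Rightarrow> ('i \<Rightarrow> 'a star_algebra) \<Rightarrow> 'b star_algebra \<Rightarrow> ('i \<Rightarrow> 'b \<Rightarrow> 'a) \<Rightarrow>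
   'i \<Rightarrow> 'a \<Rightarrow> ('i \<times> 'a) free_star set" where
  "amalg_inj I A B j i x = presented_gen (amalg_gens I A) (amalg_rels I A B j) (i, x)"


section \<open>Algebraic tensor products\<close>

text \<open>The free vector space on \<open>carrier A \<times> carrier B\<close> modulo the span of the bilinearity
  relations. Being the algebra of the product of the multiplicative monoids, the free vector
  space carries the product \<open>(a, b)(a', b') = (aa', bb')\<close> and the involution
  \<open>(a, b)\<^sup>* = (a\<^sup>*, b\<^sup>*)\<close>, and the span of the bilinearity relations is a two-sided *-ideal.\<close>

definition tensor_free :: "'a star_algebra \<Rightarrow> 'b star_algebra \<Rightarrow> ('a \<times> 'b \<Rightarrow>\<^sub>0 complex) star_algebra"
  where "tensor_free A B = monoid_star_algebra (A \<times>\<times> B) (map_prod (star A) (star B))"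

abbreviation pair_basis :: "'a \<Rightarrow> 'b \<Rightarrow> ('a \<times> 'b \<Rightarrow>\<^sub>0 complex)" where
  "pair_basis a b \<equiv> Poly_Mapping.single (a, b) 1"

definition tensor_rels ::
  "'a star_algebra \<Rightarrow> 'b star_algebra \<Rightarrow> (('a \<times> 'b \<Rightarrow>\<^sub>0 complex) \<times> ('a \<times> 'b \<Rightarrow>\<^sub>0 complex)) set" where
  "tensor_rels A B =
     (let F = tensor_free A B in
       {(pair_basis (a \<oplus>\<^bsub>A\<^esub> a') b, pair_basis a b \<oplus>\<^bsub>F\<^esub> pair_basis a' b) | a a' b.
          a \<in> carrier A \<and> a' \<in> carrier A \<and> b \<in> carrier B} \<union>
       {(pair_basis a (b \<oplus>\<^bsub>B\<^esub> b'), pair_basis a b \<oplus>\<^bsub>F\<^esub> pair_basis a b') | a b b'.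
          a \<in> carrier A \<and> b \<in> carrier B \<and> b' \<in> carrier B} \<union>
       {(pair_basis (c \<odot>\<^bsub>A\<^esub> a) b, c \<odot>\<^bsub>F\<^esub> pair_basis a b) | c a b. a \<in> carrier A \<and> b \<in> carrier B} \<union>
       {(pair_basis a (c \<odot>\<^bsub>B\<^esub> b), c \<odot>\<^bsub>F\<^esub> pair_basis a b) | c a b. a \<in> carrier A \<and> b \<in> carrier B})"

definition tensor_null :: "'a star_algebra \<Rightarrow> 'b star_algebra \<Rightarrow> ('a \<times> 'b \<Rightarrow>\<^sub>0 complex) set" where
  "tensor_null A B = lin_span (tensor_free A B) (differences (tensor_free A B) (tensor_rels A B))"

definition tensor ::
  "'a star_algebra \<Rightarrow> 'b star_algebra \<Rightarrow> ('a \<times> 'b \<Rightarrow>\<^sub>0 complex) set star_algebra" where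
  "tensor A B = star_quotient (tensor_free A B) (tensor_null A B)"

definition pure_tensor ::
  "'a star_algebra \<Rightarrow> 'b star_algebra \<Rightarrow> 'a \<Rightarrow> 'b \<Rightarrow> ('a \<times> 'b \<Rightarrow>\<^sub>0 complex) set" where
  "pure_tensor A B a b = tensor_null A B +>\<^bsub>tensor_free A B\<^esub> pair_basis a b"

text \<open>The linear map on the tensor product induced by a bilinear map \<open>\<beta>\<close> with values in \<open>V\<close>;
  for bilinear \<open>\<beta>\<close> the value does not depend on the chosen representative.\<close>

definition tensor_lift ::
  "'c star_algebra \<Rightarrow> ('a \<Rightarrow> 'b \<Rightarrow> 'c) \<Rightarrow> ('a \<times> 'b \<Rightarrow>\<^sub>0 complex) set \<Rightarrow> 'c" where
  "tensor_lift V \<beta> T =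
     (let f = SOME f. f \<in> T in
        \<Oplus>\<^bsub>V\<^esub>z\<in>Poly_Mapping.keys f. Poly_Mapping.lookup f z \<odot>\<^bsub>V\<^esub> \<beta> (fst z) (snd z))"

definition tensor_map ::
  "'c star_algebra \<Rightarrow> 'd star_algebra \<Rightarrow> ('a \<Rightarrow> 'c) \<Rightarrow> ('b \<Rightarrow> 'd) \<Rightarrow>
   ('a \<times> 'b \<Rightarrow>\<^sub>0 complex) set \<Rightarrow> ('c \<times> 'd \<Rightarrow>\<^sub>0 complex) set" where
  "tensor_map C D f g = tensor_lift (tensor C D) (\<lambda>a b. pure_tensor C D (f a) (g b))"


section \<open>Coproducts and Hopf *-ideals\<close>

definition pushforward_comult ::
  "'a star_algebra \<Rightarrow> 'b star_algebra \<Rightarrow> ('a \<Rightarrow> 'b) \<Rightarrow> ('a \<Rightarrow> ('a \<times> 'a \<Rightarrow>\<^sub>0 complex) set) \<Rightarrow>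
   'b \<Rightarrow> ('b \<times> 'b \<Rightarrow>\<^sub>0 complex) set" where
  "pushforward_comult A B \<Phi> \<Delta> y = tensor_map B B \<Phi> \<Phi> (\<Delta> (inv_into (carrier A) \<Phi> y))"

definition is_counit ::
  "'a star_algebra \<Rightarrow> ('a \<Rightarrow> ('a \<times> 'a \<Rightarrow>\<^sub>0 complex) set) \<Rightarrow> ('a \<Rightarrow> complex) \<Rightarrow> bool" where
  "is_counit A \<Delta> \<epsilon> \<longleftrightarrow>
     \<epsilon> \<one>\<^bsub>A\<^esub> = 1 \<and>
     (\<forall>x\<in>carrier A. \<forall>y\<in>carrier A. \<epsilon> (x \<oplus>\<^bsub>A\<^esub> y) = \<epsilon> x + \<epsilon> y \<and> \<epsilon> (x \<otimes>\<^bsub>A\<^esub> y) = \<epsilon> x * \<epsilon> y) \<and>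
     (\<forall>c. \<forall>x\<in>carrier A. \<epsilon> (c \<odot>\<^bsub>A\<^esub> x) = c * \<epsilon> x) \<and>
     (\<forall>x\<in>carrier A. tensor_lift A (\<lambda>a b. \<epsilon> a \<odot>\<^bsub>A\<^esub> b) (\<Delta> x) = x \<and>
                    tensor_lift A (\<lambda>a b. \<epsilon> b \<odot>\<^bsub>A\<^esub> a) (\<Delta> x) = x)"

definition is_antipode ::
  "'a star_algebra \<Rightarrow> ('a \<Rightarrow> ('a \<times> 'a \<Rightarrow>\<^sub>0 complex) set) \<Rightarrow> ('a \<Rightarrow> complex) \<Rightarrow> ('a \<Rightarrow> 'a) \<Rightarrow> bool" where
  "is_antipode A \<Delta> \<epsilon> S \<longleftrightarrow>
     S \<in> carrier A \<rightarrow> carrier A \<and>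
     (\<forall>x\<in>carrier A. \<forall>y\<in>carrier A. S (x \<oplus>\<^bsub>A\<^esub> y) = S x \<oplus>\<^bsub>A\<^esub> S y) \<and>
     (\<forall>c. \<forall>x\<in>carrier A. S (c \<odot>\<^bsub>A\<^esub> x) = c \<odot>\<^bsub>A\<^esub> S x) \<and>
     (\<forall>x\<in>carrier A. tensor_lift A (\<lambda>a b. S a \<otimes>\<^bsub>A\<^esub> b) (\<Delta> x) = \<epsilon> x \<odot>\<^bsub>A\<^esub> \<one>\<^bsub>A\<^esub> \<and>
                    tensor_lift A (\<lambda>a b. a \<otimes>\<^bsub>A\<^esub> S b) (\<Delta> x) = \<epsilon> x \<odot>\<^bsub>A\<^esub> \<one>\<^bsub>A\<^esub>)"

text \<open>The counit and the antipode of a Hopf algebra are unique on its carrier, so the existential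
  quantifier merely names them. The span in the second line is \<open>I \<otimes> A + A \<otimes> I\<close>.\<close>

definition hopf_star_ideal ::
  "'a set \<Rightarrow> 'a star_algebra \<Rightarrow> ('a \<Rightarrow> ('a \<times> 'a \<Rightarrow>\<^sub>0 complex) set) \<Rightarrow> bool" where
  "hopf_star_ideal I A \<Delta> \<longleftrightarrow>
     star_ideal I A \<and>
     \<Delta> ` I \<subseteq> lin_span (tensor A A)
                ({pure_tensor A A x y | x y. x \<in> I \<and> y \<in> carrier A} \<union>
                 {pure_tensor A A x y | x y. x \<in> carrier A \<and> y \<in> I}) \<and>
     (\<exists>\<epsilon> S. is_counit A \<Delta> \<epsilon> \<and> is_antipode A \<Delta> \<epsilon> S \<and> (\<forall>x\<in>I. \<epsilon> x = 0) \<and> S ` I \<subseteq> I)"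

definition hopf_star_ideal_gen ::
  "'a star_algebra \<Rightarrow> ('a \<Rightarrow> ('a \<times> 'a \<Rightarrow>\<^sub>0 complex) set) \<Rightarrow> 'a set \<Rightarrow> 'a set" where
  "hopf_star_ideal_gen A \<Delta> X = \<Inter>{I. hopf_star_ideal I A \<Delta> \<and> X \<subseteq> I}"


section \<open>The quantum permutation algebra\<close>

definition perm_gens :: "nat \<Rightarrow> (nat \<times> nat) set" where
  "perm_gens N = {1..N} \<times> {1..N}"

definition perm_rels :: "nat \<Rightarrow> ((nat \<times> nat) free_star \<times> (nat \<times> nat) free_star) set" where
  "perm_rels N =
     (let F = free_star_algebra (perm_gens N);
          p = (\<lambda>i j. free_gen (i, j))
      in
        {(p i j \<otimes>\<^bsub>F\<^esub> p i j, p i j) | i j. i \<in> {1..N} \<and> j \<in> {1..N}} \<union>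
        {(star F (p i j), p i j) | i j. i \<in> {1..N} \<and> j \<in> {1..N}} \<union>
        {(\<Oplus>\<^bsub>F\<^esub>k\<in>{1..N}. p i k, \<one>\<^bsub>F\<^esub>) | i. i \<in> {1..N}} \<union>
        {(\<Oplus>\<^bsub>F\<^esub>k\<in>{1..N}. p k j, \<one>\<^bsub>F\<^esub>) | j. j \<in> {1..N}} \<union>
        {(p i k \<otimes>\<^bsub>F\<^esub> p j k, if i = j then p i k else \<zero>\<^bsub>F\<^esub>) | i j k.
           i \<in> {1..N} \<and> j \<in> {1..N} \<and> k \<in> {1..N}} \<union>
        {(p k i \<otimes>\<^bsub>F\<^esub> p k j, if i = j then p k i else \<zero>\<^bsub>F\<^esub>) | i j k.
           i \<in> {1..N} \<and> j \<in> {1..N} \<and> k \<in> {1..N}})"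

definition perm_algebra :: "nat \<Rightarrow> (nat \<times> nat) free_star set star_algebra" where
  "perm_algebra N = presented (perm_gens N) (perm_rels N)"

definition perm_p :: "nat \<Rightarrow> nat \<Rightarrow> nat \<Rightarrow> (nat \<times> nat) free_star set" where
  "perm_p N i j = presented_gen (perm_gens N) (perm_rels N) (i, j)"


section \<open>The amalgamated free wreath product\<close>

type_synonym 'g amalg_elem = "(nat \<times> ('g \<Rightarrow>\<^sub>0 complex)) free_star set"
type_synonym 'g wreath_pre = "('g amalg_elem + (nat \<times> nat) free_star set) free_star set"
type_synonym 'g wreath_elem = "'g wreath_pre set"

text \<open>The group algebra of the subgroup \<open>L\<close> consists of the elements of the group algebra of \<open>G\<close>
  that are supported in \<open>L\<close>, so the inclusion is \<^term>\<open>id\<close>.\<close>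

definition wreath_amalg :: "('g, 'r) monoid_scheme \<Rightarrow> 'g set \<Rightarrow> nat \<Rightarrow> 'g amalg_elem star_algebra" where
  "wreath_amalg G L N =
     amalg_free_prod {1..N} (\<lambda>i. group_star_algebra G) (group_star_algebra (G\<lparr>carrier := L\<rparr>)) (\<lambda>i. id)"

definition wreath_amalg_nu ::
  "('g, 'r) monoid_scheme \<Rightarrow> 'g set \<Rightarrow> nat \<Rightarrow> nat \<Rightarrow> ('g \<Rightarrow>\<^sub>0 complex) \<Rightarrow> 'g amalg_elem" where
  "wreath_amalg_nu G L N i x =
     amalg_inj {1..N} (\<lambda>i. group_star_algebra G) (group_star_algebra (G\<lparr>carrier := L\<rparr>)) (\<lambda>i. id) i x"

definition wreath_free :: "('g, 'r) monoid_scheme \<Rightarrow> 'g set \<Rightarrow> nat \<Rightarrow> 'g wreath_pre star_algebra" where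
  "wreath_free G L N = free_prod (wreath_amalg G L N) (perm_algebra N)"

definition wreath_rels ::
  "('g, 'r) monoid_scheme \<Rightarrow> 'g set \<Rightarrow> nat \<Rightarrow> ('g wreath_pre \<times> 'g wreath_pre) set" where
  "wreath_rels G L N =
     (let W = wreath_free G L N;
          \<nu> = (\<lambda>i x. free_prod_inl (wreath_amalg G L N) (perm_algebra N) (wreath_amalg_nu G L N i x));
          p = (\<lambda>i j. free_prod_inr (wreath_amalg G L N) (perm_algebra N) (perm_p N i j))
      in {(\<nu> i x \<otimes>\<^bsub>W\<^esub> p i j, p i j \<otimes>\<^bsub>W\<^esub> \<nu> i x) | i j x.
            i \<in> {1..N} \<and> j \<in> {1..N} \<and> x \<in> carrier (group_star_algebra G)})"

definition wreath_algebra :: "('g, 'r) monoid_scheme \<Rightarrow> 'g set \<Rightarrow> nat \<Rightarrow> 'g wreath_elem star_algebra"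
  where "wreath_algebra G L N = impose (wreath_free G L N) (wreath_rels G L N)"

definition wreath_nu ::
  "('g, 'r) monoid_scheme \<Rightarrow> 'g set \<Rightarrow> nat \<Rightarrow> nat \<Rightarrow> ('g \<Rightarrow>\<^sub>0 complex) \<Rightarrow> 'g wreath_elem" where
  "wreath_nu G L N i x =
     impose_proj (wreath_free G L N) (wreath_rels G L N)
       (free_prod_inl (wreath_amalg G L N) (perm_algebra N) (wreath_amalg_nu G L N i x))"

definition wreath_p :: "('g, 'r) monoid_scheme \<Rightarrow> 'g set \<Rightarrow> nat \<Rightarrow> nat \<Rightarrow> nat \<Rightarrow> 'g wreath_elem" where
  "wreath_p G L N i j =
     impose_proj (wreath_free G L N) (wreath_rels G L N)
       (free_prod_inr (wreath_amalg G L N) (perm_algebra N) (perm_p N i j))"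

text \<open>Coproducts are normalised to be \<^term>\<open>undefined\<close> outside the carrier, so that a
  *-homomorphism prescribed on generators is unique as a function.\<close>

definition wreath_comult ::
  "('g, 'r) monoid_scheme \<Rightarrow> 'g set \<Rightarrow> nat \<Rightarrow>
   'g wreath_elem \<Rightarrow> ('g wreath_elem \<times> 'g wreath_elem \<Rightarrow>\<^sub>0 complex) set" where
  "wreath_comult G L N =
     (let W = wreath_algebra G L N; p = wreath_p G L N;
          \<nu> = (\<lambda>i g. wreath_nu G L N i (Poly_Mapping.single g 1))
      in THE \<Delta>. \<Delta> \<in> star_hom W (tensor W W) \<inter> extensional (carrier W) \<and>
           (\<forall>i\<in>{1..N}. \<forall>j\<in>{1..N}.
              \<Delta> (p i j) = (\<Oplus>\<^bsub>tensor W W\<^esub>k\<in>{1..N}. pure_tensor W W (p i k) (p k j))) \<and>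
           (\<forall>i\<in>{1..N}. \<forall>g\<in>carrier G.
              \<Delta> (\<nu> i g) = (\<Oplus>\<^bsub>tensor W W\<^esub>k\<in>{1..N}. pure_tensor W W (\<nu> i g \<otimes>\<^bsub>W\<^esub> p i k) (\<nu> k g))))"


section \<open>The quantum reflection algebras\<close>

type_synonym 'g refl_pre = "(nat \<times> nat \<times> 'g) free_star set"
type_synonym 'g refl_elem = "'g refl_pre set"

definition refl_gens :: "('g, 'r) monoid_scheme \<Rightarrow> nat \<Rightarrow> (nat \<times> nat \<times> 'g) set" where
  "refl_gens G N = {1..N} \<times> {1..N} \<times> carrier G"

definition refl_rels ::
  "('g, 'r) monoid_scheme \<Rightarrow> nat \<Rightarrow> ((nat \<times> nat \<times> 'g) free_star \<times> (nat \<times> nat \<times> 'g) free_star) set"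
  where
  "refl_rels G N =
     (let F = free_star_algebra (refl_gens G N);
          a = (\<lambda>i j g. free_gen (i, j, g))
      in
        {(star F (a i j g), a i j (inv\<^bsub>G\<^esub> g)) | i j g.
           i \<in> {1..N} \<and> j \<in> {1..N} \<and> g \<in> carrier G} \<union>
        {(a i j g \<otimes>\<^bsub>F\<^esub> a i k h, if j = k then a i j (g \<otimes>\<^bsub>G\<^esub> h) else \<zero>\<^bsub>F\<^esub>) | i j k g h.
           i \<in> {1..N} \<and> j \<in> {1..N} \<and> k \<in> {1..N} \<and> g \<in> carrier G \<and> h \<in> carrier G} \<union>
        {(a j i g \<otimes>\<^bsub>F\<^esub> a k i h, if j = k then a j i (g \<otimes>\<^bsub>G\<^esub> h) else \<zero>\<^bsub>F\<^esub>) | i j k g h.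
           i \<in> {1..N} \<and> j \<in> {1..N} \<and> k \<in> {1..N} \<and> g \<in> carrier G \<and> h \<in> carrier G} \<union>
        {(\<Oplus>\<^bsub>F\<^esub>k\<in>{1..N}. a i k \<one>\<^bsub>G\<^esub>, \<one>\<^bsub>F\<^esub>) | i. i \<in> {1..N}} \<union>
        {(\<Oplus>\<^bsub>F\<^esub>k\<in>{1..N}. a k j \<one>\<^bsub>G\<^esub>, \<one>\<^bsub>F\<^esub>) | j. j \<in> {1..N}})"

definition refl_algebra :: "('g, 'r) monoid_scheme \<Rightarrow> nat \<Rightarrow> 'g refl_pre star_algebra" where
  "refl_algebra G N = presented (refl_gens G N) (refl_rels G N)"

definition refl_gen :: "('g, 'r) monoid_scheme \<Rightarrow> nat \<Rightarrow> nat \<Rightarrow> nat \<Rightarrow> 'g \<Rightarrow> 'g refl_pre" where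
  "refl_gen G N i j g = presented_gen (refl_gens G N) (refl_rels G N) (i, j, g)"

definition refl_comult ::
  "('g, 'r) monoid_scheme \<Rightarrow> nat \<Rightarrow> 'g refl_pre \<Rightarrow> ('g refl_pre \<times> 'g refl_pre \<Rightarrow>\<^sub>0 complex) set" where
  "refl_comult G N =
     (let H = refl_algebra G N; a = refl_gen G N
      in THE \<Delta>. \<Delta> \<in> star_hom H (tensor H H) \<inter> extensional (carrier H) \<and>
           (\<forall>i\<in>{1..N}. \<forall>j\<in>{1..N}. \<forall>g\<in>carrier G.
              \<Delta> (a i j g) = (\<Oplus>\<^bsub>tensor H H\<^esub>k\<in>{1..N}. pure_tensor H H (a i k g) (a k j g))))"

definition refl_sub_ideal :: "('g, 'r) monoid_scheme \<Rightarrow> 'g set \<Rightarrow> nat \<Rightarrow> 'g refl_pre set" where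
  "refl_sub_ideal G L N =
     (let H = refl_algebra G N; a = refl_gen G N
      in hopf_star_ideal_gen H (refl_comult G N)
           (differences H
             {(\<Oplus>\<^bsub>H\<^esub>k\<in>{1..N}. a i k g, \<Oplus>\<^bsub>H\<^esub>k\<in>{1..N}. a j k g) | i j g.
                i \<in> {1..N} \<and> j \<in> {1..N} \<and> g \<in> L}))"

definition refl_sub_algebra ::
  "('g, 'r) monoid_scheme \<Rightarrow> 'g set \<Rightarrow> nat \<Rightarrow> 'g refl_elem star_algebra" where
  "refl_sub_algebra G L N = star_quotient (refl_algebra G N) (refl_sub_ideal G L N)"

definition refl_sub_gen ::
  "('g, 'r) monoid_scheme \<Rightarrow> 'g set \<Rightarrow> nat \<Rightarrow> nat \<Rightarrow> nat \<Rightarrow> 'g \<Rightarrow> 'g refl_elem" where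
  "refl_sub_gen G L N i j g = refl_sub_ideal G L N +>\<^bsub>refl_algebra G N\<^esub> refl_gen G N i j g"

end

theory Submission
  imports Defs
begin

text \<open>Write \<open>u\<^sub>i(g) = \<Sum>\<^sub>k a\<^sub>i\<^sub>k(g)\<close>. For fixed \<open>i\<close> this is a unitary representation of \<open>\<Gamma>\<close>, it commutes
  with \<open>a\<^sub>i\<^sub>j(e)\<close>, and \<open>u\<^sub>i(g) a\<^sub>i\<^sub>j(e) = a\<^sub>i\<^sub>j(g)\<close>; the relations of \<open>H\<^sub>N\<^sup>+(\<Gamma>, \<Lambda>)\<close> say that
  \<open>u\<^sub>i(g)\<close> does not depend on \<open>i\<close> for \<open>g \<in> \<Lambda>\<close>. Hence \<open>\<nu>\<^sub>i(g) \<mapsto> u\<^sub>i(g)\<close>, \<open>p\<^sub>i\<^sub>j \<mapsto> a\<^sub>i\<^sub>j(e)\<close> and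
  \<open>a\<^sub>i\<^sub>j(g) \<mapsto> \<nu>\<^sub>i(g) p\<^sub>i\<^sub>j\<close> are mutually inverse, and they match the coproducts. The *-ideal generated
  by the differences \<open>u\<^sub>i(g) - u\<^sub>j(g)\<close> is already a Hopf *-ideal: modulo it the coproduct maps
  \<open>u\<^sub>i(g)\<close> to \<open>u\<^sub>1(g) \<otimes> u\<^sub>1(g)\<close>, and the column sums of \<open>a(g)\<close> agree with its row sums.\<close>

section \<open>Unital *-algebras and *-homomorphisms\<close>

text \<open>The definitions shape the argument in two places. The generated Hopf *-ideal is an
  intersection over all Hopf *-ideals that contain the relations, and being one includes the
  existence of a counit and an antipode. So the full Hopf structure of the algebra for \<Gamma>
  alone has to be established before the *-ideal of the relations can be recognised as a member of
  that intersection. The coproducts are definite descriptions, so existence and uniqueness must both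
  be settled before any value can be used. Existence always comes from a universal property:
  coproduct, counit and antipode correspond to families satisfying the reflection relations in the
  tensor square, in the complex numbers and in the opposite algebra. For the wreath product the
  coproduct is not checked against the relations of that algebra; it is carried over from the
  quotient of the reflection algebra along the map that turns out to be the isomorphism.\<close>

locale star_alg = ring A for A :: "'a star_algebra" (structure) +
  assumes smult_closed [simp, intro]: "x \<in> carrier A \<Longrightarrow> c \<odot> x \<in> carrier A"
    and smult_l_distr: "x \<in> carrier A \<Longrightarrow> (c + d) \<odot> x = c \<odot> x \<oplus> d \<odot> x"
    and smult_r_distr: "x \<in> carrier A \<Longrightarrow> y \<in> carrier A \<Longrightarrow> c \<odot> (x \<oplus> y) = c \<odot> x \<oplus> c \<odot> y"
    and smult_smult: "x \<in> carrier A \<Longrightarrow> c \<odot> (d \<odot> x) = (c * d) \<odot> x"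
    and smult_one [simp]: "x \<in> carrier A \<Longrightarrow> 1 \<odot> x = x"
    and smult_mult_l: "x \<in> carrier A \<Longrightarrow> y \<in> carrier A \<Longrightarrow> (c \<odot> x) \<otimes> y = c \<odot> (x \<otimes> y)"
    and smult_mult_r: "x \<in> carrier A \<Longrightarrow> y \<in> carrier A \<Longrightarrow> x \<otimes> (c \<odot> y) = c \<odot> (x \<otimes> y)"
    and star_closed [simp, intro]: "x \<in> carrier A \<Longrightarrow> star A x \<in> carrier A"
    and star_add: "x \<in> carrier A \<Longrightarrow> y \<in> carrier A \<Longrightarrow> star A (x \<oplus> y) = star A x \<oplus> star A y"
    and star_smult: "x \<in> carrier A \<Longrightarrow> star A (c \<odot> x) = cnj c \<odot> star A x"
    and star_mult: "x \<in> carrier A \<Longrightarrow> y \<in> carrier A \<Longrightarrow> star A (x \<otimes> y) = star A y \<otimes> star A x"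
    and star_star [simp]: "x \<in> carrier A \<Longrightarrow> star A (star A x) = x"
begin

lemma smult_zero_l [simp]: "x \<in> carrier A \<Longrightarrow> 0 \<odot> x = \<zero>"
  using smult_l_distr[of x 0 0] add.r_cancel_one'[of "0 \<odot> x" "0 \<odot> x"] by simp

lemma smult_zero_r [simp]: "c \<odot> \<zero> = \<zero>"
  using smult_r_distr[of \<zero> \<zero> c] add.r_cancel_one'[of "c \<odot> \<zero>" "c \<odot> \<zero>"] by simp

lemma star_zero [simp]: "star A \<zero> = \<zero>"
  using star_add[of \<zero> \<zero>] add.r_cancel_one'[of "star A \<zero>" "star A \<zero>"] by simp

lemma star_one [simp]: "star A \<one> = \<one>"
  using star_mult[of "star A \<one>" \<one>] by simp

text \<open>Since \<open>-1\<close> is a scalar, additive inverses come from the linear structure.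
  Whatever respects sums and scalars therefore respects differences, and negatives need no separate
  treatment for homomorphisms, ideals or bilinear maps.\<close>

lemma minus_eq_smult: "x \<in> carrier A \<Longrightarrow> \<ominus> x = (-1) \<odot> x"
  using smult_l_distr[of x "1" "-1"] by (intro minus_equality) (auto simp: a_comm)

lemma diff_eq_smult: "x \<in> carrier A \<Longrightarrow> y \<in> carrier A \<Longrightarrow> x \<ominus> y = x \<oplus> (-1) \<odot> y"
  by (simp add: a_minus_def minus_eq_smult)

end

text \<open>The axioms are equations between operations, so they pass to surjective images.\<close>

lemma star_alg_image:
  assumes "star_alg A" and car: "carrier B = f ` carrier A"
    and ops: "\<zero>\<^bsub>B\<^esub> = f \<zero>\<^bsub>A\<^esub>" "\<one>\<^bsub>B\<^esub> = f \<one>\<^bsub>A\<^esub>"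
    "\<And>x y. x \<in> carrier A \<Longrightarrow> y \<in> carrier A \<Longrightarrow> f x \<oplus>\<^bsub>B\<^esub> f y = f (x \<oplus>\<^bsub>A\<^esub> y)"
    "\<And>x y. x \<in> carrier A \<Longrightarrow> y \<in> carrier A \<Longrightarrow> f x \<otimes>\<^bsub>B\<^esub> f y = f (x \<otimes>\<^bsub>A\<^esub> y)"
    "\<And>c x. x \<in> carrier A \<Longrightarrow> c \<odot>\<^bsub>B\<^esub> f x = f (c \<odot>\<^bsub>A\<^esub> x)"
    "\<And>x. x \<in> carrier A \<Longrightarrow> star B (f x) = f (star A x)"
  shows "star_alg B"
proof -
  interpret A: star_alg A by fact
  note alg = A.smult_l_distr A.smult_r_distr A.smult_smult A.smult_mult_l A.smult_mult_r
    A.star_add A.star_smult A.star_mult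
  show ?thesis
  proof (intro star_alg.intro ringI abelian_groupI monoidI star_alg_axioms.intro)
    fix x assume "x \<in> carrier B"
    then obtain a where "a \<in> carrier A" "x = f a" using car by auto
    then show "\<exists>y\<in>carrier B. y \<oplus>\<^bsub>B\<^esub> x = \<zero>\<^bsub>B\<^esub>"
      by (auto simp: car ops A.l_neg intro!: bexI[of _ "\<ominus>\<^bsub>A\<^esub> a"])
  qed (auto simp: car ops alg A.a_ac A.m_assoc A.l_distr A.r_distr)
qed

section \<open>Unital *-homomorphisms and finite sums\<close>

lemma star_homI:
  assumes "\<And>x. x \<in> carrier A \<Longrightarrow> f x \<in> carrier B"
    "\<And>x y. x \<in> carrier A \<Longrightarrow> y \<in> carrier A \<Longrightarrow> f (x \<oplus>\<^bsub>A\<^esub> y) = f x \<oplus>\<^bsub>B\<^esub> f y"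
    "\<And>x y. x \<in> carrier A \<Longrightarrow> y \<in> carrier A \<Longrightarrow> f (x \<otimes>\<^bsub>A\<^esub> y) = f x \<otimes>\<^bsub>B\<^esub> f y"
    "f \<one>\<^bsub>A\<^esub> = \<one>\<^bsub>B\<^esub>"
    "\<And>c x. x \<in> carrier A \<Longrightarrow> f (c \<odot>\<^bsub>A\<^esub> x) = c \<odot>\<^bsub>B\<^esub> f x"
    "\<And>x. x \<in> carrier A \<Longrightarrow> f (star A x) = star B (f x)"
  shows "f \<in> star_hom A B"
  using assms by (auto simp: star_hom_def ring_hom_def)

lemma star_homD:
  assumes "f \<in> star_hom A B"
  shows "\<And>x. x \<in> carrier A \<Longrightarrow> f x \<in> carrier B"
    "\<And>x y. x \<in> carrier A \<Longrightarrow> y \<in> carrier A \<Longrightarrow> f (x \<oplus>\<^bsub>A\<^esub> y) = f x \<oplus>\<^bsub>B\<^esub> f y"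
    "\<And>x y. x \<in> carrier A \<Longrightarrow> y \<in> carrier A \<Longrightarrow> f (x \<otimes>\<^bsub>A\<^esub> y) = f x \<otimes>\<^bsub>B\<^esub> f y"
    "f \<one>\<^bsub>A\<^esub> = \<one>\<^bsub>B\<^esub>"
    "\<And>c x. x \<in> carrier A \<Longrightarrow> f (c \<odot>\<^bsub>A\<^esub> x) = c \<odot>\<^bsub>B\<^esub> f x"
    "\<And>x. x \<in> carrier A \<Longrightarrow> f (star A x) = star B (f x)"
  using assms by (auto simp: star_hom_def ring_hom_def)

lemma star_hom_comp: "f \<in> star_hom A B \<Longrightarrow> g \<in> star_hom B C \<Longrightarrow> (\<lambda>x. g (f x)) \<in> star_hom A C"
  by (rule star_homI) (auto simp: star_homD)

lemma star_hom_id: "(\<lambda>x. x) \<in> star_hom A A"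
  by (rule star_homI) auto

text \<open>Being a *-homomorphism constrains the values on the carrier only. Coproducts are
  normalised to be \<open>undefined\<close> elsewhere, and this is what allows a homomorphism to be
  replaced by its restriction.\<close>

lemma star_hom_cong:
  assumes "star_alg A" "f \<in> star_hom A B" "\<And>x. x \<in> carrier A \<Longrightarrow> g x = f x"
  shows "g \<in> star_hom A B"
proof -
  interpret A: star_alg A by fact
  show ?thesis by (rule star_homI) (use assms in \<open>auto simp: star_homD[OF assms(2)]\<close>)
qed

lemma star_hom_zero:
  assumes "star_alg A" "star_alg B" "f \<in> star_hom A B" shows "f \<zero>\<^bsub>A\<^esub> = \<zero>\<^bsub>B\<^esub>"
proof -
  interpret A: star_alg A by fact
  interpret B: star_alg B by fact
  show ?thesis
    using star_homD(5)[OF assms(3), of "\<zero>\<^bsub>A\<^esub>" 0] star_homD(1)[OF assms(3), of "\<zero>\<^bsub>A\<^esub>"] by simp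
qed

lemma star_hom_diff:
  assumes "star_alg A" "star_alg B" "f \<in> star_hom A B" "x \<in> carrier A" "y \<in> carrier A"
  shows "f (x \<ominus>\<^bsub>A\<^esub> y) = f x \<ominus>\<^bsub>B\<^esub> f y"
proof -
  interpret A: star_alg A by fact
  interpret B: star_alg B by fact
  show ?thesis
    using assms(4,5) by (simp add: A.diff_eq_smult B.diff_eq_smult star_homD[OF assms(3)])
qed

text \<open>Only additivity is assumed because many maps it is applied to are not *-homomorphisms:
  scalar multiplication, the antilinear involution, one leg of a pure tensor, and linear maps
  induced on a tensor product.\<close>

lemma additive_finsum:
  assumes "abelian_monoid A" "abelian_monoid B" "f \<zero>\<^bsub>A\<^esub> = \<zero>\<^bsub>B\<^esub>"
    "\<And>x y. x \<in> carrier A \<Longrightarrow> y \<in> carrier A \<Longrightarrow> f (x \<oplus>\<^bsub>A\<^esub> y) = f x \<oplus>\<^bsub>B\<^esub> f y"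
    "\<And>x. x \<in> carrier A \<Longrightarrow> f x \<in> carrier B" "g \<in> K \<rightarrow> carrier A"
  shows "f (\<Oplus>\<^bsub>A\<^esub>k\<in>K. g k) = (\<Oplus>\<^bsub>B\<^esub>k\<in>K. f (g k))"
proof -
  interpret A: abelian_monoid A by fact
  interpret B: abelian_monoid B by fact
  show ?thesis using assms(6)
  proof (induction K rule: infinite_finite_induct)
    case (insert x K)
    then have "g \<in> K \<rightarrow> carrier A" "(\<lambda>k. f (g k)) \<in> K \<rightarrow> carrier B" "g x \<in> carrier A"
      using assms(5) by auto
    then show ?case
      using insert assms(4,5) by (simp add: A.finsum_insert B.finsum_insert)
  qed (auto simp: assms(3))
qed

lemma star_hom_finsum:
  assumes "star_alg A" "star_alg B" "f \<in> star_hom A B" "g \<in> K \<rightarrow> carrier A"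
  shows "f (\<Oplus>\<^bsub>A\<^esub>k\<in>K. g k) = (\<Oplus>\<^bsub>B\<^esub>k\<in>K. f (g k))"
proof -
  interpret A: star_alg A by fact
  interpret B: star_alg B by fact
  show ?thesis
    by (rule additive_finsum)
      (use assms(4) star_homD[OF assms(3)] star_hom_zero[OF assms(1-3)]
        A.abelian_monoid_axioms B.abelian_monoid_axioms in auto)
qed

text \<open>Phrased as an induction principle rather than as a closure. \<open>V\<close> ranges over
  all sets, with closure demanded only inside the carrier, so that the extension of any predicate
  can be substituted for \<open>V\<close>.\<close>

definition star_generates :: "'a star_algebra \<Rightarrow> 'a set \<Rightarrow> bool" where
  "star_generates A S \<longleftrightarrow> S \<subseteq> carrier A \<and>
     (\<forall>V. S \<subseteq> V \<longrightarrow> \<one>\<^bsub>A\<^esub> \<in> V \<longrightarrow>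
        (\<forall>x\<in>V \<inter> carrier A. \<forall>y\<in>V \<inter> carrier A. x \<oplus>\<^bsub>A\<^esub> y \<in> V \<and> x \<otimes>\<^bsub>A\<^esub> y \<in> V) \<longrightarrow>
        (\<forall>x\<in>V \<inter> carrier A. star A x \<in> V \<and> (\<forall>c. c \<odot>\<^bsub>A\<^esub> x \<in> V)) \<longrightarrow> carrier A \<subseteq> V)"

lemma star_generates_induct [consumes 2, case_names gen one add mult star smult]:
  assumes "star_generates A S" "x \<in> carrier A"
    "\<And>x. x \<in> S \<Longrightarrow> P x" "P \<one>\<^bsub>A\<^esub>"
    "\<And>x y. x \<in> carrier A \<Longrightarrow> y \<in> carrier A \<Longrightarrow> P x \<Longrightarrow> P y \<Longrightarrow> P (x \<oplus>\<^bsub>A\<^esub> y)"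
    "\<And>x y. x \<in> carrier A \<Longrightarrow> y \<in> carrier A \<Longrightarrow> P x \<Longrightarrow> P y \<Longrightarrow> P (x \<otimes>\<^bsub>A\<^esub> y)"
    "\<And>x. x \<in> carrier A \<Longrightarrow> P x \<Longrightarrow> P (star A x)"
    "\<And>c x. x \<in> carrier A \<Longrightarrow> P x \<Longrightarrow> P (c \<odot>\<^bsub>A\<^esub> x)"
  shows "P x"
proof -
  have "S \<subseteq> Collect P \<longrightarrow> \<one>\<^bsub>A\<^esub> \<in> Collect P \<longrightarrow>
        (\<forall>x\<in>Collect P \<inter> carrier A. \<forall>y\<in>Collect P \<inter> carrier A.
           x \<oplus>\<^bsub>A\<^esub> y \<in> Collect P \<and> x \<otimes>\<^bsub>A\<^esub> y \<in> Collect P) \<longrightarrow>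
        (\<forall>x\<in>Collect P \<inter> carrier A. star A x \<in> Collect P \<and> (\<forall>c. c \<odot>\<^bsub>A\<^esub> x \<in> Collect P)) \<longrightarrow>
        carrier A \<subseteq> Collect P"
    using assms(1) unfolding star_generates_def by blast
  then show ?thesis using assms(2-) by auto
qed

text \<open>The set on which two *-homomorphisms agree is closed under all operations. The
  uniqueness statements below and both inverse laws of the isomorphism rest on this.\<close>

lemma star_hom_eqI:
  assumes "star_generates A S" "f \<in> star_hom A B" "g \<in> star_hom A B"
    "\<And>x. x \<in> S \<Longrightarrow> f x = g x" "x \<in> carrier A"
  shows "f x = g x"
  using assms(1,5)
  by (induction rule: star_generates_induct)
    (auto simp: assms(4) star_homD[OF assms(2)] star_homD[OF assms(3)])

text \<open>The preimage under \<open>f\<close> of a set closed under the operations is again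
  closed, and \<open>f\<close> is onto.\<close>

lemma star_generates_image:
  assumes "star_alg A" "star_generates A S" "f \<in> star_hom A B" "carrier B = f ` carrier A"
  shows "star_generates B (f ` S)"
proof -
  interpret A: star_alg A by fact
  have "carrier B \<subseteq> V" if V: "f ` S \<subseteq> V" "\<one>\<^bsub>B\<^esub> \<in> V"
    "\<forall>x\<in>V \<inter> carrier B. \<forall>y\<in>V \<inter> carrier B. x \<oplus>\<^bsub>B\<^esub> y \<in> V \<and> x \<otimes>\<^bsub>B\<^esub> y \<in> V"
    "\<forall>x\<in>V \<inter> carrier B. star B x \<in> V \<and> (\<forall>c. c \<odot>\<^bsub>B\<^esub> x \<in> V)" for V
  proof -
    have "f x \<in> V" if "x \<in> carrier A" for x
      using assms(2) that
      by (induction rule: star_generates_induct)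
        (use V in \<open>auto simp: star_homD[OF assms(3)]\<close>)
    then show ?thesis using assms(4) by auto
  qed
  moreover have "f ` S \<subseteq> carrier B"
    using assms(2,4) by (auto simp: star_generates_def)
  ultimately show ?thesis unfolding star_generates_def by blast
qed

section \<open>Quotients\<close>

text \<open>Closure under negatives comes from absorption: \<open>\<ominus> x\<close> is the product
  of \<open>-1 \<odot> \<one>\<close> with \<open>x\<close>.\<close>

lemma (in star_alg) star_idealI:
  assumes "I \<subseteq> carrier A" "\<zero> \<in> I" "\<And>x y. x \<in> I \<Longrightarrow> y \<in> I \<Longrightarrow> x \<oplus> y \<in> I"
    "\<And>a x. a \<in> carrier A \<Longrightarrow> x \<in> I \<Longrightarrow> a \<otimes> x \<in> I"
    "\<And>a x. a \<in> carrier A \<Longrightarrow> x \<in> I \<Longrightarrow> x \<otimes> a \<in> I"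
    "\<And>x. x \<in> I \<Longrightarrow> star A x \<in> I"
  shows "star_ideal I A"
  unfolding star_ideal_def
proof (intro conjI idealI subgroup.intro ballI)
  fix x assume x: "x \<in> I"
  then have "x \<in> carrier A" using assms(1) by auto
  then have "\<ominus> x = (-1 \<odot> \<one>) \<otimes> x" by (simp add: minus_eq_smult smult_mult_l)
  then show "inv\<^bsub>add_monoid A\<^esub> x \<in> I"
    using assms(4)[OF _ x, of "-1 \<odot> \<one>"] by (simp add: a_inv_def)
qed (use assms ring_axioms in auto)

lemma (in star_alg) star_ideal_Inter:
  assumes "\<And>I. I \<in> F \<Longrightarrow> star_ideal I A" "F \<noteq> {}"
  shows "star_ideal (\<Inter>F) A"
  using i_Intersect[of F] assms by (fastforce simp: star_ideal_def)

text \<open>Guarantees that the intersection defining \<open>star_ideal_gen\<close> runs over a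
  nonempty family; over an empty one it would be the whole type.\<close>

lemma (in star_alg) star_ideal_carrier: "star_ideal (carrier A) A"
  by (rule star_idealI) auto

lemma (in star_alg) star_ideal_star_ideal_gen:
  "S \<subseteq> carrier A \<Longrightarrow> star_ideal (star_ideal_gen A S) A"
  unfolding star_ideal_gen_def using star_ideal_carrier by (intro star_ideal_Inter) auto

lemma star_ideal_gen_superset: "S \<subseteq> star_ideal_gen A S"
  by (auto simp: star_ideal_gen_def)

lemma star_ideal_gen_least: "star_ideal I A \<Longrightarrow> S \<subseteq> I \<Longrightarrow> star_ideal_gen A S \<subseteq> I"
  by (auto simp: star_ideal_gen_def)

lemma star_ideal_kernel:
  assumes "star_alg A" "star_alg B" "f \<in> star_hom A B"
  shows "star_ideal {x \<in> carrier A. f x = \<zero>\<^bsub>B\<^esub>} A"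
proof -
  interpret A: star_alg A by fact
  interpret B: star_alg B by fact
  show ?thesis
    by (rule A.star_idealI) (auto simp: star_homD[OF assms(3)] star_hom_zero[OF assms])
qed

locale star_quot = star_alg A for A :: "'a star_algebra" (structure) and I +
  assumes star_ideal: "star_ideal I A"
begin

sublocale ideal I A
  using star_ideal by (simp add: star_ideal_def)

lemma carrier_star_quotient: "carrier (star_quotient A I) = (+>) I ` carrier A"
  by (auto simp: star_quotient_def FactRing_def A_RCOSETS_def' )

lemma zero_star_quotient: "\<zero>\<^bsub>star_quotient A I\<^esub> = I +> \<zero>"
  by (simp add: star_quotient_def FactRing_def a_coset_add_zero a_subset)

lemma one_star_quotient: "\<one>\<^bsub>star_quotient A I\<^esub> = I +> \<one>"
  by (simp add: star_quotient_def FactRing_def)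

lemma add_star_quotient:
  "x \<in> carrier A \<Longrightarrow> y \<in> carrier A \<Longrightarrow> (I +> x) \<oplus>\<^bsub>star_quotient A I\<^esub> (I +> y) = I +> (x \<oplus> y)"
  by (simp add: star_quotient_def FactRing_def a_rcos_sum)

lemma mult_star_quotient:
  "x \<in> carrier A \<Longrightarrow> y \<in> carrier A \<Longrightarrow> (I +> x) \<otimes>\<^bsub>star_quotient A I\<^esub> (I +> y) = I +> (x \<otimes> y)"
  by (simp add: star_quotient_def FactRing_def rcoset_mult_add)

lemma rcos_eq_iff: "x \<in> carrier A \<Longrightarrow> y \<in> carrier A \<Longrightarrow> I +> x = I +> y \<longleftrightarrow> x \<ominus> y \<in> I"
  using quotient_eq_iff_same_a_r_cos[of I x y] is_ideal by auto

lemma mem_rcosE: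
  assumes "x \<in> I +> a" "a \<in> carrier A" obtains i where "i \<in> I" "i \<in> carrier A" "x = i \<oplus> a"
  using assms a_subset by (auto simp: a_r_coset_def')

lemma rcos_self: "a \<in> carrier A \<Longrightarrow> a \<in> I +> a"
  by (rule a_rcos_self)

lemma rcos_absorb: "i \<in> I \<Longrightarrow> a \<in> carrier A \<Longrightarrow> I +> (i \<oplus> a) = I +> a"
  using a_coset_add_assoc a_rcos_const a_subset by (metis Icarr)

lemma smult_in_ideal: "i \<in> I \<Longrightarrow> c \<odot> i \<in> I"
  using I_l_closed[of i "c \<odot> \<one>"] Icarr by (simp add: smult_mult_l)

text \<open>The operation is defined as a union over all representatives. An ideal is stable under
  scalars, so every representative contributes the same coset and the union is that coset.\<close>

lemma smult_star_quotient:
  assumes "a \<in> carrier A" shows "c \<odot>\<^bsub>star_quotient A I\<^esub> (I +> a) = I +> (c \<odot> a)"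
proof -
  have "I +> (c \<odot> x) = I +> (c \<odot> a)" if "x \<in> I +> a" for x
  proof -
    obtain i where "i \<in> I" "i \<in> carrier A" "x = i \<oplus> a" using \<open>x \<in> I +> a\<close> assms by (rule mem_rcosE)
    then show ?thesis using assms by (simp add: smult_r_distr smult_in_ideal rcos_absorb)
  qed
  then have "(\<Union>x\<in>I +> a. I +> (c \<odot> x)) = I +> (c \<odot> a)" using rcos_self[OF assms] by blast
  then show ?thesis by (simp add: star_quotient_def)
qed

lemma star_star_quotient:
  assumes "a \<in> carrier A" shows "star (star_quotient A I) (I +> a) = I +> star A a"
proof -
  have "star A i \<in> I" if "i \<in> I" for i using star_ideal that by (simp add: star_ideal_def)
  then have "I +> star A x = I +> star A a" if "x \<in> I +> a" for x
  proof -
    obtain i where "i \<in> I" "i \<in> carrier A" "x = i \<oplus> a" using \<open>x \<in> I +> a\<close> assms by (rule mem_rcosE)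
    then show ?thesis using assms \<open>\<And>i. i \<in> I \<Longrightarrow> star A i \<in> I\<close> by (simp add: star_add rcos_absorb)
  qed
  then have "(\<Union>x\<in>I +> a. I +> star A x) = I +> star A a" using rcos_self[OF assms] by blast
  then show ?thesis by (simp add: star_quotient_def)
qed

lemma star_alg_star_quotient: "star_alg (star_quotient A I)"
  by (rule star_alg_image[OF star_alg_axioms carrier_star_quotient])
    (auto simp: zero_star_quotient one_star_quotient add_star_quotient mult_star_quotient
      smult_star_quotient star_star_quotient)

lemma rcos_star_hom: "(+>) I \<in> star_hom A (star_quotient A I)"
  by (rule star_homI)
    (auto simp: carrier_star_quotient one_star_quotient add_star_quotient mult_star_quotient
      smult_star_quotient star_star_quotient)

lemma rcos_eq_zero_iff: "x \<in> carrier A \<Longrightarrow> I +> x = \<zero>\<^bsub>star_quotient A I\<^esub> \<longleftrightarrow> x \<in> I"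
  by (simp add: zero_star_quotient rcos_eq_iff minus_eq)

lemma star_quotient_lift:
  assumes "star_alg B" "f \<in> star_hom A B" "\<And>x. x \<in> I \<Longrightarrow> f x = \<zero>\<^bsub>B\<^esub>"
  shows "\<exists>h\<in>star_hom (star_quotient A I) B. \<forall>x\<in>carrier A. h (I +> x) = f x"
proof -
  interpret B: star_alg B by fact
  \<comment> \<open>Any representative will do: two of them differ by an element of
    \<open>I\<close>, which \<open>f\<close> kills.\<close>
  define h where "h X = f (SOME x. x \<in> X)" for X
  have h: "h (I +> a) = f a" if a: "a \<in> carrier A" for a
  proof -
    have "(SOME x. x \<in> I +> a) \<in> I +> a" using rcos_self[OF a] by (rule someI)
    then obtain i where "i \<in> I" "i \<in> carrier A" "(SOME x. x \<in> I +> a) = i \<oplus> a"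
      using a by (rule mem_rcosE)
    then show ?thesis using a assms(3) star_homD[OF assms(2)] by (simp add: h_def)
  qed
  have "h \<in> star_hom (star_quotient A I) B"
    by (rule star_homI)
      (auto simp: carrier_star_quotient one_star_quotient add_star_quotient mult_star_quotient
        smult_star_quotient star_star_quotient h star_homD[OF assms(2)])
  then show ?thesis using h by blast
qed

end

section \<open>Quotients by imposed relations\<close>

lemma (in star_alg) differences_subset:
  "R \<subseteq> carrier A \<times> carrier A \<Longrightarrow> differences A R \<subseteq> carrier A"
  by (auto simp: differences_def)

lemma (in star_alg) star_quot_impose:
  "R \<subseteq> carrier A \<times> carrier A \<Longrightarrow> star_quot A (star_ideal_gen A (differences A R))"
  by (intro star_quot.intro star_alg_axioms star_quot_axioms.intro star_ideal_star_ideal_gen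
      differences_subset)

text \<open>The kernel of \<open>f\<close> is a *-ideal and contains the difference of the two sides
  of every relation, hence it contains the generated *-ideal.\<close>

lemma star_hom_vanish_gen:
  assumes "star_alg A" "star_alg B" "f \<in> star_hom A B" "R \<subseteq> carrier A \<times> carrier A"
    "\<And>l r. (l, r) \<in> R \<Longrightarrow> f l = f r" "x \<in> star_ideal_gen A (differences A R)"
  shows "f x = \<zero>\<^bsub>B\<^esub>"
proof -
  interpret A: star_alg A by fact
  interpret B: star_alg B by fact
  have "differences A R \<subseteq> {x \<in> carrier A. f x = \<zero>\<^bsub>B\<^esub>}"
  proof
    fix x assume "x \<in> differences A R"
    then obtain l r where lr: "(l, r) \<in> R" "x = l \<ominus>\<^bsub>A\<^esub> r" by (auto simp: differences_def)
    then have "l \<in> carrier A" "r \<in> carrier A" using assms(4) by auto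
    then show "x \<in> {x \<in> carrier A. f x = \<zero>\<^bsub>B\<^esub>}"
      using lr assms(5) star_homD(1)[OF assms(3)] by (simp add: star_hom_diff[OF assms(1-3)] B.minus_eq B.r_neg)
  qed
  from star_ideal_gen_least[OF star_ideal_kernel[OF assms(1-3)] this] show ?thesis
    using assms(6) by auto
qed

context star_alg
begin

context
  fixes R assumes R: "R \<subseteq> carrier A \<times> carrier A"
begin

interpretation Q: star_quot A "star_ideal_gen A (differences A R)"
  by (rule star_quot_impose[OF R])

lemma star_alg_impose: "star_alg (impose A R)"
  unfolding impose_def by (rule Q.star_alg_star_quotient)

lemma impose_proj_star_hom: "impose_proj A R \<in> star_hom A (impose A R)"
  unfolding impose_def using Q.rcos_star_hom by (simp add: impose_proj_def[abs_def])

lemma carrier_impose: "carrier (impose A R) = impose_proj A R ` carrier A"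
  unfolding impose_def by (simp add: Q.carrier_star_quotient impose_proj_def)

lemma impose_proj_eq: "(l, r) \<in> R \<Longrightarrow> impose_proj A R l = impose_proj A R r"
proof -
  assume lr: "(l, r) \<in> R"
  then have "l \<in> carrier A" "r \<in> carrier A" "l \<ominus> r \<in> star_ideal_gen A (differences A R)"
    using R star_ideal_gen_superset[of "differences A R" A] by (auto simp: differences_def)
  then show ?thesis by (simp add: impose_proj_def Q.rcos_eq_iff)
qed

lemma impose_lift:
  assumes "star_alg B" "f \<in> star_hom A B" "\<And>l r. (l, r) \<in> R \<Longrightarrow> f l = f r"
  shows "\<exists>h\<in>star_hom (impose A R) B. \<forall>x\<in>carrier A. h (impose_proj A R x) = f x"
  unfolding impose_def impose_proj_def
  by (rule Q.star_quotient_lift[OF assms(1,2)])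
    (rule star_hom_vanish_gen[OF star_alg_axioms assms(1,2) R assms(3)])

end

end

section \<open>Monoid algebras and presented algebras\<close>

lemma keys_subset_induct [consumes 1, case_names zero single add]:
  fixes f :: "'m \<Rightarrow>\<^sub>0 complex"
  assumes "Poly_Mapping.keys f \<subseteq> S" "P 0" "\<And>x c. x \<in> S \<Longrightarrow> P (Poly_Mapping.single x c)"
    "\<And>f g. Poly_Mapping.keys f \<subseteq> S \<Longrightarrow> Poly_Mapping.keys g \<subseteq> S \<Longrightarrow> P f \<Longrightarrow> P g \<Longrightarrow> P (f + g)"
  shows "P f"
proof -
  have f: "f = (\<Sum>x\<in>Poly_Mapping.keys f. Poly_Mapping.single x (Poly_Mapping.lookup f x))"
    by (rule poly_mapping_eqI) (auto simp: lookup_sum lookup_single when_def not_in_keys_iff_lookup_eq_zero)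
  let ?s = "\<lambda>K. \<Sum>x\<in>K. Poly_Mapping.single x (Poly_Mapping.lookup f x)"
  have "P (?s K) \<and> Poly_Mapping.keys (?s K) \<subseteq> S" if "finite K" "K \<subseteq> S" for K
    using that
  proof (induction K rule: finite_induct)
    case (insert x K)
    have "Poly_Mapping.keys (Poly_Mapping.single x (Poly_Mapping.lookup f x)) \<subseteq> S"
      using insert by auto
    then show ?case
      using insert keys_add[of "Poly_Mapping.single x (Poly_Mapping.lookup f x)" "?s K"]
      by (auto intro!: assms(3,4))
  qed (auto simp: assms(2))
  then show ?thesis using assms(1) f by (metis finite_keys)
qed

lemma lookup_map_mult:
  "Poly_Mapping.lookup (Poly_Mapping.map (\<lambda>z. c * z) f) x = c * Poly_Mapping.lookup f x"
  for c :: complex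
  by (simp add: Poly_Mapping.map.rep_eq when_def)

lemma keys_map_mult: "Poly_Mapping.keys (Poly_Mapping.map (\<lambda>z. c * z) f) \<subseteq> Poly_Mapping.keys f"
  for c :: complex
  by (auto simp: in_keys_iff lookup_map_mult)

text \<open>The linear extension of a map given on a basis. It serves twice: for homomorphisms out
  of monoid algebras, and for tensor products, where \<open>tensor_lift\<close> is this sum
  evaluated on a chosen representative.\<close>

definition lin_ext :: "'c star_algebra \<Rightarrow> ('m \<Rightarrow> 'c) \<Rightarrow> ('m \<Rightarrow>\<^sub>0 complex) \<Rightarrow> 'c" where
  "lin_ext V b f = (\<Oplus>\<^bsub>V\<^esub>z\<in>Poly_Mapping.keys f. Poly_Mapping.lookup f z \<odot>\<^bsub>V\<^esub> b z)"

context star_alg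
begin

text \<open>The support of a sum can be smaller than the union of the supports. Keys outside a
  support contribute \<open>0 \<odot> b z\<close>, so sums over different supports can be compared
  over one common finite set.\<close>

lemma lin_ext_superset:
  assumes "finite K" "Poly_Mapping.keys f \<subseteq> K" "b \<in> K \<rightarrow> carrier A"
  shows "lin_ext A b f = (\<Oplus>z\<in>K. Poly_Mapping.lookup f z \<odot> b z)"
  unfolding lin_ext_def
  using assms by (intro add.finprod_mono_neutral_cong_left) (auto simp: in_keys_iff Pi_iff)

lemma lin_ext_closed:
  "Poly_Mapping.keys f \<subseteq> S \<Longrightarrow> b \<in> S \<rightarrow> carrier A \<Longrightarrow> lin_ext A b f \<in> carrier A"
  unfolding lin_ext_def by (intro finsum_closed) auto

lemma lin_ext_add:
  assumes "Poly_Mapping.keys f \<subseteq> S" "Poly_Mapping.keys g \<subseteq> S" "b \<in> S \<rightarrow> carrier A"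
  shows "lin_ext A b (f + g) = lin_ext A b f \<oplus> lin_ext A b g"
proof -
  let ?K = "Poly_Mapping.keys f \<union> Poly_Mapping.keys g"
  have K: "finite ?K" "b \<in> ?K \<rightarrow> carrier A" using assms by auto
  then have "lin_ext A b (f + g) = (\<Oplus>z\<in>?K. Poly_Mapping.lookup (f + g) z \<odot> b z)"
    using keys_add[of f g] by (intro lin_ext_superset) auto
  also have "\<dots> = (\<Oplus>z\<in>?K. Poly_Mapping.lookup f z \<odot> b z \<oplus> Poly_Mapping.lookup g z \<odot> b z)"
    using K(2) by (intro finsum_cong') (auto simp: lookup_add smult_l_distr Pi_iff)
  also have "\<dots> = lin_ext A b f \<oplus> lin_ext A b g"
    using K by (subst finsum_addf) (auto simp: lin_ext_superset[OF K(1)])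
  finally show ?thesis .
qed

lemma lin_ext_single: "b x \<in> carrier A \<Longrightarrow> lin_ext A b (Poly_Mapping.single x c) = c \<odot> b x"
  by (subst lin_ext_superset[of "{x}"]) auto

lemma lin_ext_zero: "lin_ext A b 0 = \<zero>"
  by (simp add: lin_ext_def)

lemma smult_finsum:
  assumes "g \<in> K \<rightarrow> carrier A" shows "c \<odot> (\<Oplus>k\<in>K. g k) = (\<Oplus>k\<in>K. c \<odot> g k)"
  by (rule additive_finsum[OF abelian_monoid_axioms abelian_monoid_axioms])
    (use assms in \<open>auto simp: smult_r_distr\<close>)

lemma lin_ext_smult:
  assumes "Poly_Mapping.keys f \<subseteq> S" "b \<in> S \<rightarrow> carrier A"
  shows "lin_ext A b (Poly_Mapping.map (\<lambda>z. c * z) f) = c \<odot> lin_ext A b f"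
proof -
  have K: "b \<in> Poly_Mapping.keys f \<rightarrow> carrier A" using assms by auto
  then have "lin_ext A b (Poly_Mapping.map (\<lambda>z. c * z) f) =
      (\<Oplus>z\<in>Poly_Mapping.keys f. c \<odot> (Poly_Mapping.lookup f z \<odot> b z))"
    by (subst lin_ext_superset[OF finite_keys keys_map_mult])
      (auto simp: lookup_map_mult smult_smult Pi_iff intro!: finsum_cong')
  also have "\<dots> = c \<odot> lin_ext A b f"
    unfolding lin_ext_def using K by (subst smult_finsum) auto
  finally show ?thesis .
qed

end

text \<open>A monoid with an involutive anti-automorphism. Three instances are used: a group with
  inversion, words with reversal and change of the adjoint flags, and the product of the
  multiplicative monoids of two *-algebras with the pair of their involutions.\<close>

locale star_monoid = monoid M for M :: "('m, 'r) monoid_scheme" (structure) and inv_map :: "'m \<Rightarrow> 'm" +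
  assumes inv_map_closed [simp]: "x \<in> carrier M \<Longrightarrow> inv_map x \<in> carrier M"
    and inv_map_mult: "x \<in> carrier M \<Longrightarrow> y \<in> carrier M \<Longrightarrow> inv_map (x \<otimes> y) = inv_map y \<otimes> inv_map x"
    and inv_map_inv_map [simp]: "x \<in> carrier M \<Longrightarrow> inv_map (inv_map x) = x"
begin

abbreviation "MA \<equiv> monoid_star_algebra M inv_map"

lemma carrier_MA: "carrier MA = {f. Poly_Mapping.keys f \<subseteq> carrier M}"
  and one_MA: "\<one>\<^bsub>MA\<^esub> = Poly_Mapping.single \<one> 1"
  and zero_MA: "\<zero>\<^bsub>MA\<^esub> = 0"
  and add_MA: "f \<oplus>\<^bsub>MA\<^esub> g = f + g"
  and smult_MA: "c \<odot>\<^bsub>MA\<^esub> f = Poly_Mapping.map (\<lambda>z. c * z) f"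
  by (auto simp: monoid_star_algebra_def)

lemma lookup_smult_MA: "Poly_Mapping.lookup (c \<odot>\<^bsub>MA\<^esub> f) x = c * Poly_Mapping.lookup f x"
  by (simp add: smult_MA lookup_map_mult)

lemma mult_MA_superset:
  assumes "finite K" "Poly_Mapping.keys f \<subseteq> K" "finite L" "Poly_Mapping.keys g \<subseteq> L"
  shows "f \<otimes>\<^bsub>MA\<^esub> g = (\<Sum>x\<in>K. \<Sum>y\<in>L.
    Poly_Mapping.single (x \<otimes> y) (Poly_Mapping.lookup f x * Poly_Mapping.lookup g y))"
proof -
  have "f \<otimes>\<^bsub>MA\<^esub> g = (\<Sum>x\<in>Poly_Mapping.keys f. \<Sum>y\<in>L.
    Poly_Mapping.single (x \<otimes> y) (Poly_Mapping.lookup f x * Poly_Mapping.lookup g y))"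
    unfolding monoid_star_algebra_def monoid.simps using assms
    by (intro sum.cong refl sum.mono_neutral_left) (auto simp: in_keys_iff)
  also have "\<dots> = (\<Sum>x\<in>K. \<Sum>y\<in>L.
    Poly_Mapping.single (x \<otimes> y) (Poly_Mapping.lookup f x * Poly_Mapping.lookup g y))"
    using assms by (intro sum.mono_neutral_left) (auto simp: in_keys_iff)
  finally show ?thesis .
qed

lemma star_MA_superset:
  assumes "finite K" "Poly_Mapping.keys f \<subseteq> K"
  shows "star MA f = (\<Sum>x\<in>K. Poly_Mapping.single (inv_map x) (cnj (Poly_Mapping.lookup f x)))"
  unfolding monoid_star_algebra_def using assms
  by (auto intro!: sum.mono_neutral_left simp: in_keys_iff)

lemma mult_MA_single:
  "Poly_Mapping.single x c \<otimes>\<^bsub>MA\<^esub> Poly_Mapping.single y d = Poly_Mapping.single (x \<otimes> y) (c * d)"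
  by (subst mult_MA_superset[of "{x}" _ "{y}"]) auto

lemma star_MA_single: "star MA (Poly_Mapping.single x c) = Poly_Mapping.single (inv_map x) (cnj c)"
  by (subst star_MA_superset[of "{x}"]) auto

lemma smult_MA_single: "c \<odot>\<^bsub>MA\<^esub> Poly_Mapping.single x d = Poly_Mapping.single x (c * d)"
  by (simp add: smult_MA)

lemma single_in_MA: "x \<in> carrier M \<Longrightarrow> Poly_Mapping.single x c \<in> carrier MA"
  by (auto simp: carrier_MA)

lemma zero_in_MA: "0 \<in> carrier MA"
  by (simp add: carrier_MA)

lemma mult_MA_add_l: "(f + g) \<otimes>\<^bsub>MA\<^esub> h = f \<otimes>\<^bsub>MA\<^esub> h + g \<otimes>\<^bsub>MA\<^esub> h"
proof -
  have K: "finite (Poly_Mapping.keys f \<union> Poly_Mapping.keys g)" by simp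
  show ?thesis
    by (subst (1 2 3) mult_MA_superset[OF K _ finite_keys order_refl])
      (use keys_add[of f g] in \<open>auto simp: lookup_add single_add distrib_right sum.distrib\<close>)
qed

lemma mult_MA_add_r: "h \<otimes>\<^bsub>MA\<^esub> (f + g) = h \<otimes>\<^bsub>MA\<^esub> f + h \<otimes>\<^bsub>MA\<^esub> g"
proof -
  have K: "finite (Poly_Mapping.keys f \<union> Poly_Mapping.keys g)" by simp
  show ?thesis
    by (subst (1 2 3) mult_MA_superset[OF finite_keys order_refl K])
      (use keys_add[of f g] in \<open>auto simp: lookup_add single_add distrib_left sum.distrib\<close>)
qed

lemma star_MA_add: "star MA (f + g) = star MA f + star MA g"
proof -
  have K: "finite (Poly_Mapping.keys f \<union> Poly_Mapping.keys g)" by simp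
  show ?thesis
    by (subst (1 2 3) star_MA_superset[OF K])
      (use keys_add[of f g] in \<open>auto simp: lookup_add single_add sum.distrib\<close>)
qed

lemma MA_zero [simp]: "0 \<otimes>\<^bsub>MA\<^esub> f = 0" "f \<otimes>\<^bsub>MA\<^esub> 0 = 0" "star MA 0 = 0"
  by (auto simp: monoid_star_algebra_def)

lemma mult_MA_closed:
  assumes "f \<in> carrier MA" "g \<in> carrier MA" shows "f \<otimes>\<^bsub>MA\<^esub> g \<in> carrier MA"
  using assms unfolding carrier_MA monoid_star_algebra_def
  by (auto intro!: m_closed dest!: subsetD[OF keys_sum] split: if_splits)

lemma star_MA_closed:
  assumes "f \<in> carrier MA" shows "star MA f \<in> carrier MA"
  using assms unfolding carrier_MA monoid_star_algebra_def
  by (auto dest!: subsetD[OF keys_sum] split: if_splits)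

lemma MA_induct [consumes 1, case_names zero single add]:
  assumes "f \<in> carrier MA" "P 0" "\<And>x c. x \<in> carrier M \<Longrightarrow> P (Poly_Mapping.single x c)"
    "\<And>f g. f \<in> carrier MA \<Longrightarrow> g \<in> carrier MA \<Longrightarrow> P f \<Longrightarrow> P g \<Longrightarrow> P (f + g)"
  shows "P f"
  using keys_subset_induct[of f "carrier M" P] assms by (simp add: carrier_MA)

text \<open>Both sides are additive in each argument, so three nested inductions reduce the claim to
  basis elements, where it is associativity in \<open>M\<close>.\<close>

lemma mult_MA_assoc:
  assumes "f \<in> carrier MA" "g \<in> carrier MA" "h \<in> carrier MA"
  shows "(f \<otimes>\<^bsub>MA\<^esub> g) \<otimes>\<^bsub>MA\<^esub> h = f \<otimes>\<^bsub>MA\<^esub> (g \<otimes>\<^bsub>MA\<^esub> h)"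
  using assms(1)
proof (induction rule: MA_induct)
  case (single x c) show ?case using assms(2)
  proof (induction rule: MA_induct)
    case (single y d) show ?case using assms(3)
      by (induction rule: MA_induct)
        (auto simp: mult_MA_single mult_MA_add_r m_assoc mult.assoc \<open>x \<in> carrier M\<close> \<open>y \<in> carrier M\<close>)
  qed (auto simp: mult_MA_add_r mult_MA_add_l)
qed (auto simp: mult_MA_add_l)

lemma star_MA_mult:
  assumes "f \<in> carrier MA" "g \<in> carrier MA"
  shows "star MA (f \<otimes>\<^bsub>MA\<^esub> g) = star MA g \<otimes>\<^bsub>MA\<^esub> star MA f"
  using assms(1)
proof (induction rule: MA_induct)
  case (single x c) show ?case using assms(2)
    by (induction rule: MA_induct)
      (auto simp: mult_MA_single star_MA_single mult_MA_add_r mult_MA_add_l star_MA_add inv_map_mult mult.commute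
        \<open>x \<in> carrier M\<close>)
qed (auto simp: mult_MA_add_l mult_MA_add_r star_MA_add)

text \<open>Scalars act as multiplication, from either side, by a multiple of the unit.
  Compatibility of scalars with products and with the involution then becomes a case of
  associativity and of antimultiplicativity.\<close>

lemma smult_MA_eq_mult:
  assumes "f \<in> carrier MA"
  shows "c \<odot>\<^bsub>MA\<^esub> f = Poly_Mapping.single \<one> c \<otimes>\<^bsub>MA\<^esub> f" "c \<odot>\<^bsub>MA\<^esub> f = f \<otimes>\<^bsub>MA\<^esub> Poly_Mapping.single \<one> c"
proof -
  have add: "c \<odot>\<^bsub>MA\<^esub> (f + g) = c \<odot>\<^bsub>MA\<^esub> f + c \<odot>\<^bsub>MA\<^esub> g" for f g
    by (rule poly_mapping_eqI) (simp add: lookup_smult_MA lookup_add distrib_left)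
  have zero: "c \<odot>\<^bsub>MA\<^esub> 0 = 0"
    by (rule poly_mapping_eqI) (simp add: lookup_smult_MA)
  show "c \<odot>\<^bsub>MA\<^esub> f = Poly_Mapping.single \<one> c \<otimes>\<^bsub>MA\<^esub> f"
    using assms by (induction rule: MA_induct)
      (auto simp: smult_MA_single add zero mult_MA_add_r mult_MA_single)
  show "c \<odot>\<^bsub>MA\<^esub> f = f \<otimes>\<^bsub>MA\<^esub> Poly_Mapping.single \<one> c"
    using assms by (induction rule: MA_induct)
      (auto simp: smult_MA_single add zero mult_MA_add_l mult_MA_single mult.commute)
qed

lemma inv_map_one [simp]: "inv_map \<one> = \<one>"
  using inv_map_mult[of "inv_map \<one>" \<one>] by simp

lemma star_alg_MA: "star_alg MA"
proof (intro star_alg.intro ringI abelian_groupI monoidI star_alg_axioms.intro)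
  fix f assume f: "f \<in> carrier MA"
  show "\<exists>g\<in>carrier MA. g \<oplus>\<^bsub>MA\<^esub> f = \<zero>\<^bsub>MA\<^esub>"
    using f by (intro bexI[of _ "- f"]) (auto simp: carrier_MA add_MA zero_MA in_keys_iff)
  show "\<one>\<^bsub>MA\<^esub> \<otimes>\<^bsub>MA\<^esub> f = f"
    using f by (induction rule: MA_induct) (auto simp: one_MA mult_MA_single mult_MA_add_r)
  show "f \<otimes>\<^bsub>MA\<^esub> \<one>\<^bsub>MA\<^esub> = f"
    using f by (induction rule: MA_induct) (auto simp: one_MA mult_MA_single mult_MA_add_l)
  show "star MA (star MA f) = f"
    using f by (induction rule: MA_induct) (auto simp: star_MA_single star_MA_add)
  fix c d
  show "c \<odot>\<^bsub>MA\<^esub> f \<in> carrier MA"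
    using f keys_map_mult[of c f] by (auto simp: carrier_MA smult_MA)
  show "(c + d) \<odot>\<^bsub>MA\<^esub> f = c \<odot>\<^bsub>MA\<^esub> f \<oplus>\<^bsub>MA\<^esub> d \<odot>\<^bsub>MA\<^esub> f"
    by (rule poly_mapping_eqI)
      (simp add: add_MA lookup_smult_MA lookup_add distrib_right)
  show "c \<odot>\<^bsub>MA\<^esub> (d \<odot>\<^bsub>MA\<^esub> f) = (c * d) \<odot>\<^bsub>MA\<^esub> f"
    by (rule poly_mapping_eqI) (simp add: lookup_smult_MA)
  show "1 \<odot>\<^bsub>MA\<^esub> f = f"
    by (rule poly_mapping_eqI) (simp add: lookup_smult_MA)
  show "star MA (c \<odot>\<^bsub>MA\<^esub> f) = cnj c \<odot>\<^bsub>MA\<^esub> star MA f"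
    using f by (simp add: smult_MA_eq_mult(1) star_MA_closed star_MA_mult single_in_MA star_MA_single
        flip: smult_MA_eq_mult(2))
  fix g assume g: "g \<in> carrier MA"
  show "f \<oplus>\<^bsub>MA\<^esub> g \<in> carrier MA"
    using f g keys_add[of f g] by (auto simp: carrier_MA add_MA)
  show "c \<odot>\<^bsub>MA\<^esub> (f \<oplus>\<^bsub>MA\<^esub> g) = c \<odot>\<^bsub>MA\<^esub> f \<oplus>\<^bsub>MA\<^esub> c \<odot>\<^bsub>MA\<^esub> g"
    by (rule poly_mapping_eqI) (simp add: add_MA lookup_smult_MA lookup_add distrib_left)
  show "c \<odot>\<^bsub>MA\<^esub> f \<otimes>\<^bsub>MA\<^esub> g = c \<odot>\<^bsub>MA\<^esub> (f \<otimes>\<^bsub>MA\<^esub> g)"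
    using f g by (simp add: smult_MA_eq_mult(1) mult_MA_closed mult_MA_assoc single_in_MA)
  show "f \<otimes>\<^bsub>MA\<^esub> (c \<odot>\<^bsub>MA\<^esub> g) = c \<odot>\<^bsub>MA\<^esub> (f \<otimes>\<^bsub>MA\<^esub> g)"
    using f g by (simp add: smult_MA_eq_mult(2) mult_MA_closed mult_MA_assoc single_in_MA)
qed (auto simp: add_MA zero_MA mult_MA_closed star_MA_closed mult_MA_add_l mult_MA_add_r star_MA_add
    star_MA_mult mult_MA_assoc one_MA single_in_MA zero_in_MA add_ac)

sublocale MA: star_alg MA by (rule star_alg_MA)

lemma star_generates_MA: "star_generates MA ((\<lambda>x. Poly_Mapping.single x 1) ` carrier M)"
  unfolding star_generates_def
proof (intro conjI allI impI subsetI)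
  fix V f
  assume V: "(\<lambda>x. Poly_Mapping.single x 1) ` carrier M \<subseteq> V"
    "\<forall>x\<in>V \<inter> carrier MA. \<forall>y\<in>V \<inter> carrier MA. x \<oplus>\<^bsub>MA\<^esub> y \<in> V \<and> x \<otimes>\<^bsub>MA\<^esub> y \<in> V"
    "\<forall>x\<in>V \<inter> carrier MA. star MA x \<in> V \<and> (\<forall>c. c \<odot>\<^bsub>MA\<^esub> x \<in> V)"
  have s: "Poly_Mapping.single x c \<in> V" if "x \<in> carrier M" for x c
  proof -
    have "Poly_Mapping.single x 1 \<in> V \<inter> carrier MA" using V(1) that by (auto simp: single_in_MA)
    then have "c \<odot>\<^bsub>MA\<^esub> Poly_Mapping.single x 1 \<in> V" using V(3) by blast
    then show ?thesis by (simp add: smult_MA_single)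
  qed
  assume "f \<in> carrier MA"
  then show "f \<in> V"
  proof (induction rule: MA_induct)
    case zero show ?case using s[OF one_closed, of 0] by simp
  next
    case (add f g) then show ?case using V(2) by (auto simp: add_MA)
  qed (rule s)
qed (auto simp: single_in_MA)

text \<open>The universal property of the monoid algebra: a homomorphism of involutive monoids into
  the multiplicative monoid of \<open>V\<close> extends linearly to a *-homomorphism, products being
  checked on pairs of basis elements.\<close>

lemma lin_ext_star_hom:
  assumes "star_alg V" "b \<in> carrier M \<rightarrow> carrier V" "b \<one> = \<one>\<^bsub>V\<^esub>"
    "\<And>x y. x \<in> carrier M \<Longrightarrow> y \<in> carrier M \<Longrightarrow> b (x \<otimes> y) = b x \<otimes>\<^bsub>V\<^esub> b y"
    "\<And>x. x \<in> carrier M \<Longrightarrow> b (inv_map x) = star V (b x)"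
  shows "lin_ext V b \<in> star_hom MA V"
proof -
  interpret V: star_alg V by fact
  have b: "b x \<in> carrier V" if "x \<in> carrier M" for x using assms(2) that by auto
  have closed: "lin_ext V b f \<in> carrier V" if "f \<in> carrier MA" for f
    using that V.lin_ext_closed[OF _ assms(2)] by (simp add: carrier_MA)
  have add: "lin_ext V b (f + g) = lin_ext V b f \<oplus>\<^bsub>V\<^esub> lin_ext V b g"
    if "f \<in> carrier MA" "g \<in> carrier MA" for f g
    using that V.lin_ext_add[OF _ _ assms(2)] by (simp add: carrier_MA)
  show ?thesis
  proof (rule star_homI)
    fix f assume f: "f \<in> carrier MA"
    show "lin_ext V b (star MA f) = star V (lin_ext V b f)"
      using f by (induction rule: MA_induct)
        (auto simp: star_MA_single V.lin_ext_single b assms(5) V.star_smult V.lin_ext_zero star_MA_add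
          add closed V.star_add star_MA_closed)
    fix g assume g: "g \<in> carrier MA"
    show "lin_ext V b (f \<otimes>\<^bsub>MA\<^esub> g) = lin_ext V b f \<otimes>\<^bsub>V\<^esub> lin_ext V b g"
      using f
    proof (induction rule: MA_induct)
      case zero show ?case using closed[OF g] by (simp add: V.lin_ext_zero)
    next
      case (single x c) show ?case using g
        by (induction rule: MA_induct)
          (use single in \<open>auto simp: mult_MA_single V.lin_ext_single b assms(4) V.smult_mult_l
            V.smult_mult_r V.smult_smult V.lin_ext_zero mult_MA_add_r add closed mult_MA_closed
            single_in_MA V.r_distr mult.commute\<close>)
    qed (use g in \<open>auto simp: mult_MA_add_l add closed mult_MA_closed V.l_distr\<close>)
  qed (auto simp: closed add add_MA one_MA V.lin_ext_single b assms(3) smult_MA carrier_MA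
      intro: V.lin_ext_smult[OF _ assms(2)])
qed

end

section \<open>Free *-algebras and algebras given by generators and relations\<close>

lemma word_star_monoid: "star_monoid (word_monoid X) word_star"
proof (intro star_monoid.intro monoidI star_monoid_axioms.intro)
  have "map_prod id Not \<circ> map_prod id Not = (id :: ('a \<times> bool) \<Rightarrow> _)" by (auto simp: fun_eq_iff)
  then show "word_star (word_star x) = x" for x :: "('a \<times> bool) list"
    by (simp add: word_star_def rev_map)
  show "word_star x \<in> carrier (word_monoid X)" if "x \<in> carrier (word_monoid X)" for x
    using that by (induction x) (auto simp: word_monoid_def word_star_def)
qed (auto simp: word_monoid_def word_star_def)

lemma (in group) group_star_monoid: "star_monoid G (m_inv G)"
  by unfold_locales (auto simp: inv_mult_group)

text \<open>A word is a product of letters, and the letter \<open>(x, True)\<close> is the adjoint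
  of the generator \<open>x\<close>. So every word is reached from the generators, and the words
  generate the monoid algebra.\<close>

lemma free_star_generates: "star_generates (free_star_algebra X) (free_gen ` X)"
proof -
  interpret W: star_monoid "word_monoid X" word_star by (rule word_star_monoid)
  let ?F = "free_star_algebra X"
  have gen_in: "free_gen x \<in> carrier ?F" if "x \<in> X" for x
    using that unfolding free_star_algebra_def free_gen_def
    by (intro W.single_in_MA) (simp add: word_monoid_def)
  have "carrier ?F \<subseteq> V" if V: "free_gen ` X \<subseteq> V" "\<one>\<^bsub>?F\<^esub> \<in> V"
    "\<forall>x\<in>V \<inter> carrier ?F. \<forall>y\<in>V \<inter> carrier ?F. x \<oplus>\<^bsub>?F\<^esub> y \<in> V \<and> x \<otimes>\<^bsub>?F\<^esub> y \<in> V"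
    "\<forall>x\<in>V \<inter> carrier ?F. star ?F x \<in> V \<and> (\<forall>c. c \<odot>\<^bsub>?F\<^esub> x \<in> V)" for V
  proof -
    have "Poly_Mapping.single w 1 \<in> V" if "w \<in> carrier (word_monoid X)" for w
      using that
    proof (induction w)
      case Nil
      then show ?case using V(2) by (simp add: free_star_algebra_def W.one_MA) (simp add: word_monoid_def)
    next
      case (Cons a w)
      obtain x s where a: "a = (x, s)" by force
      have x: "x \<in> X" and w: "w \<in> carrier (word_monoid X)"
        using Cons.prems by (auto simp: a word_monoid_def)
      have "star ?F (free_gen x) \<in> V" using V(1,4) gen_in x by auto
      moreover have "star ?F (free_gen x) = Poly_Mapping.single [(x, True)] 1"
        by (simp add: free_star_algebra_def free_gen_def W.star_MA_single)
          (simp add: word_star_def)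
      ultimately have g: "Poly_Mapping.single [(x, s)] 1 \<in> V"
        using V(1) x by (cases s) (auto simp: free_gen_def)
      have "Poly_Mapping.single [(x, s)] 1 \<in> carrier ?F" "Poly_Mapping.single w 1 \<in> carrier ?F"
        unfolding free_star_algebra_def using x w
        by (auto intro!: W.single_in_MA) (simp add: word_monoid_def)
      then have "Poly_Mapping.single [(x, s)] 1 \<otimes>\<^bsub>?F\<^esub> Poly_Mapping.single w 1 \<in> V"
        using V(3) g Cons.IH[OF w] by blast
      then show ?case by (simp add: free_star_algebra_def W.mult_MA_single a)
          (simp add: word_monoid_def)
    qed
    then show ?thesis
      using W.star_generates_MA V(2-)
      unfolding star_generates_def free_star_algebra_def[symmetric] by blast
  qed
  then show ?thesis using gen_in unfolding star_generates_def by blast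
qed

lemma star_alg_free_star_algebra: "star_alg (free_star_algebra X)"
  unfolding free_star_algebra_def by (rule star_monoid.star_alg_MA[OF word_star_monoid])

lemma free_star_lift:
  assumes "star_alg V" "\<phi> \<in> X \<rightarrow> carrier V"
  shows "\<exists>h\<in>star_hom (free_star_algebra X) V. \<forall>x\<in>X. h (free_gen x) = \<phi> x"
proof -
  interpret V: star_alg V by fact
  interpret W: star_monoid "word_monoid X" word_star by (rule word_star_monoid)
  \<comment> \<open>The two kinds of letters go to \<open>\<phi> x\<close> and to its adjoint. Then
    \<open>b\<close> evaluates a word as the product of its letters, and reversing a word while
    flipping all flags amounts to taking the adjoint of that product.\<close>
  define l where "l = (\<lambda>(x, s). if s then star V (\<phi> x) else \<phi> x)"
  define b where "b w = foldr (\<lambda>a y. l a \<otimes>\<^bsub>V\<^esub> y) w \<one>\<^bsub>V\<^esub>" for w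
  have l: "l a \<in> carrier V" if "a \<in> X \<times> UNIV" for a
    using assms(2) that by (auto simp: l_def split: prod.splits)
  have b_simps: "b [] = \<one>\<^bsub>V\<^esub>" "b (a # w) = l a \<otimes>\<^bsub>V\<^esub> b w" for a w by (auto simp: b_def)
  have b: "b w \<in> carrier V" if "w \<in> lists (X \<times> UNIV)" for w
    using that by (induction w) (auto simp: b_simps l)
  have b_app: "b (v @ w) = b v \<otimes>\<^bsub>V\<^esub> b w" if "v \<in> lists (X \<times> UNIV)" "w \<in> lists (X \<times> UNIV)" for v w
    using that(1) by (induction v) (auto simp: b_simps l b that(2) V.m_assoc)
  have l_star: "l (map_prod id Not a) = star V (l a)" if "a \<in> X \<times> UNIV" for a
    using assms(2) that by (cases a) (auto simp: l_def Pi_iff)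
  have ws: "word_star w \<in> lists (X \<times> UNIV)" if "w \<in> lists (X \<times> UNIV)" for w
    using that by (induction w) (auto simp: word_star_def)
  have b_star: "b (word_star w) = star V (b w)" if "w \<in> lists (X \<times> UNIV)" for w
    using that
  proof (induction w)
    case (Cons a w)
    then have "word_star (a # w) = word_star w @ [map_prod id Not a]" "a \<in> X \<times> UNIV"
      "w \<in> lists (X \<times> UNIV)" by (auto simp: word_star_def)
    moreover have "[map_prod id Not a] \<in> lists (X \<times> UNIV)" using \<open>a \<in> X \<times> UNIV\<close> by auto
    ultimately show ?case using Cons
      by (simp add: b_app ws b_simps l_star l b V.star_mult)
  qed (simp add: b_simps word_star_def)
  have "lin_ext V b \<in> star_hom (free_star_algebra X) V"
    unfolding free_star_algebra_def using b b_app b_star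
    by (intro W.lin_ext_star_hom assms(1)) (auto simp: word_monoid_def b_simps)
  moreover have "lin_ext V b (free_gen x) = \<phi> x" if "x \<in> X" for x
    using l[of "(x, False)"] that unfolding free_gen_def
    by (subst V.lin_ext_single) (auto simp: b_simps l_def)
  ultimately show ?thesis by blast
qed

lemma free_gen_closed: "x \<in> X \<Longrightarrow> free_gen x \<in> carrier (free_star_algebra X)"
  using free_star_generates[of X] by (auto simp: star_generates_def)

context
  fixes X :: "'x set" and R :: "('x free_star \<times> 'x free_star) set"
  assumes R: "R \<subseteq> carrier (free_star_algebra X) \<times> carrier (free_star_algebra X)"
begin

interpretation F: star_alg "free_star_algebra X" by (rule star_alg_free_star_algebra)

lemma star_alg_presented: "star_alg (presented X R)"
  unfolding presented_def by (rule F.star_alg_impose[OF R])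

lemma presented_proj: "impose_proj (free_star_algebra X) R \<in> star_hom (free_star_algebra X) (presented X R)"
  unfolding presented_def by (rule F.impose_proj_star_hom[OF R])

lemma presented_generates: "star_generates (presented X R) (presented_gen X R ` X)"
  using star_generates_image[OF F.star_alg_axioms free_star_generates presented_proj]
    F.carrier_impose[OF R]
  by (simp add: presented_def presented_gen_def image_image)

text \<open>The relations are pairs of elements of the free algebra, whose images
  \<open>\<phi>\<close> alone does not express. The last hypothesis therefore quantifies over the
  *-homomorphisms \<open>f\<close> that extend \<open>\<phi>\<close>.\<close>

lemma presented_lift:
  assumes "star_alg B" "\<phi> \<in> X \<rightarrow> carrier B"
    "\<And>f l r. f \<in> star_hom (free_star_algebra X) B \<Longrightarrow> (\<And>x. x \<in> X \<Longrightarrow> f (free_gen x) = \<phi> x) \<Longrightarrow>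
       (l, r) \<in> R \<Longrightarrow> f l = f r"
  shows "\<exists>h\<in>star_hom (presented X R) B. \<forall>x\<in>X. h (presented_gen X R x) = \<phi> x"
proof -
  obtain f where f: "f \<in> star_hom (free_star_algebra X) B" "\<forall>x\<in>X. f (free_gen x) = \<phi> x"
    using free_star_lift[OF assms(1,2)] by blast
  then obtain h where "h \<in> star_hom (impose (free_star_algebra X) R) B"
    "\<forall>x\<in>carrier (free_star_algebra X). h (impose_proj (free_star_algebra X) R x) = f x"
    using F.impose_lift[OF R assms(1) f(1)] assms(3) by blast
  then show ?thesis
    using f(2) free_gen_closed[of _ X] by (auto simp: presented_def presented_gen_def intro!: bexI[of _ h])
qed

end

section \<open>Tensor products\<close>

context star_alg
begin

lemma lin_span_superset: "S \<subseteq> carrier A \<Longrightarrow> S \<subseteq> lin_span A S"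
  by (auto simp: lin_span_def)

lemma lin_span_subset: "S \<subseteq> carrier A \<Longrightarrow> lin_span A S \<subseteq> carrier A"
  unfolding lin_span_def by (rule Inter_lower) auto

lemma lin_span_zero: "\<zero> \<in> lin_span A S"
  and lin_span_add: "x \<in> lin_span A S \<Longrightarrow> y \<in> lin_span A S \<Longrightarrow> x \<oplus> y \<in> lin_span A S"
  and lin_span_smult: "x \<in> lin_span A S \<Longrightarrow> c \<odot> x \<in> lin_span A S"
  by (auto simp: lin_span_def)

lemma lin_span_induct [consumes 2, case_names gen zero add smult]:
  assumes "S \<subseteq> carrier A" "x \<in> lin_span A S" "\<And>x. x \<in> S \<Longrightarrow> P x" "P \<zero>"
    "\<And>x y. x \<in> carrier A \<Longrightarrow> y \<in> carrier A \<Longrightarrow> P x \<Longrightarrow> P y \<Longrightarrow> P (x \<oplus> y)"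
    "\<And>c x. x \<in> carrier A \<Longrightarrow> P x \<Longrightarrow> P (c \<odot> x)"
  shows "P x"
proof -
  have "lin_span A S \<subseteq> {x \<in> carrier A. P x}"
    unfolding lin_span_def using assms by (intro Inter_lower) auto
  then show ?thesis using assms(2) by auto
qed

text \<open>By bilinearity of the product it is enough to multiply the generators \<open>S\<close>
  of the span by a spanning set \<open>T\<close> of the algebra. In the applications both sets
  consist of explicit elements.\<close>

lemma star_ideal_lin_span:
  assumes S: "S \<subseteq> carrier A" and T: "T \<subseteq> carrier A" "carrier A \<subseteq> lin_span A T"
    and "\<And>t s. t \<in> T \<Longrightarrow> s \<in> S \<Longrightarrow> t \<otimes> s \<in> lin_span A S"
    "\<And>t s. t \<in> T \<Longrightarrow> s \<in> S \<Longrightarrow> s \<otimes> t \<in> lin_span A S"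
    "\<And>s. s \<in> S \<Longrightarrow> star A s \<in> lin_span A S"
  shows "star_ideal (lin_span A S) A"
proof (rule star_idealI)
  have aux: "a \<otimes> s \<in> lin_span A S \<and> s \<otimes> a \<in> lin_span A S" if "a \<in> carrier A" "s \<in> S" for a s
    using T(1) subsetD[OF T(2) that(1)]
    by (induction rule: lin_span_induct)
      (use S that assms(4,5) in \<open>auto simp: l_distr r_distr smult_mult_l smult_mult_r subsetD
        intro: lin_span_add lin_span_smult lin_span_zero\<close>)
  fix a x assume a: "a \<in> carrier A" and x: "x \<in> lin_span A S"
  show "a \<otimes> x \<in> lin_span A S"
    using S x by (induction rule: lin_span_induct)
      (auto simp: a aux r_distr smult_mult_r intro: lin_span_add lin_span_smult lin_span_zero)
  show "x \<otimes> a \<in> lin_span A S"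
    using S x by (induction rule: lin_span_induct)
      (auto simp: a aux l_distr smult_mult_l intro: lin_span_add lin_span_smult lin_span_zero)
next
  fix x assume x: "x \<in> lin_span A S"
  show "star A x \<in> lin_span A S"
    using S x by (induction rule: lin_span_induct)
      (auto simp: assms(6) star_add star_smult intro: lin_span_add lin_span_smult lin_span_zero)
qed (auto intro: lin_span_add lin_span_zero subsetD[OF lin_span_subset[OF S]])

lemma mult_diff_r: "x \<in> carrier A \<Longrightarrow> y \<in> carrier A \<Longrightarrow> z \<in> carrier A \<Longrightarrow> x \<otimes> (y \<ominus> z) = x \<otimes> y \<ominus> x \<otimes> z"
  by (simp add: minus_eq r_distr r_minus)

lemma mult_diff_l: "x \<in> carrier A \<Longrightarrow> y \<in> carrier A \<Longrightarrow> z \<in> carrier A \<Longrightarrow> (y \<ominus> z) \<otimes> x = y \<otimes> x \<ominus> z \<otimes> x"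
  by (simp add: minus_eq l_distr l_minus)

lemma star_diff: "x \<in> carrier A \<Longrightarrow> y \<in> carrier A \<Longrightarrow> star A (x \<ominus> y) = star A x \<ominus> star A y"
  by (simp add: diff_eq_smult star_add star_smult)

end

lemma (in star_monoid) lin_span_MA:
  "carrier MA \<subseteq> lin_span MA ((\<lambda>x. Poly_Mapping.single x 1) ` carrier M)"
proof
  have S: "(\<lambda>x. Poly_Mapping.single x 1) ` carrier M \<subseteq> carrier MA" by (auto simp: single_in_MA)
  fix f assume "f \<in> carrier MA"
  then show "f \<in> lin_span MA ((\<lambda>x. Poly_Mapping.single x 1) ` carrier M)"
  proof (induction rule: MA_induct)
    case zero show ?case using MA.lin_span_zero by (simp add: zero_MA)
  next
    case (single x c)
    then have "Poly_Mapping.single x 1 \<in> lin_span MA ((\<lambda>x. Poly_Mapping.single x 1) ` carrier M)"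
      using MA.lin_span_superset[OF S] by auto
    from MA.lin_span_smult[OF this, of c] show ?case by (simp add: smult_MA_single)
  next
    case (add f g) then show ?case using MA.lin_span_add by (auto simp: add_MA)
  qed
qed

section \<open>The tensor product as a *-algebra\<close>

definition bilinear_into ::
  "'a star_algebra \<Rightarrow> 'b star_algebra \<Rightarrow> 'c star_algebra \<Rightarrow> ('a \<Rightarrow> 'b \<Rightarrow> 'c) \<Rightarrow> bool" where
  "bilinear_into A B V \<beta> \<longleftrightarrow>
     (\<forall>a\<in>carrier A. \<forall>b\<in>carrier B. \<beta> a b \<in> carrier V \<and>
        (\<forall>c. \<beta> (c \<odot>\<^bsub>A\<^esub> a) b = c \<odot>\<^bsub>V\<^esub> \<beta> a b \<and> \<beta> a (c \<odot>\<^bsub>B\<^esub> b) = c \<odot>\<^bsub>V\<^esub> \<beta> a b) \<and>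
        (\<forall>a'\<in>carrier A. \<beta> (a \<oplus>\<^bsub>A\<^esub> a') b = \<beta> a b \<oplus>\<^bsub>V\<^esub> \<beta> a' b) \<and>
        (\<forall>b'\<in>carrier B. \<beta> a (b \<oplus>\<^bsub>B\<^esub> b') = \<beta> a b \<oplus>\<^bsub>V\<^esub> \<beta> a b'))"

locale star_alg_pair = A: star_alg A + B: star_alg B
  for A :: "'a star_algebra" and B :: "'b star_algebra"
begin

lemma star_monoid_DirProd: "star_monoid (A \<times>\<times> B) (map_prod (star A) (star B))"
proof (intro star_monoid.intro star_monoid_axioms.intro)
  show "monoid (A \<times>\<times> B)" by (rule DirProd_monoid) unfold_locales
qed (auto simp: DirProd_def A.star_mult B.star_mult)

sublocale F: star_monoid "A \<times>\<times> B" "map_prod (star A) (star B)"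
  rewrites "monoid_star_algebra (A \<times>\<times> B) (map_prod (star A) (star B)) = tensor_free A B"
  by (rule star_monoid_DirProd) (simp add: tensor_free_def)

lemma pair_basis_closed: "a \<in> carrier A \<Longrightarrow> b \<in> carrier B \<Longrightarrow> Poly_Mapping.single (a, b) c \<in> carrier (tensor_free A B)"
  by (rule F.single_in_MA) (simp add: DirProd_def)

lemma mult_pair_basis:
  "Poly_Mapping.single (a, b) c \<otimes>\<^bsub>tensor_free A B\<^esub> Poly_Mapping.single (a', b') d =
    Poly_Mapping.single (a \<otimes>\<^bsub>A\<^esub> a', b \<otimes>\<^bsub>B\<^esub> b') (c * d)"
  by (subst F.mult_MA_single) (simp add: DirProd_def)

lemma star_pair_basis:
  "star (tensor_free A B) (Poly_Mapping.single (a, b) c) = Poly_Mapping.single (star A a, star B b) (cnj c)"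
  by (simp add: F.star_MA_single)

abbreviation "rels \<equiv> tensor_rels A B"

lemma tensor_rels_iff:
  "(l, r) \<in> rels \<longleftrightarrow>
    (\<exists>a a' b. a \<in> carrier A \<and> a' \<in> carrier A \<and> b \<in> carrier B \<and> l = pair_basis (a \<oplus>\<^bsub>A\<^esub> a') b \<and>
       r = pair_basis a b \<oplus>\<^bsub>tensor_free A B\<^esub> pair_basis a' b) \<or>
    (\<exists>a b b'. a \<in> carrier A \<and> b \<in> carrier B \<and> b' \<in> carrier B \<and> l = pair_basis a (b \<oplus>\<^bsub>B\<^esub> b') \<and>
       r = pair_basis a b \<oplus>\<^bsub>tensor_free A B\<^esub> pair_basis a b') \<or>
    (\<exists>c a b. a \<in> carrier A \<and> b \<in> carrier B \<and> l = pair_basis (c \<odot>\<^bsub>A\<^esub> a) b \<and>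
       r = c \<odot>\<^bsub>tensor_free A B\<^esub> pair_basis a b) \<or>
    (\<exists>c a b. a \<in> carrier A \<and> b \<in> carrier B \<and> l = pair_basis a (c \<odot>\<^bsub>B\<^esub> b) \<and>
       r = c \<odot>\<^bsub>tensor_free A B\<^esub> pair_basis a b)"
  unfolding tensor_rels_def Let_def
  by (simp only: Un_iff mem_Collect_eq prod.inject disj_assoc conj_ac)

lemma tensor_rels_closed: "rels \<subseteq> carrier (tensor_free A B) \<times> carrier (tensor_free A B)"
  by (auto simp: tensor_rels_iff pair_basis_closed)

lemma tensor_rels_add_l: "a \<in> carrier A \<Longrightarrow> a' \<in> carrier A \<Longrightarrow> b \<in> carrier B \<Longrightarrow>
    (pair_basis (a \<oplus>\<^bsub>A\<^esub> a') b, pair_basis a b \<oplus>\<^bsub>tensor_free A B\<^esub> pair_basis a' b) \<in> rels"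
  unfolding tensor_rels_iff by (rule disjI1, rule exI[of _ a], rule exI[of _ a'], rule exI[of _ b]) simp

lemma tensor_rels_add_r: "a \<in> carrier A \<Longrightarrow> b \<in> carrier B \<Longrightarrow> b' \<in> carrier B \<Longrightarrow>
    (pair_basis a (b \<oplus>\<^bsub>B\<^esub> b'), pair_basis a b \<oplus>\<^bsub>tensor_free A B\<^esub> pair_basis a b') \<in> rels"
  unfolding tensor_rels_iff by (rule disjI2[OF disjI1], rule exI[of _ a], rule exI[of _ b], rule exI[of _ b']) simp

lemma tensor_rels_smult_l: "a \<in> carrier A \<Longrightarrow> b \<in> carrier B \<Longrightarrow>
    (pair_basis (c \<odot>\<^bsub>A\<^esub> a) b, c \<odot>\<^bsub>tensor_free A B\<^esub> pair_basis a b) \<in> rels"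
  unfolding tensor_rels_iff by (rule disjI2[OF disjI2[OF disjI1]], rule exI[of _ c], rule exI[of _ a], rule exI[of _ b]) simp

lemma tensor_rels_smult_r: "a \<in> carrier A \<Longrightarrow> b \<in> carrier B \<Longrightarrow>
    (pair_basis a (c \<odot>\<^bsub>B\<^esub> b), c \<odot>\<^bsub>tensor_free A B\<^esub> pair_basis a b) \<in> rels"
  unfolding tensor_rels_iff by (rule disjI2[OF disjI2[OF disjI2]], rule exI[of _ c], rule exI[of _ a], rule exI[of _ b]) simp

lemmas tensor_rels_intros =
  tensor_rels_add_l tensor_rels_add_r tensor_rels_smult_l tensor_rels_smult_r

text \<open>Multiplying a bilinearity relation by a basis pair gives a bilinearity relation of the
  same kind, by distributivity in one of the factors. This is why the span of these relations is an
  ideal.\<close>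

lemma tensor_rels_mult_l:
  assumes "(l, r) \<in> rels" "x \<in> carrier A" "y \<in> carrier B"
  shows "(pair_basis x y \<otimes>\<^bsub>tensor_free A B\<^esub> l, pair_basis x y \<otimes>\<^bsub>tensor_free A B\<^esub> r) \<in> rels"
  using assms unfolding tensor_rels_iff[of l r]
  by (elim disjE exE conjE)
    (simp_all add: mult_pair_basis F.MA.r_distr F.MA.smult_mult_r pair_basis_closed A.r_distr
      B.r_distr A.smult_mult_r B.smult_mult_r tensor_rels_intros)

lemma tensor_rels_mult_r:
  assumes "(l, r) \<in> rels" "x \<in> carrier A" "y \<in> carrier B"
  shows "(l \<otimes>\<^bsub>tensor_free A B\<^esub> pair_basis x y, r \<otimes>\<^bsub>tensor_free A B\<^esub> pair_basis x y) \<in> rels"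
  using assms unfolding tensor_rels_iff[of l r]
  by (elim disjE exE conjE)
    (simp_all add: mult_pair_basis F.MA.l_distr F.MA.smult_mult_l pair_basis_closed A.l_distr
      B.l_distr A.smult_mult_l B.smult_mult_l tensor_rels_intros)

lemma tensor_rels_star:
  assumes "(l, r) \<in> rels"
  shows "(star (tensor_free A B) l, star (tensor_free A B) r) \<in> rels"
  using assms unfolding tensor_rels_iff[of l r]
  by (elim disjE exE conjE)
    (simp_all add: star_pair_basis F.MA.star_add F.MA.star_smult pair_basis_closed A.star_add
      B.star_add A.star_smult B.star_smult tensor_rels_intros)

lemma differences_closed: "differences (tensor_free A B) rels \<subseteq> carrier (tensor_free A B)"
  by (rule F.MA.differences_subset[OF tensor_rels_closed])

text \<open>The null space is defined as a linear span, which is what linear maps out of the tensor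
  product need, whereas the quotient algebra needs a *-ideal. Here the two readings are
  reconciled.\<close>

lemma star_ideal_tensor_null: "star_ideal (tensor_null A B) (tensor_free A B)"
  unfolding tensor_null_def
proof (rule F.MA.star_ideal_lin_span[OF differences_closed _ F.lin_span_MA])
  let ?D = "differences (tensor_free A B) rels"
  note D = subsetD[OF F.MA.lin_span_superset[OF differences_closed]]
  fix s assume "s \<in> ?D"
  then obtain l r where lr: "(l, r) \<in> rels" and s: "s = l \<ominus>\<^bsub>tensor_free A B\<^esub> r"
    by (auto simp: differences_def)
  have c: "l \<in> carrier (tensor_free A B)" "r \<in> carrier (tensor_free A B)"
    using lr tensor_rels_closed by auto
  have mem: "l \<ominus>\<^bsub>tensor_free A B\<^esub> r \<in> lin_span (tensor_free A B) ?D" if "(l, r) \<in> rels" for l r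
    using that by (intro D) (auto simp: differences_def)
  show "star (tensor_free A B) s \<in> lin_span (tensor_free A B) ?D"
    using mem[OF tensor_rels_star[OF lr]] c by (simp add: s F.MA.star_diff)
  fix t :: "'a \<times> 'b \<Rightarrow>\<^sub>0 complex"
  assume "t \<in> (\<lambda>x. Poly_Mapping.single x 1) ` carrier (A \<times>\<times> B)"
  then obtain x y where t: "t = pair_basis x y" "x \<in> carrier A" "y \<in> carrier B"
    by (auto simp: DirProd_def)
  show "t \<otimes>\<^bsub>tensor_free A B\<^esub> s \<in> lin_span (tensor_free A B) ?D"
    using mem[OF tensor_rels_mult_l[OF lr t(2,3)]] c t(2,3)
    by (simp add: s t(1) F.MA.mult_diff_r pair_basis_closed)
  show "s \<otimes>\<^bsub>tensor_free A B\<^esub> t \<in> lin_span (tensor_free A B) ?D"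
    using mem[OF tensor_rels_mult_r[OF lr t(2,3)]] c t(2,3)
    by (simp add: s t(1) F.MA.mult_diff_l pair_basis_closed)
qed (auto simp: F.single_in_MA)

sublocale Q: star_quot "tensor_free A B" "tensor_null A B"
  by (intro star_quot.intro star_quot_axioms.intro F.star_alg_MA star_ideal_tensor_null)

lemma star_alg_tensor: "star_alg (tensor A B)"
  unfolding tensor_def by (rule Q.star_alg_star_quotient)

sublocale T: star_alg "tensor A B" by (rule star_alg_tensor)

lemmas proj_hom = Q.rcos_star_hom[folded tensor_def]

lemma proj_rel: "(l, r) \<in> rels \<Longrightarrow>
  tensor_null A B +>\<^bsub>tensor_free A B\<^esub> l = tensor_null A B +>\<^bsub>tensor_free A B\<^esub> r"
proof -
  assume lr: "(l, r) \<in> rels"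
  then have "l \<in> carrier (tensor_free A B)" "r \<in> carrier (tensor_free A B)"
    "l \<ominus>\<^bsub>tensor_free A B\<^esub> r \<in> tensor_null A B"
    using tensor_rels_closed F.MA.lin_span_superset[OF differences_closed]
    by (auto simp: tensor_null_def differences_def)
  then show ?thesis by (simp add: Q.rcos_eq_iff)
qed

lemma pure_closed: "a \<in> carrier A \<Longrightarrow> b \<in> carrier B \<Longrightarrow> pure_tensor A B a b \<in> carrier (tensor A B)"
  unfolding pure_tensor_def by (intro star_homD(1)[OF proj_hom] pair_basis_closed)

lemma pure_add_l:
  assumes "a \<in> carrier A" "a' \<in> carrier A" "b \<in> carrier B"
  shows "pure_tensor A B (a \<oplus>\<^bsub>A\<^esub> a') b = pure_tensor A B a b \<oplus>\<^bsub>tensor A B\<^esub> pure_tensor A B a' b"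
  unfolding pure_tensor_def
  by (subst star_homD(2)[OF proj_hom, symmetric], (intro pair_basis_closed assms)+, rule proj_rel)
    (use assms in \<open>simp add: tensor_rels_intros\<close>)

lemma pure_add_r:
  assumes "a \<in> carrier A" "b \<in> carrier B" "b' \<in> carrier B"
  shows "pure_tensor A B a (b \<oplus>\<^bsub>B\<^esub> b') = pure_tensor A B a b \<oplus>\<^bsub>tensor A B\<^esub> pure_tensor A B a b'"
  unfolding pure_tensor_def
  by (subst star_homD(2)[OF proj_hom, symmetric], (intro pair_basis_closed assms)+, rule proj_rel)
    (use assms in \<open>simp add: tensor_rels_intros\<close>)

lemma pure_smult_l:
  assumes "a \<in> carrier A" "b \<in> carrier B"
  shows "pure_tensor A B (c \<odot>\<^bsub>A\<^esub> a) b = c \<odot>\<^bsub>tensor A B\<^esub> pure_tensor A B a b"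
  unfolding pure_tensor_def
  by (subst star_homD(5)[OF proj_hom, symmetric], (intro pair_basis_closed assms)+, rule proj_rel)
    (use assms in \<open>simp add: tensor_rels_intros\<close>)

lemma pure_smult_r:
  assumes "a \<in> carrier A" "b \<in> carrier B"
  shows "pure_tensor A B a (c \<odot>\<^bsub>B\<^esub> b) = c \<odot>\<^bsub>tensor A B\<^esub> pure_tensor A B a b"
  unfolding pure_tensor_def
  by (subst star_homD(5)[OF proj_hom, symmetric], (intro pair_basis_closed assms)+, rule proj_rel)
    (use assms in \<open>simp add: tensor_rels_intros\<close>)

lemma pure_mult:
  assumes "a \<in> carrier A" "b \<in> carrier B" "a' \<in> carrier A" "b' \<in> carrier B"
  shows "pure_tensor A B a b \<otimes>\<^bsub>tensor A B\<^esub> pure_tensor A B a' b' =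
    pure_tensor A B (a \<otimes>\<^bsub>A\<^esub> a') (b \<otimes>\<^bsub>B\<^esub> b')"
  unfolding pure_tensor_def
  by (subst star_homD(3)[OF proj_hom, symmetric]) (simp_all add: pair_basis_closed assms mult_pair_basis)

lemma pure_star:
  assumes "a \<in> carrier A" "b \<in> carrier B"
  shows "star (tensor A B) (pure_tensor A B a b) = pure_tensor A B (star A a) (star B b)"
  unfolding pure_tensor_def
  by (subst star_homD(6)[OF proj_hom, symmetric]) (simp_all add: pair_basis_closed assms star_pair_basis)

lemma pure_one: "\<one>\<^bsub>tensor A B\<^esub> = pure_tensor A B \<one>\<^bsub>A\<^esub> \<one>\<^bsub>B\<^esub>"
  unfolding pure_tensor_def star_homD(4)[OF proj_hom, symmetric] F.one_MA by (simp add: DirProd_def)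

lemma tensor_projE:
  assumes "x \<in> carrier (tensor A B)"
  obtains f where "f \<in> carrier (tensor_free A B)" "x = tensor_null A B +>\<^bsub>tensor_free A B\<^esub> f"
  using assms unfolding tensor_def Q.carrier_star_quotient by auto

text \<open>Scalars give no case of their own because a multiple of a pure tensor is again pure: the
  scalar is absorbed by the left factor.\<close>

lemma tensor_induct [consumes 1, case_names pure add]:
  assumes "x \<in> carrier (tensor A B)"
    "\<And>a b. a \<in> carrier A \<Longrightarrow> b \<in> carrier B \<Longrightarrow> P (pure_tensor A B a b)"
    "\<And>x y. x \<in> carrier (tensor A B) \<Longrightarrow> y \<in> carrier (tensor A B) \<Longrightarrow> P x \<Longrightarrow> P y \<Longrightarrow>
       P (x \<oplus>\<^bsub>tensor A B\<^esub> y)"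
  shows "P x"
proof -
  obtain f where f: "f \<in> carrier (tensor_free A B)" and x: "x = tensor_null A B +>\<^bsub>tensor_free A B\<^esub> f"
    using assms(1) unfolding tensor_def Q.carrier_star_quotient by auto
  have basis: "P (tensor_null A B +>\<^bsub>tensor_free A B\<^esub> Poly_Mapping.single (a, b) c)"
    if "a \<in> carrier A" "b \<in> carrier B" for a b c
  proof -
    have "tensor_null A B +>\<^bsub>tensor_free A B\<^esub> Poly_Mapping.single (a, b) c =
        tensor_null A B +>\<^bsub>tensor_free A B\<^esub> (c \<odot>\<^bsub>tensor_free A B\<^esub> pair_basis a b)"
      by (simp add: F.smult_MA_single)
    also have "\<dots> = c \<odot>\<^bsub>tensor A B\<^esub> pure_tensor A B a b"
      unfolding pure_tensor_def using that by (intro star_homD(5)[OF proj_hom] pair_basis_closed)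
    also have "\<dots> = pure_tensor A B (c \<odot>\<^bsub>A\<^esub> a) b" using that by (simp add: pure_smult_l)
    finally show ?thesis using assms(2) that by simp
  qed
  show ?thesis unfolding x using f
  proof (induction rule: F.MA_induct)
    case zero show ?case using basis[of "\<zero>\<^bsub>A\<^esub>" "\<zero>\<^bsub>B\<^esub>" 0] by simp
  next
    case (single z c) then show ?case
      using basis by (cases z) (auto simp: DirProd_def)
  next
    case (add f g) then show ?case
      using assms(3) star_homD(1,2)[OF proj_hom] by (simp flip: F.add_MA)
  qed
qed

section \<open>Linear maps induced by bilinear maps\<close>

context
  fixes V :: "'c star_algebra" and \<beta>
  assumes V: "star_alg V" and \<beta>: "bilinear_into A B V \<beta>"
begin

interpretation V: star_alg V by (rule V)

abbreviation "lext \<equiv> lin_ext V (\<lambda>z. \<beta> (fst z) (snd z))"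

lemma \<beta>_Pi: "(\<lambda>z. \<beta> (fst z) (snd z)) \<in> carrier (A \<times>\<times> B) \<rightarrow> carrier V"
  using \<beta> by (auto simp: bilinear_into_def DirProd_def)

lemma lext_closed: "f \<in> carrier (tensor_free A B) \<Longrightarrow> lext f \<in> carrier V"
  using V.lin_ext_closed[OF _ \<beta>_Pi] by (simp add: F.carrier_MA)

lemma lext_add: "f \<in> carrier (tensor_free A B) \<Longrightarrow> g \<in> carrier (tensor_free A B) \<Longrightarrow>
    lext (f \<oplus>\<^bsub>tensor_free A B\<^esub> g) = lext f \<oplus>\<^bsub>V\<^esub> lext g"
  using V.lin_ext_add[OF _ _ \<beta>_Pi] by (simp add: F.carrier_MA F.add_MA)

lemma lext_smult: "f \<in> carrier (tensor_free A B) \<Longrightarrow> lext (c \<odot>\<^bsub>tensor_free A B\<^esub> f) = c \<odot>\<^bsub>V\<^esub> lext f"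
  using V.lin_ext_smult[OF _ \<beta>_Pi] by (simp add: F.carrier_MA F.smult_MA)

lemma lext_pair_basis: "a \<in> carrier A \<Longrightarrow> b \<in> carrier B \<Longrightarrow> lext (pair_basis a b) = \<beta> a b"
  using \<beta> by (subst V.lin_ext_single) (auto simp: bilinear_into_def)

lemma lext_rels: "(l, r) \<in> rels \<Longrightarrow> lext l = lext r"
  using \<beta> unfolding tensor_rels_iff
  by (auto simp: lext_pair_basis lext_add lext_smult pair_basis_closed bilinear_into_def)

text \<open>\<open>lext\<close> is linear, and the null space is spanned by differences on which it
  vanishes. Linearity alone carries the argument, which matters for the antipode:
  \<open>S x \<otimes> y\<close> is bilinear but not multiplicative in the pair.\<close>

lemma lext_null: "f \<in> tensor_null A B \<Longrightarrow> lext f = \<zero>\<^bsub>V\<^esub>"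
proof -
  assume f: "f \<in> tensor_null A B"
  show ?thesis
    using differences_closed f unfolding tensor_null_def
  proof (induction rule: F.MA.lin_span_induct)
    case (gen x)
    then obtain l r where lr: "(l, r) \<in> rels" and x: "x = l \<ominus>\<^bsub>tensor_free A B\<^esub> r"
      by (auto simp: differences_def)
    have c: "l \<in> carrier (tensor_free A B)" "r \<in> carrier (tensor_free A B)"
      using lr tensor_rels_closed by auto
    then have "lext x = lext l \<ominus>\<^bsub>V\<^esub> lext r"
      by (simp add: x F.MA.diff_eq_smult V.diff_eq_smult lext_add lext_smult lext_closed)
    then show ?case using lext_rels[OF lr] c by (simp add: lext_closed V.minus_eq V.r_neg)
  qed (auto simp: lext_add lext_smult F.zero_MA V.lin_ext_zero)
qed

text \<open>The representative chosen in \<open>tensor_lift\<close> differs from \<open>f\<close> by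
  a null element, so the choice does not show in the value. The other facts on induced maps are read
  off from \<open>lext\<close> through this one.\<close>

lemma tensor_lift_proj:
  assumes "f \<in> carrier (tensor_free A B)"
  shows "tensor_lift V \<beta> (tensor_null A B +>\<^bsub>tensor_free A B\<^esub> f) = lext f"
proof -
  let ?T = "tensor_null A B +>\<^bsub>tensor_free A B\<^esub> f"
  have "(SOME g. g \<in> ?T) \<in> ?T" using Q.rcos_self[OF assms] by (rule someI)
  then obtain i where "i \<in> tensor_null A B" "i \<in> carrier (tensor_free A B)"
    "(SOME g. g \<in> ?T) = i \<oplus>\<^bsub>tensor_free A B\<^esub> f"
    using assms by (rule Q.mem_rcosE)
  then show ?thesis
    using assms by (simp add: tensor_lift_def Let_def lin_ext_def[symmetric] lext_add lext_null lext_closed)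
qed

lemma tensor_lift_pure:
  "a \<in> carrier A \<Longrightarrow> b \<in> carrier B \<Longrightarrow> tensor_lift V \<beta> (pure_tensor A B a b) = \<beta> a b"
  unfolding pure_tensor_def by (simp add: tensor_lift_proj pair_basis_closed lext_pair_basis)

lemma tensor_lift_closed: "x \<in> carrier (tensor A B) \<Longrightarrow> tensor_lift V \<beta> x \<in> carrier V"
  by (erule tensor_projE) (simp add: tensor_lift_proj lext_closed)

lemma tensor_lift_add:
  assumes "x \<in> carrier (tensor A B)" "y \<in> carrier (tensor A B)"
  shows "tensor_lift V \<beta> (x \<oplus>\<^bsub>tensor A B\<^esub> y) = tensor_lift V \<beta> x \<oplus>\<^bsub>V\<^esub> tensor_lift V \<beta> y"
proof -
  obtain f g where fg: "f \<in> carrier (tensor_free A B)" "x = tensor_null A B +>\<^bsub>tensor_free A B\<^esub> f"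
    "g \<in> carrier (tensor_free A B)" "y = tensor_null A B +>\<^bsub>tensor_free A B\<^esub> g"
    using assms by (metis tensor_projE)
  then show ?thesis
    by (simp add: star_homD(2)[OF proj_hom, symmetric] tensor_lift_proj lext_add)
qed

lemma tensor_lift_zero: "tensor_lift V \<beta> \<zero>\<^bsub>tensor A B\<^esub> = \<zero>\<^bsub>V\<^esub>"
  using star_hom_zero[OF F.star_alg_MA star_alg_tensor proj_hom]
    tensor_lift_proj[OF F.MA.zero_closed] lext_null[OF Q.zero_closed] by simp

lemma tensor_lift_finsum:
  assumes "g \<in> K \<rightarrow> carrier (tensor A B)"
  shows "tensor_lift V \<beta> (\<Oplus>\<^bsub>tensor A B\<^esub>k\<in>K. g k) = (\<Oplus>\<^bsub>V\<^esub>k\<in>K. tensor_lift V \<beta> (g k))"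
  by (rule additive_finsum[OF T.abelian_monoid_axioms V.abelian_monoid_axioms])
    (use assms in \<open>auto simp: tensor_lift_zero tensor_lift_add tensor_lift_closed\<close>)

lemma tensor_lift_smult:
  assumes "x \<in> carrier (tensor A B)"
  shows "tensor_lift V \<beta> (c \<odot>\<^bsub>tensor A B\<^esub> x) = c \<odot>\<^bsub>V\<^esub> tensor_lift V \<beta> x"
proof -
  obtain f where fg: "f \<in> carrier (tensor_free A B)" "x = tensor_null A B +>\<^bsub>tensor_free A B\<^esub> f"
    using assms by (metis tensor_projE)
  then show ?thesis
    by (simp add: star_homD(5)[OF proj_hom, symmetric] tensor_lift_proj lext_smult)
qed

end

end

section \<open>Families satisfying the quantum reflection relations\<close>

declare One_nat_def [simp del]

context star_alg
begin

lemma sum_cong: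
  "(\<And>i. i \<in> K \<Longrightarrow> f i = g i) \<Longrightarrow> (\<And>i. i \<in> K \<Longrightarrow> g i \<in> carrier A) \<Longrightarrow>
    (\<Oplus>i\<in>K. f i) = (\<Oplus>i\<in>K. g i)"
  by (rule finsum_cong') auto

lemma sum_closed: "(\<And>i. i \<in> K \<Longrightarrow> f i \<in> carrier A) \<Longrightarrow> (\<Oplus>i\<in>K. f i) \<in> carrier A"
  by (rule finsum_closed) auto

lemma sum_mult_r:
  "finite K \<Longrightarrow> a \<in> carrier A \<Longrightarrow> (\<And>i. i \<in> K \<Longrightarrow> f i \<in> carrier A) \<Longrightarrow>
    (\<Oplus>i\<in>K. f i) \<otimes> a = (\<Oplus>i\<in>K. f i \<otimes> a)"
  by (rule finsum_ldistr) auto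

lemma sum_mult_l:
  "finite K \<Longrightarrow> a \<in> carrier A \<Longrightarrow> (\<And>i. i \<in> K \<Longrightarrow> f i \<in> carrier A) \<Longrightarrow>
    a \<otimes> (\<Oplus>i\<in>K. f i) = (\<Oplus>i\<in>K. a \<otimes> f i)"
  by (rule finsum_rdistr) auto

lemma sum_delta:
  "i \<in> K \<Longrightarrow> finite K \<Longrightarrow> f i \<in> carrier A \<Longrightarrow> (\<Oplus>j\<in>K. if i = j then f j else \<zero>) = f i"
  using finsum_singleton[of i K "\<lambda>_. f i"] by (simp cong: if_cong)

lemma sum_delta':
  "i \<in> K \<Longrightarrow> finite K \<Longrightarrow> f i \<in> carrier A \<Longrightarrow> (\<Oplus>j\<in>K. if j = i then f j else \<zero>) = f i"
  using sum_delta[of i K f] by (simp add: eq_commute)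

lemma sum_swap:
  assumes "finite K" "finite J" "\<And>i j. i \<in> K \<Longrightarrow> j \<in> J \<Longrightarrow> f i j \<in> carrier A"
  shows "(\<Oplus>i\<in>K. \<Oplus>j\<in>J. f i j) = (\<Oplus>j\<in>J. \<Oplus>i\<in>K. f i j)"
  using assms(1,3)
proof (induction K rule: finite_induct)
  case (insert x K)
  have "(\<Oplus>i\<in>insert x K. \<Oplus>j\<in>J. f i j) = (\<Oplus>j\<in>J. f x j) \<oplus> (\<Oplus>j\<in>J. \<Oplus>i\<in>K. f i j)"
    using insert by (subst finsum_insert) (auto intro!: sum_closed)
  also have "\<dots> = (\<Oplus>j\<in>J. f x j \<oplus> (\<Oplus>i\<in>K. f i j))"
    using insert by (subst finsum_addf) (auto intro!: sum_closed)
  also have "\<dots> = (\<Oplus>j\<in>J. \<Oplus>i\<in>insert x K. f i j)"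
    using insert by (intro sum_cong) (auto simp: finsum_insert intro!: sum_closed)
  finally show ?case .
qed simp

lemma sum_mult_sum:
  assumes "finite K" "\<And>i. i \<in> K \<Longrightarrow> x i \<in> carrier A" "\<And>i. i \<in> K \<Longrightarrow> y i \<in> carrier A"
  shows "(\<Oplus>l\<in>K. x l) \<otimes> (\<Oplus>m\<in>K. y m) = (\<Oplus>l\<in>K. \<Oplus>m\<in>K. x l \<otimes> y m)"
proof -
  have "(\<Oplus>l\<in>K. x l) \<otimes> (\<Oplus>m\<in>K. y m) = (\<Oplus>l\<in>K. x l \<otimes> (\<Oplus>m\<in>K. y m))"
    using assms by (intro sum_mult_r sum_closed)
  also have "\<dots> = (\<Oplus>l\<in>K. \<Oplus>m\<in>K. x l \<otimes> y m)"
    using assms by (intro sum_cong sum_mult_l sum_closed m_closed)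
  finally show ?thesis .
qed

lemma star_sum:
  "(\<And>i. i \<in> K \<Longrightarrow> f i \<in> carrier A) \<Longrightarrow> star A (\<Oplus>i\<in>K. f i) = (\<Oplus>i\<in>K. star A (f i))"
  by (rule additive_finsum[OF abelian_monoid_axioms abelian_monoid_axioms]) (auto simp: star_add)

lemma mult_exchange:
  assumes "x \<in> carrier A" "y \<in> carrier A" "x' \<in> carrier A" "y' \<in> carrier A" "y \<otimes> x' = x' \<otimes> y"
  shows "(x \<otimes> y) \<otimes> (x' \<otimes> y') = (x \<otimes> x') \<otimes> (y \<otimes> y')"
  using assms by (metis m_assoc m_closed)

end

text \<open>The defining relations of \<open>refl_algebra G N\<close>, read in an arbitrary
  *-algebra \<open>B\<close>. Such a family amounts to a *-homomorphism from that algebra to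
  \<open>B\<close>, so constructing a structure map means exhibiting a family.\<close>

locale refl_family = B: star_alg B + G: group G
  for G :: "('g, 'r) monoid_scheme" and N :: nat and B :: "'b star_algebra"
    and b :: "nat \<Rightarrow> nat \<Rightarrow> 'g \<Rightarrow> 'b" +
  assumes closed: "i \<in> {1..N} \<Longrightarrow> j \<in> {1..N} \<Longrightarrow> g \<in> carrier G \<Longrightarrow> b i j g \<in> carrier B"
    and star_b: "i \<in> {1..N} \<Longrightarrow> j \<in> {1..N} \<Longrightarrow> g \<in> carrier G \<Longrightarrow> star B (b i j g) = b i j (inv\<^bsub>G\<^esub> g)"
    and row: "i \<in> {1..N} \<Longrightarrow> j \<in> {1..N} \<Longrightarrow> k \<in> {1..N} \<Longrightarrow> g \<in> carrier G \<Longrightarrow> h \<in> carrier G \<Longrightarrow>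
      b i j g \<otimes>\<^bsub>B\<^esub> b i k h = (if j = k then b i j (g \<otimes>\<^bsub>G\<^esub> h) else \<zero>\<^bsub>B\<^esub>)"
    and col: "i \<in> {1..N} \<Longrightarrow> j \<in> {1..N} \<Longrightarrow> k \<in> {1..N} \<Longrightarrow> g \<in> carrier G \<Longrightarrow> h \<in> carrier G \<Longrightarrow>
      b j i g \<otimes>\<^bsub>B\<^esub> b k i h = (if j = k then b j i (g \<otimes>\<^bsub>G\<^esub> h) else \<zero>\<^bsub>B\<^esub>)"
    and row_sum_one: "i \<in> {1..N} \<Longrightarrow> (\<Oplus>\<^bsub>B\<^esub>k\<in>{1..N}. b i k \<one>\<^bsub>G\<^esub>) = \<one>\<^bsub>B\<^esub>"
    and col_sum_one: "j \<in> {1..N} \<Longrightarrow> (\<Oplus>\<^bsub>B\<^esub>k\<in>{1..N}. b k j \<one>\<^bsub>G\<^esub>) = \<one>\<^bsub>B\<^esub>"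
begin

definition row_sum :: "nat \<Rightarrow> 'g \<Rightarrow> 'b" where
  "row_sum i g = (\<Oplus>\<^bsub>B\<^esub>k\<in>{1..N}. b i k g)"

lemma row_sum_closed: "i \<in> {1..N} \<Longrightarrow> g \<in> carrier G \<Longrightarrow> row_sum i g \<in> carrier B"
  unfolding row_sum_def by (intro B.sum_closed closed)

text \<open>Within row \<open>i\<close>, products of entries in different columns vanish, so only
  the summand \<open>k = j\<close> survives. Taking for \<open>h\<close> the identity recovers
  \<open>b i j g\<close> from a row sum and a projection.\<close>

lemma row_sum_mult_b:
  assumes "i \<in> {1..N}" "j \<in> {1..N}" "g \<in> carrier G" "h \<in> carrier G"
  shows "row_sum i g \<otimes>\<^bsub>B\<^esub> b i j h = b i j (g \<otimes>\<^bsub>G\<^esub> h)"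
proof -
  have "row_sum i g \<otimes>\<^bsub>B\<^esub> b i j h = (\<Oplus>\<^bsub>B\<^esub>k\<in>{1..N}. b i k g \<otimes>\<^bsub>B\<^esub> b i j h)"
    unfolding row_sum_def using assms by (intro B.sum_mult_r closed) auto
  also have "\<dots> = (\<Oplus>\<^bsub>B\<^esub>k\<in>{1..N}. if k = j then b i k (g \<otimes>\<^bsub>G\<^esub> h) else \<zero>\<^bsub>B\<^esub>)"
    using assms by (intro B.sum_cong) (auto simp: row closed)
  also have "\<dots> = b i j (g \<otimes>\<^bsub>G\<^esub> h)"
    using assms by (intro B.sum_delta') (auto simp: closed)
  finally show ?thesis .
qed

text \<open>The group elements now multiply in the opposite order. The two orders agree when
  \<open>h\<close> is the identity, hence row sums commute with the projections of their own
  row.\<close>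

lemma b_mult_row_sum:
  assumes "i \<in> {1..N}" "j \<in> {1..N}" "g \<in> carrier G" "h \<in> carrier G"
  shows "b i j h \<otimes>\<^bsub>B\<^esub> row_sum i g = b i j (h \<otimes>\<^bsub>G\<^esub> g)"
proof -
  have "b i j h \<otimes>\<^bsub>B\<^esub> row_sum i g = (\<Oplus>\<^bsub>B\<^esub>k\<in>{1..N}. b i j h \<otimes>\<^bsub>B\<^esub> b i k g)"
    unfolding row_sum_def using assms by (intro B.sum_mult_l closed) auto
  also have "\<dots> = (\<Oplus>\<^bsub>B\<^esub>k\<in>{1..N}. if j = k then b i k (h \<otimes>\<^bsub>G\<^esub> g) else \<zero>\<^bsub>B\<^esub>)"
    using assms by (intro B.sum_cong) (auto simp: row closed)
  also have "\<dots> = b i j (h \<otimes>\<^bsub>G\<^esub> g)"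
    using assms by (intro B.sum_delta) (auto simp: closed)
  finally show ?thesis .
qed

lemma row_sum_mult:
  assumes "i \<in> {1..N}" "g \<in> carrier G" "h \<in> carrier G"
  shows "row_sum i g \<otimes>\<^bsub>B\<^esub> row_sum i h = row_sum i (g \<otimes>\<^bsub>G\<^esub> h)"
proof -
  have "row_sum i g \<otimes>\<^bsub>B\<^esub> row_sum i h = (\<Oplus>\<^bsub>B\<^esub>k\<in>{1..N}. row_sum i g \<otimes>\<^bsub>B\<^esub> b i k h)"
    unfolding row_sum_def[of i h] using assms by (intro B.sum_mult_l closed row_sum_closed) auto
  also have "\<dots> = (\<Oplus>\<^bsub>B\<^esub>k\<in>{1..N}. b i k (g \<otimes>\<^bsub>G\<^esub> h))"
    using assms by (intro B.sum_cong) (auto simp: row_sum_mult_b closed)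
  finally show ?thesis by (simp add: row_sum_def)
qed

lemma star_row_sum:
  assumes "i \<in> {1..N}" "g \<in> carrier G"
  shows "star B (row_sum i g) = row_sum i (inv\<^bsub>G\<^esub> g)"
  unfolding row_sum_def using assms
  by (subst B.star_sum) (auto simp: closed star_b intro!: B.sum_cong)

lemma row_sum_one': "i \<in> {1..N} \<Longrightarrow> row_sum i \<one>\<^bsub>G\<^esub> = \<one>\<^bsub>B\<^esub>"
  by (simp add: row_sum_def row_sum_one)

text \<open>Each entry \<open>b k j g\<close> is \<open>row_sum k g\<close> times the projection in
  the same position. If the row sums at \<open>g\<close> have a common value \<open>u\<close>, it
  can be pulled out of the column sum, leaving a column of projections whose sum is the
  unit.\<close>

lemma col_sum_eq_row_sum:
  assumes "j \<in> {1..N}" "g \<in> carrier G" "\<And>k. k \<in> {1..N} \<Longrightarrow> row_sum k g = u" "u \<in> carrier B"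
  shows "(\<Oplus>\<^bsub>B\<^esub>k\<in>{1..N}. b k j g) = u"
proof -
  have "(\<Oplus>\<^bsub>B\<^esub>k\<in>{1..N}. b k j g) = (\<Oplus>\<^bsub>B\<^esub>k\<in>{1..N}. u \<otimes>\<^bsub>B\<^esub> b k j \<one>\<^bsub>G\<^esub>)"
    using assms row_sum_mult_b[of _ j g "\<one>\<^bsub>G\<^esub>"] by (intro B.sum_cong) (auto simp: closed)
  also have "\<dots> = u \<otimes>\<^bsub>B\<^esub> (\<Oplus>\<^bsub>B\<^esub>k\<in>{1..N}. b k j \<one>\<^bsub>G\<^esub>)"
    using assms by (intro B.sum_mult_l[symmetric]) (auto simp: closed)
  also have "\<dots> = u" using assms by (simp add: col_sum_one)
  finally show ?thesis .
qed

end

lemma refl_family_image: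
  assumes "refl_family G N A b" "star_alg B" "f \<in> star_hom A B"
  shows "refl_family G N B (\<lambda>i j g. f (b i j g))"
proof -
  interpret b: refl_family G N A b by fact
  interpret B: star_alg B by fact
  note f = star_homD[OF assms(3)] star_hom_zero[OF b.B.star_alg_axioms assms(2,3)]
    star_hom_finsum[OF b.B.star_alg_axioms assms(2,3), symmetric]
  show ?thesis
    by (intro refl_family.intro refl_family_axioms.intro assms(2) b.G.group_axioms)
      (auto simp: f(1,4,7,8) b.closed b.star_b b.row b.col b.row_sum_one b.col_sum_one Pi_iff
        simp flip: f(3,6))
qed

text \<open>Reversing the product turns the antimultiplicative antipode into a homomorphism, to
  which the universal property applies. The involution is kept: here the antipode commutes with it,
  which in a Hopf *-algebra amounts to the antipode being its own inverse.\<close>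

definition op_alg :: "'a star_algebra \<Rightarrow> 'a star_algebra" where
  "op_alg A = A\<lparr>mult := \<lambda>x y. y \<otimes>\<^bsub>A\<^esub> x\<rparr>"

lemma op_alg_simps [simp]:
  "carrier (op_alg A) = carrier A" "x \<otimes>\<^bsub>op_alg A\<^esub> y = y \<otimes>\<^bsub>A\<^esub> x" "\<one>\<^bsub>op_alg A\<^esub> = \<one>\<^bsub>A\<^esub>"
  "\<zero>\<^bsub>op_alg A\<^esub> = \<zero>\<^bsub>A\<^esub>" "x \<oplus>\<^bsub>op_alg A\<^esub> y = x \<oplus>\<^bsub>A\<^esub> y" "c \<odot>\<^bsub>op_alg A\<^esub> x = c \<odot>\<^bsub>A\<^esub> x"
  "star (op_alg A) x = star A x" "finsum (op_alg A) f K = finsum A f K"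
  by (simp_all add: op_alg_def finsum_def)

lemma star_alg_op_alg:
  assumes "star_alg A" shows "star_alg (op_alg A)"
proof -
  interpret star_alg A by fact
  have "\<exists>y\<in>carrier A. y \<oplus>\<^bsub>A\<^esub> x = \<zero>\<^bsub>A\<^esub>" if "x \<in> carrier A" for x
    using that l_neg by blast
  then show ?thesis
    by (intro star_alg.intro ringI abelian_groupI monoidI star_alg_axioms.intro)
      (auto simp: a_ac m_assoc l_distr r_distr smult_l_distr smult_r_distr smult_smult smult_mult_l
        smult_mult_r star_add star_smult star_mult)
qed

text \<open>Transposition exchanges the row relations with the column relations, and the reversed
  product multiplies the inverses in the order that gives the inverse of the product. This is the
  family behind the antipode.\<close>

lemma (in refl_family) refl_family_op:
  "refl_family G N (op_alg B) (\<lambda>i j g. b j i (inv\<^bsub>G\<^esub> g))"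
  by (intro refl_family.intro refl_family_axioms.intro star_alg_op_alg B.star_alg_axioms
      G.group_axioms)
    (auto simp: closed star_b row col row_sum_one col_sum_one G.inv_mult_group)

lemma row_sum_convolution:
  assumes "refl_family G N B b" "refl_family G N B c" "i \<in> {1..N}" "g \<in> carrier G"
  shows "(\<Oplus>\<^bsub>B\<^esub>j\<in>{1..N}. \<Oplus>\<^bsub>B\<^esub>k\<in>{1..N}. b i k g \<otimes>\<^bsub>B\<^esub> c k j g) =
    (\<Oplus>\<^bsub>B\<^esub>k\<in>{1..N}. b i k g \<otimes>\<^bsub>B\<^esub> (\<Oplus>\<^bsub>B\<^esub>j\<in>{1..N}. c k j g))"
proof -
  interpret b: refl_family G N B b by fact
  interpret c: refl_family G N B c by fact
  have "(\<Oplus>\<^bsub>B\<^esub>j\<in>{1..N}. \<Oplus>\<^bsub>B\<^esub>k\<in>{1..N}. b i k g \<otimes>\<^bsub>B\<^esub> c k j g) =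
      (\<Oplus>\<^bsub>B\<^esub>k\<in>{1..N}. \<Oplus>\<^bsub>B\<^esub>j\<in>{1..N}. b i k g \<otimes>\<^bsub>B\<^esub> c k j g)"
    using assms(3,4) by (intro b.B.sum_swap b.B.m_closed b.closed c.closed) auto
  also have "\<dots> = (\<Oplus>\<^bsub>B\<^esub>k\<in>{1..N}. b i k g \<otimes>\<^bsub>B\<^esub> (\<Oplus>\<^bsub>B\<^esub>j\<in>{1..N}. c k j g))"
    using assms(3,4)
    by (intro b.B.sum_cong b.B.sum_mult_l[symmetric] b.B.m_closed b.closed c.closed b.B.sum_closed) auto
  finally show ?thesis .
qed

text \<open>The matrix product of two families whose entries commute with each other, taken at each
  group element separately. Applied to the two legs of a tensor product it yields the coproduct
  formula.\<close>

lemma refl_family_convolution: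
  assumes "refl_family G N B b" "refl_family G N B c"
    and comm: "\<And>i j k l g h. i \<in> {1..N} \<Longrightarrow> j \<in> {1..N} \<Longrightarrow> k \<in> {1..N} \<Longrightarrow> l \<in> {1..N} \<Longrightarrow>
      g \<in> carrier G \<Longrightarrow> h \<in> carrier G \<Longrightarrow> c i j g \<otimes>\<^bsub>B\<^esub> b k l h = b k l h \<otimes>\<^bsub>B\<^esub> c i j g"
  shows "refl_family G N B (\<lambda>i j g. \<Oplus>\<^bsub>B\<^esub>k\<in>{1..N}. b i k g \<otimes>\<^bsub>B\<^esub> c k j g)"
proof -
  interpret b: refl_family G N B b by fact
  interpret c: refl_family G N B c by fact
  define d where "d i j g = (\<Oplus>\<^bsub>B\<^esub>k\<in>{1..N}. b i k g \<otimes>\<^bsub>B\<^esub> c k j g)" for i j g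
  note cl = b.closed c.closed b.G.m_closed b.G.inv_closed b.G.one_closed b.B.m_closed
  \<comment> \<open>Commutation of \<open>c\<close> with \<open>b\<close> sorts each product into a
    \<open>b\<close>-part and a \<open>c\<close>-part, so that the relations of either family become
    applicable.\<close>
  have mult: "d i j g \<otimes>\<^bsub>B\<^esub> d i' k h = (\<Oplus>\<^bsub>B\<^esub>l\<in>{1..N}. \<Oplus>\<^bsub>B\<^esub>m\<in>{1..N}.
      (b i l g \<otimes>\<^bsub>B\<^esub> b i' m h) \<otimes>\<^bsub>B\<^esub> (c l j g \<otimes>\<^bsub>B\<^esub> c m k h))"
    if "i \<in> {1..N}" "i' \<in> {1..N}" "j \<in> {1..N}" "k \<in> {1..N}" "g \<in> carrier G" "h \<in> carrier G"
    for i i' j k g h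
    unfolding d_def using that
    by (subst b.B.sum_mult_sum) (auto simp: cl comm b.B.mult_exchange intro!: b.B.sum_cong b.B.sum_closed)
  have "refl_family G N B d"
  proof (intro refl_family.intro refl_family_axioms.intro b.B.star_alg_axioms b.G.group_axioms)
    fix i j g assume ij: "i \<in> {1..N}" "j \<in> {1..N}" and g: "g \<in> carrier G"
    show "d i j g \<in> carrier B"
      unfolding d_def using ij g by (intro b.B.sum_closed cl)
    show "star B (d i j g) = d i j (inv\<^bsub>G\<^esub> g)"
      unfolding d_def using ij g
      by (subst b.B.star_sum) (auto simp: cl b.B.star_mult b.star_b c.star_b comm intro!: b.B.sum_cong)
    fix k h assume k: "k \<in> {1..N}" and h: "h \<in> carrier G"
    have "d i j g \<otimes>\<^bsub>B\<^esub> d i k h = (\<Oplus>\<^bsub>B\<^esub>l\<in>{1..N}. \<Oplus>\<^bsub>B\<^esub>m\<in>{1..N}.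
        (if l = m then b i l (g \<otimes>\<^bsub>G\<^esub> h) \<otimes>\<^bsub>B\<^esub> (c l j g \<otimes>\<^bsub>B\<^esub> c m k h) else \<zero>\<^bsub>B\<^esub>))"
      unfolding mult[OF ij(1) ij(1,2) k g h] using ij k g h
      by (intro b.B.sum_cong b.B.sum_closed) (auto simp: cl b.row)
    also have "\<dots> = (\<Oplus>\<^bsub>B\<^esub>l\<in>{1..N}. if j = k then b i l (g \<otimes>\<^bsub>G\<^esub> h) \<otimes>\<^bsub>B\<^esub> c l j (g \<otimes>\<^bsub>G\<^esub> h) else \<zero>\<^bsub>B\<^esub>)"
      using ij k g h
      by (intro b.B.sum_cong, subst b.B.sum_delta) (auto simp: cl c.row)
    also have "\<dots> = (if j = k then d i j (g \<otimes>\<^bsub>G\<^esub> h) else \<zero>\<^bsub>B\<^esub>)" by (simp add: d_def)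
    finally show "d i j g \<otimes>\<^bsub>B\<^esub> d i k h = (if j = k then d i j (g \<otimes>\<^bsub>G\<^esub> h) else \<zero>\<^bsub>B\<^esub>)" .
    \<comment> \<open>For columns the roles are exchanged: the column relation of \<open>c\<close>
      forces \<open>l = m\<close>, and that of \<open>b\<close> then gives the condition on
      \<open>j\<close> and \<open>k\<close>. For rows it was \<open>b\<close> that collapsed the
      double sum.\<close>
    have "d j i g \<otimes>\<^bsub>B\<^esub> d k i h = (\<Oplus>\<^bsub>B\<^esub>l\<in>{1..N}. \<Oplus>\<^bsub>B\<^esub>m\<in>{1..N}.
        (if l = m then (b j l g \<otimes>\<^bsub>B\<^esub> b k m h) \<otimes>\<^bsub>B\<^esub> c l i (g \<otimes>\<^bsub>G\<^esub> h) else \<zero>\<^bsub>B\<^esub>))"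
      unfolding mult[OF ij(2) k ij(1) ij(1) g h] using ij k g h
      by (intro b.B.sum_cong b.B.sum_closed) (auto simp: cl c.col)
    also have "\<dots> = (\<Oplus>\<^bsub>B\<^esub>l\<in>{1..N}. if j = k then b j l (g \<otimes>\<^bsub>G\<^esub> h) \<otimes>\<^bsub>B\<^esub> c l i (g \<otimes>\<^bsub>G\<^esub> h) else \<zero>\<^bsub>B\<^esub>)"
      using ij k g h
      by (intro b.B.sum_cong, subst b.B.sum_delta) (auto simp: cl b.col)
    also have "\<dots> = (if j = k then d j i (g \<otimes>\<^bsub>G\<^esub> h) else \<zero>\<^bsub>B\<^esub>)" by (simp add: d_def)
    finally show "d j i g \<otimes>\<^bsub>B\<^esub> d k i h = (if j = k then d j i (g \<otimes>\<^bsub>G\<^esub> h) else \<zero>\<^bsub>B\<^esub>)" .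
  next
    fix i assume i: "i \<in> {1..N}"
    have "(\<Oplus>\<^bsub>B\<^esub>k\<in>{1..N}. d i k \<one>\<^bsub>G\<^esub>) = (\<Oplus>\<^bsub>B\<^esub>l\<in>{1..N}. b i l \<one>\<^bsub>G\<^esub>)"
      unfolding d_def row_sum_convolution[OF assms(1,2) i b.G.one_closed]
      using i by (intro b.B.sum_cong) (auto simp: cl c.row_sum_one)
    then show "(\<Oplus>\<^bsub>B\<^esub>k\<in>{1..N}. d i k \<one>\<^bsub>G\<^esub>) = \<one>\<^bsub>B\<^esub>" using i by (simp add: b.row_sum_one)
    have "(\<Oplus>\<^bsub>B\<^esub>k\<in>{1..N}. d k i \<one>\<^bsub>G\<^esub>) =
        (\<Oplus>\<^bsub>B\<^esub>l\<in>{1..N}. \<Oplus>\<^bsub>B\<^esub>k\<in>{1..N}. b k l \<one>\<^bsub>G\<^esub> \<otimes>\<^bsub>B\<^esub> c l i \<one>\<^bsub>G\<^esub>)"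
      unfolding d_def using i by (intro b.B.sum_swap cl) auto
    also have "\<dots> = (\<Oplus>\<^bsub>B\<^esub>l\<in>{1..N}. (\<Oplus>\<^bsub>B\<^esub>k\<in>{1..N}. b k l \<one>\<^bsub>G\<^esub>) \<otimes>\<^bsub>B\<^esub> c l i \<one>\<^bsub>G\<^esub>)"
      using i by (intro b.B.sum_cong b.B.sum_mult_r[symmetric] cl b.B.sum_closed) auto
    also have "\<dots> = (\<Oplus>\<^bsub>B\<^esub>l\<in>{1..N}. c l i \<one>\<^bsub>G\<^esub>)"
      using i by (intro b.B.sum_cong) (auto simp: cl b.col_sum_one)
    finally have "(\<Oplus>\<^bsub>B\<^esub>k\<in>{1..N}. d k i \<one>\<^bsub>G\<^esub>) = (\<Oplus>\<^bsub>B\<^esub>l\<in>{1..N}. c l i \<one>\<^bsub>G\<^esub>)" .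
    then show "(\<Oplus>\<^bsub>B\<^esub>k\<in>{1..N}. d k i \<one>\<^bsub>G\<^esub>) = \<one>\<^bsub>B\<^esub>" using i by (simp add: c.col_sum_one)
  qed
  then show ?thesis by (simp add: d_def[abs_def])
qed


context star_alg_pair
begin

lemma pure_hom_l: "(\<lambda>a. pure_tensor A B a \<one>\<^bsub>B\<^esub>) \<in> star_hom A (tensor A B)"
  by (rule star_homI) (simp_all add: pure_closed pure_add_l pure_smult_l pure_mult pure_star pure_one)

lemma pure_hom_r: "(\<lambda>b. pure_tensor A B \<one>\<^bsub>A\<^esub> b) \<in> star_hom B (tensor A B)"
  by (rule star_homI) (simp_all add: pure_closed pure_add_r pure_smult_r pure_mult pure_star pure_one)

lemma pure_mult_one:
  assumes "a \<in> carrier A" "b \<in> carrier B"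
  shows "pure_tensor A B a \<one>\<^bsub>B\<^esub> \<otimes>\<^bsub>tensor A B\<^esub> pure_tensor A B \<one>\<^bsub>A\<^esub> b = pure_tensor A B a b"
    "pure_tensor A B \<one>\<^bsub>A\<^esub> b \<otimes>\<^bsub>tensor A B\<^esub> pure_tensor A B a \<one>\<^bsub>B\<^esub> = pure_tensor A B a b"
  using assms by (simp_all add: pure_mult)

text \<open>The images of \<open>b\<close> and \<open>c\<close> in the two legs commute with each
  other, so their matrix product is again a family.\<close>

lemma refl_family_tensor:
  assumes "refl_family G N A b" "refl_family G N B c"
  shows "refl_family G N (tensor A B)
    (\<lambda>i j g. \<Oplus>\<^bsub>tensor A B\<^esub>k\<in>{1..N}. pure_tensor A B (b i k g) (c k j g))"
proof -
  interpret b: refl_family G N A b by fact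
  interpret c: refl_family G N B c by fact
  let ?b = "\<lambda>i j g. pure_tensor A B (b i j g) \<one>\<^bsub>B\<^esub>" and ?c = "\<lambda>i j g. pure_tensor A B \<one>\<^bsub>A\<^esub> (c i j g)"
  have bc: "refl_family G N (tensor A B) ?b" "refl_family G N (tensor A B) ?c"
    using refl_family_image[OF assms(1) star_alg_tensor pure_hom_l]
      refl_family_image[OF assms(2) star_alg_tensor pure_hom_r] .
  have eq: "(\<Oplus>\<^bsub>tensor A B\<^esub>k\<in>{1..N}. pure_tensor A B (b i k g) (c k j g)) =
      (\<Oplus>\<^bsub>tensor A B\<^esub>k\<in>{1..N}. ?b i k g \<otimes>\<^bsub>tensor A B\<^esub> ?c k j g)"
    if "i \<in> {1..N}" "j \<in> {1..N}" "g \<in> carrier G" for i j g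
    using that by (intro T.sum_cong) (auto simp: pure_mult b.closed c.closed pure_closed)
  interpret d: refl_family G N "tensor A B"
      "\<lambda>i j g. \<Oplus>\<^bsub>tensor A B\<^esub>k\<in>{1..N}. ?b i k g \<otimes>\<^bsub>tensor A B\<^esub> ?c k j g"
    by (rule refl_family_convolution[OF bc]) (simp add: pure_mult_one b.closed c.closed)
  show ?thesis
    using d.closed d.star_b d.row d.col d.row_sum_one d.col_sum_one
    by (intro refl_family.intro refl_family_axioms.intro star_alg_tensor b.G.group_axioms)
      (simp_all add: eq cong: T.finsum_cong)
qed

text \<open>Meant for the counit identities, where the scalar values of the counit make the bilinear
  map multiplicative in the pair. The antipode identities require a different argument.\<close>

lemma tensor_lift_mult:
  assumes "star_alg V" "bilinear_into A B V \<beta>"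
    "\<And>a b a' b'. a \<in> carrier A \<Longrightarrow> b \<in> carrier B \<Longrightarrow> a' \<in> carrier A \<Longrightarrow> b' \<in> carrier B \<Longrightarrow>
       \<beta> (a \<otimes>\<^bsub>A\<^esub> a') (b \<otimes>\<^bsub>B\<^esub> b') = \<beta> a b \<otimes>\<^bsub>V\<^esub> \<beta> a' b'"
    "x \<in> carrier (tensor A B)" "y \<in> carrier (tensor A B)"
  shows "tensor_lift V \<beta> (x \<otimes>\<^bsub>tensor A B\<^esub> y) = tensor_lift V \<beta> x \<otimes>\<^bsub>V\<^esub> tensor_lift V \<beta> y"
proof -
  interpret V: star_alg V by fact
  note lift = tensor_lift_pure[OF assms(1,2)] tensor_lift_add[OF assms(1,2)]
    tensor_lift_closed[OF assms(1,2)]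
  have closed: "\<beta> a b \<in> carrier V" if "a \<in> carrier A" "b \<in> carrier B" for a b
    using assms(2) that by (simp add: bilinear_into_def)
  show ?thesis using assms(4)
  proof (induction rule: tensor_induct)
    case (pure a b) show ?case using assms(5)
      by (induction rule: tensor_induct)
        (use pure in \<open>auto simp: pure_mult pure_closed lift assms(3) T.r_distr V.r_distr closed\<close>)
  qed (use assms(5) in \<open>simp_all add: T.l_distr V.l_distr lift\<close>)
qed

end

text \<open>The scalars as a *-algebra, so that the counit is obtained from the universal property
  as a *-homomorphism with this target.\<close>

definition complex_alg :: "complex star_algebra" where
  "complex_alg = \<lparr>carrier = UNIV, mult = (*), one = 1, zero = 0, add = (+), smult = (*), star = cnj\<rparr>"

lemma complex_alg_simps [simp]:
  "carrier complex_alg = UNIV" "x \<otimes>\<^bsub>complex_alg\<^esub> y = x * y" "\<one>\<^bsub>complex_alg\<^esub> = 1"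
  "\<zero>\<^bsub>complex_alg\<^esub> = 0" "x \<oplus>\<^bsub>complex_alg\<^esub> y = x + y" "c \<odot>\<^bsub>complex_alg\<^esub> x = c * x"
  "star complex_alg = cnj"
  by (simp_all add: complex_alg_def)

lemma star_alg_complex_alg: "star_alg complex_alg"
proof -
  have "\<exists>y. y + x = 0" for x :: complex by (rule exI[of _ "-x"]) simp
  then show ?thesis
    by (intro star_alg.intro ringI abelian_groupI monoidI star_alg_axioms.intro)
      (auto simp: algebra_simps)
qed

lemma refl_family_complex:
  assumes "group G"
  shows "refl_family G N complex_alg (\<lambda>i j g. if i = j then 1 else 0)"
proof -
  interpret C: star_alg complex_alg by (rule star_alg_complex_alg)
  have "(\<Oplus>\<^bsub>complex_alg\<^esub>k\<in>{1..N}. if i = k then 1 else 0) = 1"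
    "(\<Oplus>\<^bsub>complex_alg\<^esub>k\<in>{1..N}. if k = i then 1 else 0) = 1" if "i \<in> {1..N}" for i
    using C.sum_delta[of i "{1..N}" "\<lambda>_. 1"] C.sum_delta'[of i "{1..N}" "\<lambda>_. 1"] that
    by (simp_all cong: if_cong)
  then show ?thesis
    by (intro refl_family.intro refl_family_axioms.intro star_alg_complex_alg assms) auto
qed

text \<open>The relation sets are unions of set comprehensions with one, two, three or five
  parameters. These equivalences turn the statement that all relations are respected into one
  quantified equation for each kind of relation.\<close>

lemma ball_setcompr1:
  "(\<forall>z\<in>{(L i, R i) |i. P i}. Q z) \<longleftrightarrow> (\<forall>i. P i \<longrightarrow> Q (L i, R i))"
  by auto

lemma ball_setcompr2:
  "(\<forall>z\<in>{(L i j, R i j) |i j. P i j}. Q z) \<longleftrightarrow> (\<forall>i j. P i j \<longrightarrow> Q (L i j, R i j))"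
  by auto

lemma ball_setcompr3:
  "(\<forall>z\<in>{(L i j k, R i j k) |i j k. P i j k}. Q z) \<longleftrightarrow>
    (\<forall>i j k. P i j k \<longrightarrow> Q (L i j k, R i j k))"
  by (intro iffI ballI allI impI; (elim CollectE exE conjE)?) (blast, simp)

lemma ball_setcompr5:
  "(\<forall>z\<in>{(L i j k g h, R i j k g h) |i j k g h. P i j k g h}. Q z) \<longleftrightarrow>
    (\<forall>i j k g h. P i j k g h \<longrightarrow> Q (L i j k g h, R i j k g h))"
  by (intro iffI ballI allI impI; (elim CollectE exE conjE)?) (blast, simp)

lemmas ball_setcompr = ball_setcompr1 ball_setcompr2 ball_setcompr3 ball_setcompr5

context
  fixes G :: "('g, 'r) monoid_scheme" and N :: nat
  assumes G: "group G"
begin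

interpretation G: group G by (rule G)

interpretation F: star_alg "free_star_algebra (refl_gens G N)" by (rule star_alg_free_star_algebra)

lemma refl_free_gen_closed:
  "i \<in> {1..N} \<Longrightarrow> j \<in> {1..N} \<Longrightarrow> g \<in> carrier G \<Longrightarrow>
    free_gen (i, j, g) \<in> carrier (free_star_algebra (refl_gens G N))"
  by (intro free_gen_closed) (auto simp: refl_gens_def)

lemma refl_rels_closed:
  "refl_rels G N \<subseteq> carrier (free_star_algebra (refl_gens G N)) \<times> carrier (free_star_algebra (refl_gens G N))"
  by (auto simp: refl_rels_def Let_def refl_free_gen_closed intro!: F.sum_closed)

context
  fixes B f
  assumes B: "star_alg B" and f_hom: "f \<in> star_hom (free_star_algebra (refl_gens G N)) B"
begin

lemmas refl_rel_simps = star_homD[OF f_hom] star_hom_zero[OF F.star_alg_axioms B f_hom]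
  star_hom_finsum[OF F.star_alg_axioms B f_hom]

text \<open>Together with its converse this translates between homomorphisms of the free algebra
  that respect the relations and families in \<open>B\<close>. This direction serves the universal
  property, the converse the relations between the canonical generators.\<close>

lemma refl_family_rels:
  assumes "refl_family G N B (\<lambda>i j g. f (free_gen (i, j, g)))"
  shows "\<forall>z\<in>refl_rels G N. f (fst z) = f (snd z)"
proof -
  interpret b: refl_family G N B "\<lambda>i j g. f (free_gen (i, j, g))" by fact
  show ?thesis
    unfolding refl_rels_def Let_def ball_Un ball_setcompr fst_conv snd_conv
    by (intro conjI allI impI)
      (simp_all add: refl_rel_simps refl_free_gen_closed b.star_b b.row b.col b.row_sum_one b.col_sum_one
        Pi_iff del: atLeastAtMost_iff)
qed

lemma rels_refl_family:
  assumes "\<forall>z\<in>refl_rels G N. f (fst z) = f (snd z)"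
  shows "refl_family G N B (\<lambda>i j g. f (free_gen (i, j, g)))"
proof -
  note rels = assms[unfolded refl_rels_def Let_def ball_Un ball_setcompr fst_conv snd_conv]
  note closed = refl_free_gen_closed
  show ?thesis
  proof (intro refl_family.intro refl_family_axioms.intro B G)
    fix i j k g h
    assume i: "i \<in> {1..N}"
    show "(\<Oplus>\<^bsub>B\<^esub>k\<in>{1..N}. f (free_gen (i, k, \<one>\<^bsub>G\<^esub>))) = \<one>\<^bsub>B\<^esub>"
      using rels i by (simp add: refl_rel_simps(4,8)[symmetric] closed Pi_iff)
    show "(\<Oplus>\<^bsub>B\<^esub>k\<in>{1..N}. f (free_gen (k, i, \<one>\<^bsub>G\<^esub>))) = \<one>\<^bsub>B\<^esub>"
      using rels i by (simp add: refl_rel_simps(4,8)[symmetric] closed Pi_iff)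
    assume j: "j \<in> {1..N}" and g: "g \<in> carrier G"
    show "f (free_gen (i, j, g)) \<in> carrier B" using i j g by (intro refl_rel_simps closed)
    show "star B (f (free_gen (i, j, g))) = f (free_gen (i, j, inv\<^bsub>G\<^esub> g))"
      using rels i j g by (simp add: refl_rel_simps(6)[symmetric] closed)
    assume k: "k \<in> {1..N}" and h: "h \<in> carrier G"
    show "f (free_gen (i, j, g)) \<otimes>\<^bsub>B\<^esub> f (free_gen (i, k, h)) =
       (if j = k then f (free_gen (i, j, g \<otimes>\<^bsub>G\<^esub> h)) else \<zero>\<^bsub>B\<^esub>)"
      using rels i j k g h by (simp add: refl_rel_simps(3)[symmetric] refl_rel_simps(7) closed)
    show "f (free_gen (j, i, g)) \<otimes>\<^bsub>B\<^esub> f (free_gen (k, i, h)) =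
       (if j = k then f (free_gen (j, i, g \<otimes>\<^bsub>G\<^esub> h)) else \<zero>\<^bsub>B\<^esub>)"
      using rels i j k g h by (simp add: refl_rel_simps(3)[symmetric] refl_rel_simps(7) closed)
  qed
qed

end

end

section \<open>The Hopf structure of the quantum reflection algebra\<close>

locale reflection = G: group G for G :: "('g, 'r) monoid_scheme" + fixes N :: nat
begin

abbreviation "H \<equiv> refl_algebra G N"
abbreviation "a \<equiv> refl_gen G N"

lemma star_alg_H: "star_alg H"
  unfolding refl_algebra_def by (rule star_alg_presented[OF refl_rels_closed[OF G.group_axioms]])

sublocale H: star_alg H by (rule star_alg_H)

sublocale HH: star_alg_pair H H by unfold_locales

lemma refl_family_H: "refl_family G N H a"
proof -
  interpret F: star_alg "free_star_algebra (refl_gens G N)" by (rule star_alg_free_star_algebra)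
  note closed = refl_rels_closed[OF G.group_axioms, of N]
  show ?thesis
    using rels_refl_family[OF G.group_axioms star_alg_presented[OF closed] presented_proj[OF closed]]
      F.impose_proj_eq[OF closed]
    by (simp add: refl_algebra_def refl_gen_def[abs_def] presented_gen_def)
qed

sublocale a: refl_family G N H a by (rule refl_family_H)

lemma refl_lift:
  assumes "refl_family G N B b"
  shows "\<exists>h\<in>star_hom H B. \<forall>i\<in>{1..N}. \<forall>j\<in>{1..N}. \<forall>g\<in>carrier G. h (a i j g) = b i j g"
proof -
  interpret b: refl_family G N B b by fact
  have "\<exists>h\<in>star_hom (presented (refl_gens G N) (refl_rels G N)) B.
      \<forall>x\<in>refl_gens G N. h (presented_gen (refl_gens G N) (refl_rels G N) x) = (\<lambda>(i, j, g). b i j g) x"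
  proof (rule presented_lift[OF refl_rels_closed[OF G.group_axioms]])
    fix f l r
    assume f: "f \<in> star_hom (free_star_algebra (refl_gens G N)) B"
      "\<And>x. x \<in> refl_gens G N \<Longrightarrow> f (free_gen x) = (\<lambda>(i, j, g). b i j g) x"
      and lr: "(l, r) \<in> refl_rels G N"
    have eq: "f (free_gen (i, j, g)) = b i j g"
      if "i \<in> {1..N}" "j \<in> {1..N}" "g \<in> carrier G" for i j g
      using f(2)[of "(i, j, g)"] that by (simp add: refl_gens_def)
    have "refl_family G N B (\<lambda>i j g. f (free_gen (i, j, g)))"
      using b.closed b.star_b b.row b.col b.row_sum_one b.col_sum_one
      by (intro refl_family.intro refl_family_axioms.intro b.B.star_alg_axioms G.group_axioms)
        (simp_all add: eq cong: b.B.finsum_cong)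
    then show "f l = f r"
      using refl_family_rels[OF G.group_axioms b.B.star_alg_axioms f(1)] lr by force
  qed (auto simp: b.B.star_alg_axioms refl_gens_def b.closed)
  then show ?thesis
    by (auto simp: refl_algebra_def refl_gen_def refl_gens_def)
qed

lemma refl_generates:
  "star_generates H {a i j g |i j g. i \<in> {1..N} \<and> j \<in> {1..N} \<and> g \<in> carrier G}"
proof -
  have "{a i j g |i j g. i \<in> {1..N} \<and> j \<in> {1..N} \<and> g \<in> carrier G} =
      presented_gen (refl_gens G N) (refl_rels G N) ` refl_gens G N"
    by (force simp: refl_gen_def refl_gens_def)
  then show ?thesis
    using presented_generates[OF refl_rels_closed[OF G.group_axioms]] by (simp add: refl_algebra_def)
qed

lemma refl_hom_eqI:
  assumes "f \<in> star_hom H B" "f' \<in> star_hom H B"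
    "\<And>i j g. i \<in> {1..N} \<Longrightarrow> j \<in> {1..N} \<Longrightarrow> g \<in> carrier G \<Longrightarrow> f (a i j g) = f' (a i j g)"
    "x \<in> carrier H"
  shows "f x = f' x"
  by (rule star_hom_eqI[OF refl_generates assms(1,2) _ assms(4)]) (use assms(3) in blast)

text \<open>The generators are closed under the involution, so no closure under it is required.\<close>

lemma refl_induct [consumes 1, case_names gen one add mult smult]:
  assumes "x \<in> carrier H"
    "\<And>i j g. i \<in> {1..N} \<Longrightarrow> j \<in> {1..N} \<Longrightarrow> g \<in> carrier G \<Longrightarrow> P (a i j g)" "P \<one>\<^bsub>H\<^esub>"
    "\<And>x y. x \<in> carrier H \<Longrightarrow> y \<in> carrier H \<Longrightarrow> P x \<Longrightarrow> P y \<Longrightarrow> P (x \<oplus>\<^bsub>H\<^esub> y)"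
    "\<And>x y. x \<in> carrier H \<Longrightarrow> y \<in> carrier H \<Longrightarrow> P x \<Longrightarrow> P y \<Longrightarrow> P (x \<otimes>\<^bsub>H\<^esub> y)"
    "\<And>c x. x \<in> carrier H \<Longrightarrow> P x \<Longrightarrow> P (c \<odot>\<^bsub>H\<^esub> x)"
  shows "P x"
proof -
  \<comment> \<open>Carrying the claim for \<open>x\<close> and for its adjoint together makes the
    step for the involution an exchange of the two conjuncts.\<close>
  have "P x \<and> P (star H x)"
    using refl_generates assms(1)
  proof (induction rule: star_generates_induct)
    case (gen x)
    then show ?case using assms(2) by (auto simp: a.star_b simp del: atLeastAtMost_iff)
  qed (auto simp: assms(3-) H.star_add H.star_mult H.star_smult)
  then show ?thesis by simp
qed

definition \<epsilon> where
  "\<epsilon> = (SOME f. f \<in> star_hom H complex_alg \<and>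
    (\<forall>i\<in>{1..N}. \<forall>j\<in>{1..N}. \<forall>g\<in>carrier G. f (a i j g) = (if i = j then 1 else 0)))"

lemma \<epsilon>_hom: "\<epsilon> \<in> star_hom H complex_alg"
  and \<epsilon>_gen: "i \<in> {1..N} \<Longrightarrow> j \<in> {1..N} \<Longrightarrow> g \<in> carrier G \<Longrightarrow> \<epsilon> (a i j g) = (if i = j then 1 else 0)"
proof -
  have "\<exists>f. f \<in> star_hom H complex_alg \<and>
    (\<forall>i\<in>{1..N}. \<forall>j\<in>{1..N}. \<forall>g\<in>carrier G. f (a i j g) = (if i = j then 1 else 0))"
    using refl_lift[OF refl_family_complex[OF G.group_axioms]] by blast
  from someI_ex[OF this] show "\<epsilon> \<in> star_hom H complex_alg"
    and "i \<in> {1..N} \<Longrightarrow> j \<in> {1..N} \<Longrightarrow> g \<in> carrier G \<Longrightarrow> \<epsilon> (a i j g) = (if i = j then 1 else 0)"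
    unfolding \<epsilon>_def[symmetric] by blast+
qed

definition S where
  "S = (SOME f. f \<in> star_hom H (op_alg H) \<and>
    (\<forall>i\<in>{1..N}. \<forall>j\<in>{1..N}. \<forall>g\<in>carrier G. f (a i j g) = a j i (inv\<^bsub>G\<^esub> g)))"

lemma S_hom: "S \<in> star_hom H (op_alg H)"
  and S_gen: "i \<in> {1..N} \<Longrightarrow> j \<in> {1..N} \<Longrightarrow> g \<in> carrier G \<Longrightarrow> S (a i j g) = a j i (inv\<^bsub>G\<^esub> g)"
proof -
  have "\<exists>f. f \<in> star_hom H (op_alg H) \<and>
    (\<forall>i\<in>{1..N}. \<forall>j\<in>{1..N}. \<forall>g\<in>carrier G. f (a i j g) = a j i (inv\<^bsub>G\<^esub> g))"
    using refl_lift[OF a.refl_family_op] by blast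
  from someI_ex[OF this] show "S \<in> star_hom H (op_alg H)"
    and "i \<in> {1..N} \<Longrightarrow> j \<in> {1..N} \<Longrightarrow> g \<in> carrier G \<Longrightarrow> S (a i j g) = a j i (inv\<^bsub>G\<^esub> g)"
    unfolding S_def[symmetric] by blast+
qed

abbreviation "\<Delta> \<equiv> refl_comult G N"

text \<open>The coproduct is a definite description, so none of its properties is available before
  this. Uniqueness on the carrier comes from the generators, and outside it from
  \<open>extensional\<close>.\<close>

lemma comult_ex1:
  "\<exists>!\<Delta>. \<Delta> \<in> star_hom H (tensor H H) \<inter> extensional (carrier H) \<and>
    (\<forall>i\<in>{1..N}. \<forall>j\<in>{1..N}. \<forall>g\<in>carrier G.
       \<Delta> (a i j g) = (\<Oplus>\<^bsub>tensor H H\<^esub>k\<in>{1..N}. pure_tensor H H (a i k g) (a k j g)))"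
proof -
  obtain h where h: "h \<in> star_hom H (tensor H H)" "\<forall>i\<in>{1..N}. \<forall>j\<in>{1..N}. \<forall>g\<in>carrier G.
      h (a i j g) = (\<Oplus>\<^bsub>tensor H H\<^esub>k\<in>{1..N}. pure_tensor H H (a i k g) (a k j g))"
    using refl_lift[OF HH.refl_family_tensor[OF refl_family_H refl_family_H]] by blast
  show ?thesis
  proof (rule ex1I[of _ "restrict h (carrier H)"])
    have "restrict h (carrier H) \<in> star_hom H (tensor H H)"
      by (rule star_hom_cong[OF star_alg_H h(1)]) simp
    then show "restrict h (carrier H) \<in> star_hom H (tensor H H) \<inter> extensional (carrier H) \<and>
      (\<forall>i\<in>{1..N}. \<forall>j\<in>{1..N}. \<forall>g\<in>carrier G. restrict h (carrier H) (a i j g) =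
         (\<Oplus>\<^bsub>tensor H H\<^esub>k\<in>{1..N}. pure_tensor H H (a i k g) (a k j g)))"
      using h(2) a.closed by simp
  next
    fix f
    assume f: "f \<in> star_hom H (tensor H H) \<inter> extensional (carrier H) \<and>
      (\<forall>i\<in>{1..N}. \<forall>j\<in>{1..N}. \<forall>g\<in>carrier G.
         f (a i j g) = (\<Oplus>\<^bsub>tensor H H\<^esub>k\<in>{1..N}. pure_tensor H H (a i k g) (a k j g)))"
    have "f x = h x" if "x \<in> carrier H" for x
      using f h that by (intro refl_hom_eqI[of f "tensor H H" h x]) auto
    then show "f = restrict h (carrier H)"
      using f by (intro extensionalityI[of f "carrier H"]) auto
  qed
qed

lemma \<Delta>_hom: "\<Delta> \<in> star_hom H (tensor H H)"
  and \<Delta>_gen: "i \<in> {1..N} \<Longrightarrow> j \<in> {1..N} \<Longrightarrow> g \<in> carrier G \<Longrightarrow>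
    \<Delta> (a i j g) = (\<Oplus>\<^bsub>tensor H H\<^esub>k\<in>{1..N}. pure_tensor H H (a i k g) (a k j g))"
  using theI'[OF comult_ex1] unfolding refl_comult_def Let_def by blast+

lemma pure_a_closed: "i \<in> {1..N} \<Longrightarrow> j \<in> {1..N} \<Longrightarrow> k \<in> {1..N} \<Longrightarrow> g \<in> carrier G \<Longrightarrow>
    pure_tensor H H (a i k g) (a k j g) \<in> carrier (tensor H H)"
  by (intro HH.pure_closed a.closed)

lemma lift_\<Delta>_gen:
  assumes "bilinear_into H H H \<beta>" "i \<in> {1..N}" "j \<in> {1..N}" "g \<in> carrier G"
  shows "tensor_lift H \<beta> (\<Delta> (a i j g)) = (\<Oplus>\<^bsub>H\<^esub>k\<in>{1..N}. \<beta> (a i k g) (a k j g))"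
proof -
  have "tensor_lift H \<beta> (\<Delta> (a i j g)) =
      (\<Oplus>\<^bsub>H\<^esub>k\<in>{1..N}. tensor_lift H \<beta> (pure_tensor H H (a i k g) (a k j g)))"
    unfolding \<Delta>_gen[OF assms(2-4)]
    using assms pure_a_closed by (intro HH.tensor_lift_finsum[OF star_alg_H assms(1)]) auto
  also have "\<dots> = (\<Oplus>\<^bsub>H\<^esub>k\<in>{1..N}. \<beta> (a i k g) (a k j g))"
    using assms a.closed
    by (intro H.sum_cong HH.tensor_lift_pure[OF star_alg_H assms(1)])
      (auto simp: bilinear_into_def simp del: atLeastAtMost_iff)
  finally show ?thesis .
qed

section \<open>Counit and antipode identities\<close>

lemma bilinear_\<epsilon>: "bilinear_into H H H (\<lambda>x y. \<epsilon> x \<odot>\<^bsub>H\<^esub> y)" "bilinear_into H H H (\<lambda>x y. \<epsilon> y \<odot>\<^bsub>H\<^esub> x)"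
  by (auto simp: bilinear_into_def star_homD[OF \<epsilon>_hom] H.smult_smult H.smult_l_distr H.smult_r_distr
      mult.commute)

lemma bilinear_S: "bilinear_into H H H (\<lambda>x y. S x \<otimes>\<^bsub>H\<^esub> y)" "bilinear_into H H H (\<lambda>x y. x \<otimes>\<^bsub>H\<^esub> S y)"
  using star_homD[OF S_hom]
  by (auto simp: bilinear_into_def H.l_distr H.r_distr H.smult_mult_l H.smult_mult_r)

text \<open>Both sides are linear and multiplicative in \<open>x\<close>, so generators suffice;
  there \<open>\<epsilon>\<close> is the identity matrix and collapses the sum over
  \<open>k\<close>.\<close>

lemma counit_l: "x \<in> carrier H \<Longrightarrow> tensor_lift H (\<lambda>a b. \<epsilon> a \<odot>\<^bsub>H\<^esub> b) (\<Delta> x) = x"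
proof (induction rule: refl_induct)
  case (gen i j g)
  have "(\<Oplus>\<^bsub>H\<^esub>k\<in>{1..N}. \<epsilon> (a i k g) \<odot>\<^bsub>H\<^esub> a k j g) = (\<Oplus>\<^bsub>H\<^esub>k\<in>{1..N}. if i = k then a k j g else \<zero>\<^bsub>H\<^esub>)"
    using gen by (intro H.sum_cong) (auto simp: \<epsilon>_gen a.closed)
  also have "\<dots> = a i j g" using gen by (intro H.sum_delta) (auto simp: a.closed)
  finally show ?case using gen by (simp add: lift_\<Delta>_gen[OF bilinear_\<epsilon>(1)])
next
  case one show ?case
    by (simp add: star_homD(4)[OF \<Delta>_hom] HH.pure_one HH.tensor_lift_pure[OF star_alg_H bilinear_\<epsilon>(1)]
        star_homD(4)[OF \<epsilon>_hom])
next
  case (mult x y) then show ?case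
    by (simp add: star_homD[OF \<Delta>_hom] star_homD[OF \<epsilon>_hom] HH.tensor_lift_mult[OF star_alg_H bilinear_\<epsilon>(1)]
        H.smult_mult_l H.smult_mult_r H.smult_smult mult.commute)
qed (simp_all add: star_homD[OF \<Delta>_hom] HH.tensor_lift_add[OF star_alg_H bilinear_\<epsilon>(1)]
    HH.tensor_lift_smult[OF star_alg_H bilinear_\<epsilon>(1)])

lemma counit_r: "x \<in> carrier H \<Longrightarrow> tensor_lift H (\<lambda>a b. \<epsilon> b \<odot>\<^bsub>H\<^esub> a) (\<Delta> x) = x"
proof (induction rule: refl_induct)
  case (gen i j g)
  have "(\<Oplus>\<^bsub>H\<^esub>k\<in>{1..N}. \<epsilon> (a k j g) \<odot>\<^bsub>H\<^esub> a i k g) = (\<Oplus>\<^bsub>H\<^esub>k\<in>{1..N}. if k = j then a i k g else \<zero>\<^bsub>H\<^esub>)"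
    using gen by (intro H.sum_cong) (auto simp: \<epsilon>_gen a.closed)
  also have "\<dots> = a i j g" using gen by (intro H.sum_delta') (auto simp: a.closed)
  finally show ?case using gen by (simp add: lift_\<Delta>_gen[OF bilinear_\<epsilon>(2)])
next
  case one show ?case
    by (simp add: star_homD(4)[OF \<Delta>_hom] HH.pure_one HH.tensor_lift_pure[OF star_alg_H bilinear_\<epsilon>(2)]
        star_homD(4)[OF \<epsilon>_hom])
next
  case (mult x y) then show ?case
    by (simp add: star_homD[OF \<Delta>_hom] star_homD[OF \<epsilon>_hom] HH.tensor_lift_mult[OF star_alg_H bilinear_\<epsilon>(2)]
        H.smult_mult_l H.smult_mult_r H.smult_smult mult.commute)
qed (simp_all add: star_homD[OF \<Delta>_hom] HH.tensor_lift_add[OF star_alg_H bilinear_\<epsilon>(2)]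
    HH.tensor_lift_smult[OF star_alg_H bilinear_\<epsilon>(2)])

lemma is_counit_\<epsilon>: "is_counit H \<Delta> \<epsilon>"
  unfolding is_counit_def using star_homD[OF \<epsilon>_hom] by (simp add: counit_l counit_r)

lemma S_closed: "x \<in> carrier H \<Longrightarrow> S x \<in> carrier H"
  and S_add: "x \<in> carrier H \<Longrightarrow> y \<in> carrier H \<Longrightarrow> S (x \<oplus>\<^bsub>H\<^esub> y) = S x \<oplus>\<^bsub>H\<^esub> S y"
  and S_mult: "x \<in> carrier H \<Longrightarrow> y \<in> carrier H \<Longrightarrow> S (x \<otimes>\<^bsub>H\<^esub> y) = S y \<otimes>\<^bsub>H\<^esub> S x"
  and S_one: "S \<one>\<^bsub>H\<^esub> = \<one>\<^bsub>H\<^esub>"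
  and S_smult: "x \<in> carrier H \<Longrightarrow> S (c \<odot>\<^bsub>H\<^esub> x) = c \<odot>\<^bsub>H\<^esub> S x"
  using star_homD[OF S_hom] by simp_all

text \<open>The induced map is not multiplicative. But \<open>S\<close> reverses products, so
  multiplying \<open>x\<close> on the right by the pure tensor of \<open>p\<close> and
  \<open>q\<close> wraps the value at \<open>x\<close> between \<open>S p\<close> and
  \<open>q\<close>, and a scalar in the middle can be pulled out. With \<open>x\<close> and
  \<open>y\<close> the coproducts of two factors, this carries the antipode identity over to their
  product.\<close>

lemma antipode_l_mult:
  assumes "x \<in> carrier (tensor H H)" "y \<in> carrier (tensor H H)"
    "tensor_lift H (\<lambda>a b. S a \<otimes>\<^bsub>H\<^esub> b) x = c \<odot>\<^bsub>H\<^esub> \<one>\<^bsub>H\<^esub>"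
  shows "tensor_lift H (\<lambda>a b. S a \<otimes>\<^bsub>H\<^esub> b) (x \<otimes>\<^bsub>tensor H H\<^esub> y) =
    c \<odot>\<^bsub>H\<^esub> tensor_lift H (\<lambda>a b. S a \<otimes>\<^bsub>H\<^esub> b) y"
  using assms(2)
proof (induction rule: HH.tensor_induct)
  note lift = HH.tensor_lift_pure[OF star_alg_H bilinear_S(1)] HH.tensor_lift_add[OF star_alg_H bilinear_S(1)]
    HH.tensor_lift_closed[OF star_alg_H bilinear_S(1)]
  case (pure p q)
  have "tensor_lift H (\<lambda>a b. S a \<otimes>\<^bsub>H\<^esub> b) (x \<otimes>\<^bsub>tensor H H\<^esub> pure_tensor H H p q) =
      S p \<otimes>\<^bsub>H\<^esub> tensor_lift H (\<lambda>a b. S a \<otimes>\<^bsub>H\<^esub> b) x \<otimes>\<^bsub>H\<^esub> q"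
    using assms(1)
    by (induction rule: HH.tensor_induct)
      (use pure in \<open>simp_all add: HH.pure_mult HH.pure_closed lift S_mult S_closed H.m_assoc
        HH.T.l_distr H.l_distr H.r_distr\<close>)
  then show ?case
    using pure by (simp add: assms(3) lift S_closed H.smult_mult_l H.smult_mult_r)
next
  case (add y z)
  then show ?case
    using assms(1) by (simp add: HH.T.r_distr HH.tensor_lift_add[OF star_alg_H bilinear_S(1)]
        HH.tensor_lift_closed[OF star_alg_H bilinear_S(1)] H.smult_r_distr)
qed

text \<open>Mirror image: the value at \<open>y\<close> now sits in the middle, between
  \<open>p\<close> and \<open>S q\<close>, so the scalar hypothesis concerns the second
  factor.\<close>

lemma antipode_r_mult:
  assumes "x \<in> carrier (tensor H H)" "y \<in> carrier (tensor H H)"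
    "tensor_lift H (\<lambda>a b. a \<otimes>\<^bsub>H\<^esub> S b) y = c \<odot>\<^bsub>H\<^esub> \<one>\<^bsub>H\<^esub>"
  shows "tensor_lift H (\<lambda>a b. a \<otimes>\<^bsub>H\<^esub> S b) (x \<otimes>\<^bsub>tensor H H\<^esub> y) =
    c \<odot>\<^bsub>H\<^esub> tensor_lift H (\<lambda>a b. a \<otimes>\<^bsub>H\<^esub> S b) x"
  using assms(1)
proof (induction rule: HH.tensor_induct)
  note lift = HH.tensor_lift_pure[OF star_alg_H bilinear_S(2)] HH.tensor_lift_add[OF star_alg_H bilinear_S(2)]
    HH.tensor_lift_closed[OF star_alg_H bilinear_S(2)]
  case (pure p q)
  have "tensor_lift H (\<lambda>a b. a \<otimes>\<^bsub>H\<^esub> S b) (pure_tensor H H p q \<otimes>\<^bsub>tensor H H\<^esub> y) =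
      p \<otimes>\<^bsub>H\<^esub> tensor_lift H (\<lambda>a b. a \<otimes>\<^bsub>H\<^esub> S b) y \<otimes>\<^bsub>H\<^esub> S q"
    using assms(2)
    by (induction rule: HH.tensor_induct)
      (use pure in \<open>simp_all add: HH.pure_mult HH.pure_closed lift S_mult S_closed H.m_assoc
        HH.T.r_distr H.l_distr H.r_distr\<close>)
  then show ?case
    using pure by (simp add: assms(3) lift S_closed H.smult_mult_l H.smult_mult_r)
next
  case (add x z)
  then show ?case
    using assms(2) by (simp add: HH.T.l_distr HH.tensor_lift_add[OF star_alg_H bilinear_S(2)]
        HH.tensor_lift_closed[OF star_alg_H bilinear_S(2)] H.smult_r_distr)
qed

text \<open>On a generator \<open>S\<close> produces products of two entries of row
  \<open>k\<close>, in columns \<open>i\<close> and \<open>j\<close>, at inverse group elements.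
  They vanish for \<open>i \<noteq> j\<close>; for \<open>i = j\<close> they are the projections of
  column \<open>j\<close>, which sum to the unit. In the other antipode identity rows and columns
  are exchanged.\<close>

lemma antipode_l: "x \<in> carrier H \<Longrightarrow> tensor_lift H (\<lambda>a b. S a \<otimes>\<^bsub>H\<^esub> b) (\<Delta> x) = \<epsilon> x \<odot>\<^bsub>H\<^esub> \<one>\<^bsub>H\<^esub>"
proof (induction rule: refl_induct)
  case (gen i j g)
  have "(\<Oplus>\<^bsub>H\<^esub>k\<in>{1..N}. S (a i k g) \<otimes>\<^bsub>H\<^esub> a k j g) =
      (\<Oplus>\<^bsub>H\<^esub>k\<in>{1..N}. if i = j then a k j \<one>\<^bsub>G\<^esub> else \<zero>\<^bsub>H\<^esub>)"
    using gen by (intro H.sum_cong) (auto simp: S_gen a.closed a.row)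
  also have "\<dots> = \<epsilon> (a i j g) \<odot>\<^bsub>H\<^esub> \<one>\<^bsub>H\<^esub>" using gen by (simp add: \<epsilon>_gen a.col_sum_one)
  finally show ?case using gen by (simp add: lift_\<Delta>_gen[OF bilinear_S(1)])
next
  case one show ?case
    by (simp add: star_homD(4)[OF \<Delta>_hom] HH.pure_one HH.tensor_lift_pure[OF star_alg_H bilinear_S(1)]
        star_homD(4)[OF \<epsilon>_hom] S_one)
next
  case (mult x y) then show ?case
    by (simp add: star_homD[OF \<Delta>_hom] star_homD[OF \<epsilon>_hom] antipode_l_mult H.smult_smult)
qed (simp_all add: star_homD[OF \<Delta>_hom] HH.tensor_lift_add[OF star_alg_H bilinear_S(1)]
    HH.tensor_lift_smult[OF star_alg_H bilinear_S(1)] star_homD[OF \<epsilon>_hom] H.smult_l_distr H.smult_smult)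

lemma antipode_r: "x \<in> carrier H \<Longrightarrow> tensor_lift H (\<lambda>a b. a \<otimes>\<^bsub>H\<^esub> S b) (\<Delta> x) = \<epsilon> x \<odot>\<^bsub>H\<^esub> \<one>\<^bsub>H\<^esub>"
proof (induction rule: refl_induct)
  case (gen i j g)
  have "(\<Oplus>\<^bsub>H\<^esub>k\<in>{1..N}. a i k g \<otimes>\<^bsub>H\<^esub> S (a k j g)) =
      (\<Oplus>\<^bsub>H\<^esub>k\<in>{1..N}. if i = j then a i k \<one>\<^bsub>G\<^esub> else \<zero>\<^bsub>H\<^esub>)"
    using gen by (intro H.sum_cong) (auto simp: S_gen a.closed a.col)
  also have "\<dots> = \<epsilon> (a i j g) \<odot>\<^bsub>H\<^esub> \<one>\<^bsub>H\<^esub>" using gen by (simp add: \<epsilon>_gen a.row_sum_one)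
  finally show ?case using gen by (simp add: lift_\<Delta>_gen[OF bilinear_S(2)])
next
  case one show ?case
    by (simp add: star_homD(4)[OF \<Delta>_hom] HH.pure_one HH.tensor_lift_pure[OF star_alg_H bilinear_S(2)]
        star_homD(4)[OF \<epsilon>_hom] S_one)
next
  case (mult x y) then show ?case
    by (simp add: star_homD[OF \<Delta>_hom] star_homD[OF \<epsilon>_hom] antipode_r_mult H.smult_smult mult.commute)
qed (simp_all add: star_homD[OF \<Delta>_hom] HH.tensor_lift_add[OF star_alg_H bilinear_S(2)]
    HH.tensor_lift_smult[OF star_alg_H bilinear_S(2)] star_homD[OF \<epsilon>_hom] H.smult_l_distr H.smult_smult)

lemma is_antipode_S: "is_antipode H \<Delta> \<epsilon> S"
  unfolding is_antipode_def
  by (auto simp: antipode_l antipode_r S_closed S_add S_smult)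

end

section \<open>The Hopf *-ideal of the subgroup\<close>

context star_alg_pair
begin

lemma pure_zero_r: "x \<in> carrier A \<Longrightarrow> pure_tensor A B x \<zero>\<^bsub>B\<^esub> = \<zero>\<^bsub>tensor A B\<^esub>"
  using pure_smult_r[of x "\<zero>\<^bsub>B\<^esub>" 0] by (simp add: pure_closed)

lemma pure_zero_l: "y \<in> carrier B \<Longrightarrow> pure_tensor A B \<zero>\<^bsub>A\<^esub> y = \<zero>\<^bsub>tensor A B\<^esub>"
  using pure_smult_l[of "\<zero>\<^bsub>A\<^esub>" y 0] by (simp add: pure_closed)

lemma pure_sum_r:
  assumes "x \<in> carrier A" "f \<in> K \<rightarrow> carrier B"
  shows "pure_tensor A B x (\<Oplus>\<^bsub>B\<^esub>k\<in>K. f k) = (\<Oplus>\<^bsub>tensor A B\<^esub>k\<in>K. pure_tensor A B x (f k))"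
  by (rule additive_finsum[OF B.abelian_monoid_axioms T.abelian_monoid_axioms])
    (use assms in \<open>auto simp: pure_zero_r pure_add_r pure_closed\<close>)

lemma pure_sum_l:
  assumes "y \<in> carrier B" "f \<in> K \<rightarrow> carrier A"
  shows "pure_tensor A B (\<Oplus>\<^bsub>A\<^esub>k\<in>K. f k) y = (\<Oplus>\<^bsub>tensor A B\<^esub>k\<in>K. pure_tensor A B (f k) y)"
  by (rule additive_finsum[OF A.abelian_monoid_axioms T.abelian_monoid_axioms])
    (use assms in \<open>auto simp: pure_zero_l pure_add_l pure_closed\<close>)

lemma pure_diff_r:
  assumes "x \<in> carrier A" "y \<in> carrier B" "z \<in> carrier B"
  shows "pure_tensor A B x (y \<ominus>\<^bsub>B\<^esub> z) = pure_tensor A B x y \<ominus>\<^bsub>tensor A B\<^esub> pure_tensor A B x z"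
  using assms by (simp add: B.diff_eq_smult T.diff_eq_smult pure_add_r pure_smult_r pure_closed)

lemma pure_diff_l:
  assumes "x \<in> carrier B" "y \<in> carrier A" "z \<in> carrier A"
  shows "pure_tensor A B (y \<ominus>\<^bsub>A\<^esub> z) x = pure_tensor A B y x \<ominus>\<^bsub>tensor A B\<^esub> pure_tensor A B z x"
  using assms by (simp add: A.diff_eq_smult T.diff_eq_smult pure_add_l pure_smult_l pure_closed)

text \<open>Summing the coproduct formula along a row collects the second leg into a row sum:
  \<open>u\<^sub>i(g)\<close> goes to the sum over \<open>k\<close> of
  \<open>a\<^sub>i\<^sub>k(g) \<otimes> u\<^sub>k(g)\<close>.\<close>

lemma row_sum_tensor:
  assumes "refl_family G N A b" "refl_family G N B c" "i \<in> {1..N}" "g \<in> carrier G"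
  shows "(\<Oplus>\<^bsub>tensor A B\<^esub>j\<in>{1..N}. \<Oplus>\<^bsub>tensor A B\<^esub>k\<in>{1..N}. pure_tensor A B (b i k g) (c k j g)) =
    (\<Oplus>\<^bsub>tensor A B\<^esub>k\<in>{1..N}. pure_tensor A B (b i k g) (\<Oplus>\<^bsub>B\<^esub>j\<in>{1..N}. c k j g))"
proof -
  interpret b: refl_family G N A b by fact
  interpret c: refl_family G N B c by fact
  have "(\<Oplus>\<^bsub>tensor A B\<^esub>j\<in>{1..N}. \<Oplus>\<^bsub>tensor A B\<^esub>k\<in>{1..N}. pure_tensor A B (b i k g) (c k j g)) =
    (\<Oplus>\<^bsub>tensor A B\<^esub>k\<in>{1..N}. \<Oplus>\<^bsub>tensor A B\<^esub>j\<in>{1..N}. pure_tensor A B (b i k g) (c k j g))"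
    using assms(3,4) by (intro T.sum_swap pure_closed b.closed c.closed) auto
  also have "\<dots> = (\<Oplus>\<^bsub>tensor A B\<^esub>k\<in>{1..N}. pure_tensor A B (b i k g) (\<Oplus>\<^bsub>B\<^esub>j\<in>{1..N}. c k j g))"
    using assms(3,4)
    by (intro T.sum_cong pure_sum_r[symmetric] pure_closed b.closed c.closed B.sum_closed)
      (auto simp: c.closed)
  finally show ?thesis .
qed

lemma tensor_span: "carrier (tensor A B) \<subseteq>
    lin_span (tensor A B) {pure_tensor A B x y |x y. x \<in> carrier A \<and> y \<in> carrier B}"
    (is "_ \<subseteq> lin_span _ ?P")
proof
  have P: "?P \<subseteq> carrier (tensor A B)" by (auto simp: pure_closed)
  fix t assume "t \<in> carrier (tensor A B)"
  then show "t \<in> lin_span (tensor A B) ?P"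
  proof (induction rule: tensor_induct)
    case (pure x y) then show ?case using subsetD[OF T.lin_span_superset[OF P]] by blast
  qed (rule T.lin_span_add)
qed

text \<open>\<open>I \<otimes> B + A \<otimes> J\<close>, the kernel of \<open>A \<otimes> B \<rightarrow> A/I \<otimes> B/J\<close>\<close>

lemma star_ideal_tensor_sum:
  assumes "star_ideal I A" "star_ideal J B"
  shows "star_ideal (lin_span (tensor A B)
    ({pure_tensor A B x y | x y. x \<in> I \<and> y \<in> carrier B} \<union>
     {pure_tensor A B x y | x y. x \<in> carrier A \<and> y \<in> J})) (tensor A B)"
    (is "star_ideal (lin_span _ ?S) _")
proof -
  interpret I: star_quot A I by unfold_locales fact
  interpret J: star_quot B J by unfold_locales fact
  have stars: "star A x \<in> I" "star B y \<in> J" if "x \<in> I" "y \<in> J" for x y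
    using assms that by (auto simp: star_ideal_def)
  have S: "?S \<subseteq> carrier (tensor A B)"
    by (auto simp: pure_closed I.Icarr J.Icarr)
  have mem: "pure_tensor A B x y \<in> lin_span (tensor A B) ?S"
    if "x \<in> I \<and> y \<in> carrier B \<or> x \<in> carrier A \<and> y \<in> J" for x y
    using that by (intro subsetD[OF T.lin_span_superset[OF S]]) blast
  show ?thesis
  proof (rule T.star_ideal_lin_span[OF S _ tensor_span])
    fix s assume "s \<in> ?S"
    then obtain x y where s: "s = pure_tensor A B x y"
      "x \<in> I \<and> y \<in> carrier B \<or> x \<in> carrier A \<and> y \<in> J" by blast
    have xy: "x \<in> carrier A" "y \<in> carrier B" using s(2) I.Icarr J.Icarr by auto
    show "star (tensor A B) s \<in> lin_span (tensor A B) ?S"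
      using s stars xy assms by (auto simp: pure_star star_ideal_def intro!: mem)
    fix t assume "t \<in> {pure_tensor A B x y |x y. x \<in> carrier A \<and> y \<in> carrier B}"
    then obtain x' y' where t: "t = pure_tensor A B x' y'" "x' \<in> carrier A" "y' \<in> carrier B" by blast
    show "t \<otimes>\<^bsub>tensor A B\<^esub> s \<in> lin_span (tensor A B) ?S"
      using s t xy by (auto simp: pure_mult I.I_l_closed J.I_l_closed intro!: mem)
    show "s \<otimes>\<^bsub>tensor A B\<^esub> t \<in> lin_span (tensor A B) ?S"
      using s t xy by (auto simp: pure_mult I.I_r_closed J.I_r_closed intro!: mem)
  qed (auto simp: pure_closed)
qed

end

section \<open>The quotient by the relations of the subgroup\<close>

locale reflection_sub = reflection G N + L: subgroup L G
  for G :: "('g, 'r) monoid_scheme" and N :: nat and L :: "'g set"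
begin

definition R where
  "R = {(\<Oplus>\<^bsub>H\<^esub>k\<in>{1..N}. a i k g, \<Oplus>\<^bsub>H\<^esub>k\<in>{1..N}. a j k g) | i j g.
     i \<in> {1..N} \<and> j \<in> {1..N} \<and> g \<in> L}"

lemma R_closed: "R \<subseteq> carrier H \<times> carrier H"
  by (auto simp: R_def a.closed L.mem_carrier intro!: H.sum_closed)

lemma R_I: "i \<in> {1..N} \<Longrightarrow> j \<in> {1..N} \<Longrightarrow> g \<in> L \<Longrightarrow>
    (\<Oplus>\<^bsub>H\<^esub>k\<in>{1..N}. a i k g, \<Oplus>\<^bsub>H\<^esub>k\<in>{1..N}. a j k g) \<in> R"
  unfolding R_def by blast

text \<open>Only the *-ideal generated by the relations. It is contained in every Hopf *-ideal that
  contains them, and its quotient has an immediate universal property.\<close>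

definition I where "I = star_ideal_gen H (differences H R)"

sublocale I: star_quot H I
  unfolding I_def by (rule H.star_quot_impose[OF R_closed])

abbreviation "K \<equiv> star_quotient H I"

definition \<alpha> where "\<alpha> i j g = I +>\<^bsub>H\<^esub> a i j g"

lemma star_alg_K: "star_alg K" by (rule I.star_alg_star_quotient)

sublocale K: star_alg K by (rule star_alg_K)

lemma refl_family_\<alpha>: "refl_family G N K \<alpha>"
  using refl_family_image[OF refl_family_H star_alg_K I.rcos_star_hom] by (simp add: \<alpha>_def[abs_def])

sublocale \<alpha>: refl_family G N K \<alpha> by (rule refl_family_\<alpha>)

lemma row_sum_\<alpha>_eq:
  assumes "i \<in> {1..N}" "j \<in> {1..N}" "g \<in> L"
  shows "(\<Oplus>\<^bsub>K\<^esub>k\<in>{1..N}. \<alpha> i k g) = (\<Oplus>\<^bsub>K\<^esub>k\<in>{1..N}. \<alpha> j k g)"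
  using H.impose_proj_eq[OF R_closed R_I[OF assms]] assms L.mem_carrier
  by (simp add: impose_proj_def I_def[symmetric] \<alpha>_def a.closed Pi_iff
      star_hom_finsum[OF star_alg_H star_alg_K I.rcos_star_hom])

lemma K_hom_eqI:
  assumes "f \<in> star_hom K B" "f' \<in> star_hom K B"
    "\<And>i j g. i \<in> {1..N} \<Longrightarrow> j \<in> {1..N} \<Longrightarrow> g \<in> carrier G \<Longrightarrow> f (\<alpha> i j g) = f' (\<alpha> i j g)"
    "x \<in> carrier K"
  shows "f x = f' x"
proof -
  obtain y where y: "y \<in> carrier H" "x = I +>\<^bsub>H\<^esub> y" using assms(4) I.carrier_star_quotient by auto
  show ?thesis unfolding y(2)
    by (rule refl_hom_eqI[OF star_hom_comp[OF I.rcos_star_hom assms(1)]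
          star_hom_comp[OF I.rcos_star_hom assms(2)]])
      (use assms(3) y in \<open>auto simp: \<alpha>_def\<close>)
qed

text \<open>Each Hopf condition on \<open>I\<close> says that \<open>I\<close> lies in the kernel of
  a suitable *-homomorphism, so it can be decided by comparing images of row sums over
  \<open>L\<close>.\<close>

lemma vanish_I:
  assumes "star_alg B" "f \<in> star_hom H B"
    "\<And>i j g. i \<in> {1..N} \<Longrightarrow> j \<in> {1..N} \<Longrightarrow> g \<in> L \<Longrightarrow>
      (\<Oplus>\<^bsub>B\<^esub>k\<in>{1..N}. f (a i k g)) = (\<Oplus>\<^bsub>B\<^esub>k\<in>{1..N}. f (a j k g))"
    "x \<in> I"
  shows "f x = \<zero>\<^bsub>B\<^esub>"
proof (rule star_hom_vanish_gen[OF star_alg_H assms(1,2) R_closed])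
  fix l r assume "(l, r) \<in> R"
  then obtain i j g where ij: "i \<in> {1..N}" "j \<in> {1..N}" "g \<in> L"
    and lr: "l = (\<Oplus>\<^bsub>H\<^esub>k\<in>{1..N}. a i k g)" "r = (\<Oplus>\<^bsub>H\<^esub>k\<in>{1..N}. a j k g)"
    unfolding R_def by blast
  show "f l = f r"
    unfolding lr using assms(3)[OF ij] ij
    by (simp add: star_hom_finsum[OF star_alg_H assms(1,2)] a.closed Pi_iff L.mem_carrier)
qed (use assms(4) I_def in simp)

lemma K_lift:
  assumes "refl_family G N B b"
    "\<And>i j g. i \<in> {1..N} \<Longrightarrow> j \<in> {1..N} \<Longrightarrow> g \<in> L \<Longrightarrow>
      (\<Oplus>\<^bsub>B\<^esub>k\<in>{1..N}. b i k g) = (\<Oplus>\<^bsub>B\<^esub>k\<in>{1..N}. b j k g)"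
  shows "\<exists>h\<in>star_hom K B. \<forall>i\<in>{1..N}. \<forall>j\<in>{1..N}. \<forall>g\<in>carrier G. h (\<alpha> i j g) = b i j g"
proof -
  interpret b: refl_family G N B b by fact
  obtain f where f: "f \<in> star_hom H B" "\<forall>i\<in>{1..N}. \<forall>j\<in>{1..N}. \<forall>g\<in>carrier G. f (a i j g) = b i j g"
    using refl_lift[OF assms(1)] by blast
  have "f x = \<zero>\<^bsub>B\<^esub>" if "x \<in> I" for x
  proof (rule vanish_I[OF b.B.star_alg_axioms f(1) _ that])
    fix i j g assume ij: "i \<in> {1..N}" "j \<in> {1..N}" "g \<in> L"
    then show "(\<Oplus>\<^bsub>B\<^esub>k\<in>{1..N}. f (a i k g)) = (\<Oplus>\<^bsub>B\<^esub>k\<in>{1..N}. f (a j k g))"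
      using assms(2)[OF ij] f(2) L.mem_carrier b.closed by (simp cong: b.B.finsum_cong)
  qed
  then obtain h where "h \<in> star_hom K B" "\<forall>x\<in>carrier H. h (I +>\<^bsub>H\<^esub> x) = f x"
    using I.star_quotient_lift[OF b.B.star_alg_axioms f(1)] by blast
  then show ?thesis using f(2) a.closed by (intro bexI[of _ h]) (auto simp: \<alpha>_def)
qed

text \<open>The span on the right is a *-ideal of the tensor square, so the inclusion says that the
  coproduct followed by the projection onto the quotient vanishes on \<open>I\<close>. In that
  quotient either leg of a pure tensor may be altered by an element of \<open>I\<close>.\<close>

lemma \<Delta>_I: "\<Delta> ` I \<subseteq> lin_span (tensor H H)
    ({pure_tensor H H x y | x y. x \<in> I \<and> y \<in> carrier H} \<union>
     {pure_tensor H H x y | x y. x \<in> carrier H \<and> y \<in> I})"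
    (is "_ \<subseteq> lin_span _ ?S")
proof
  let ?J = "lin_span (tensor H H) ?S"
  interpret J: star_quot "tensor H H" ?J
    by (intro star_quot.intro star_quot_axioms.intro HH.star_alg_tensor HH.star_ideal_tensor_sum
        I.star_ideal)
  let ?q = "(+>\<^bsub>tensor H H\<^esub>) ?J" and ?Q = "star_quotient (tensor H H) ?J"
  have S: "?S \<subseteq> carrier (tensor H H)" by (auto simp: HH.pure_closed I.Icarr)
  have q_r: "?q (pure_tensor H H x y) = ?q (pure_tensor H H x z)"
    if "x \<in> carrier H" "y \<in> carrier H" "z \<in> carrier H" "y \<ominus>\<^bsub>H\<^esub> z \<in> I" for x y z
  proof -
    have "pure_tensor H H x (y \<ominus>\<^bsub>H\<^esub> z) \<in> ?J"
      using that by (intro subsetD[OF HH.T.lin_span_superset[OF S]]) blast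
    then show ?thesis using that by (simp add: J.rcos_eq_iff HH.pure_closed HH.pure_diff_r)
  qed
  have q_l: "?q (pure_tensor H H y x) = ?q (pure_tensor H H z x)"
    if "x \<in> carrier H" "y \<in> carrier H" "z \<in> carrier H" "y \<ominus>\<^bsub>H\<^esub> z \<in> I" for x y z
  proof -
    have "pure_tensor H H (y \<ominus>\<^bsub>H\<^esub> z) x \<in> ?J"
      using that by (intro subsetD[OF HH.T.lin_span_superset[OF S]]) blast
    then show ?thesis using that by (simp add: J.rcos_eq_iff HH.pure_closed HH.pure_diff_l)
  qed
  have diff: "a.row_sum i g \<ominus>\<^bsub>H\<^esub> a.row_sum j g \<in> I"
    if "i \<in> {1..N}" "j \<in> {1..N}" "g \<in> L" for i j g
    using R_I[OF that] star_ideal_gen_superset[of "differences H R" H]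
    by (auto simp: I_def a.row_sum_def differences_def)
  note u = a.row_sum_closed[OF _ L.mem_carrier]
  have hom: "(\<lambda>x. ?q (\<Delta> x)) \<in> star_hom H ?Q"
    by (rule star_hom_comp[OF \<Delta>_hom J.rcos_star_hom])
  \<comment> \<open>The right-hand side does not mention \<open>i\<close>, which is what the
    vanishing criterion asks for.\<close>
  have key: "(\<Oplus>\<^bsub>?Q\<^esub>j\<in>{1..N}. ?q (\<Delta> (a i j g))) = ?q (pure_tensor H H (a.row_sum 1 g) (a.row_sum 1 g))"
    if i: "i \<in> {1..N}" and g: "g \<in> L" for i g
  proof -
    \<comment> \<open>Row \<open>1\<close> serves as a reference; it is in the range because
      \<open>i\<close> is.\<close>
    have g': "g \<in> carrier G" and one: "1 \<in> {1..N}" using g L.mem_carrier i by auto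
    note q_sum = star_hom_finsum[OF HH.star_alg_tensor J.star_alg_star_quotient J.rcos_star_hom]
    have "(\<Oplus>\<^bsub>?Q\<^esub>j\<in>{1..N}. ?q (\<Delta> (a i j g))) = ?q (\<Oplus>\<^bsub>tensor H H\<^esub>j\<in>{1..N}. \<Delta> (a i j g))"
      using i g' by (intro q_sum[symmetric] Pi_I star_homD(1)[OF \<Delta>_hom] a.closed)
    also have "(\<Oplus>\<^bsub>tensor H H\<^esub>j\<in>{1..N}. \<Delta> (a i j g)) =
        (\<Oplus>\<^bsub>tensor H H\<^esub>j\<in>{1..N}. \<Oplus>\<^bsub>tensor H H\<^esub>k\<in>{1..N}. pure_tensor H H (a i k g) (a k j g))"
      using i g' by (intro HH.T.sum_cong HH.T.sum_closed \<Delta>_gen pure_a_closed)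
    also have "\<dots> = (\<Oplus>\<^bsub>tensor H H\<^esub>k\<in>{1..N}. pure_tensor H H (a i k g) (a.row_sum k g))"
      unfolding a.row_sum_def by (rule HH.row_sum_tensor[OF refl_family_H refl_family_H i g'])
    also have "?q \<dots> = (\<Oplus>\<^bsub>?Q\<^esub>k\<in>{1..N}. ?q (pure_tensor H H (a i k g) (a.row_sum k g)))"
      using i g' by (intro q_sum Pi_I HH.pure_closed a.closed a.row_sum_closed)
    \<comment> \<open>Replacing \<open>u\<^sub>k(g)\<close> by \<open>u\<^sub>1(g)\<close> frees the
      second leg from \<open>k\<close>, so that the first leg can be summed to
      \<open>u\<^sub>i(g)\<close>.\<close>
    also have "\<dots> = (\<Oplus>\<^bsub>?Q\<^esub>k\<in>{1..N}. ?q (pure_tensor H H (a i k g) (a.row_sum 1 g)))"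
      using i g g' one
      by (intro star_alg.sum_cong[OF J.star_alg_star_quotient] q_r star_homD(1)[OF J.rcos_star_hom]
          HH.pure_closed a.closed a.row_sum_closed diff)
    also have "\<dots> = ?q (\<Oplus>\<^bsub>tensor H H\<^esub>k\<in>{1..N}. pure_tensor H H (a i k g) (a.row_sum 1 g))"
      using i g' one by (intro q_sum[symmetric] Pi_I HH.pure_closed a.closed a.row_sum_closed)
    also have "(\<Oplus>\<^bsub>tensor H H\<^esub>k\<in>{1..N}. pure_tensor H H (a i k g) (a.row_sum 1 g)) =
        pure_tensor H H (a.row_sum i g) (a.row_sum 1 g)"
      unfolding a.row_sum_def[of i] using i g' one
      by (intro HH.pure_sum_l[symmetric] Pi_I a.closed a.row_sum_closed)
    also have "?q \<dots> = ?q (pure_tensor H H (a.row_sum 1 g) (a.row_sum 1 g))"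
      using i g g' one by (intro q_l diff a.row_sum_closed)
    finally show ?thesis .
  qed
  fix y assume "y \<in> \<Delta> ` I"
  then obtain x where x: "x \<in> I" "y = \<Delta> x" by blast
  have "?q (\<Delta> x) = \<zero>\<^bsub>?Q\<^esub>"
    by (rule vanish_I[OF J.star_alg_star_quotient hom _ x(1)]) (simp add: key)
  then show "y \<in> ?J"
    using x I.Icarr by (simp add: J.rcos_eq_zero_iff star_homD(1)[OF \<Delta>_hom])
qed

text \<open>\<open>\<epsilon>\<close> sends the generators at each group element to the identity
  matrix, all of whose rows have sum \<open>1\<close>.\<close>

lemma \<epsilon>_I: "x \<in> I \<Longrightarrow> \<epsilon> x = 0"
proof -
  assume x: "x \<in> I"
  interpret C: star_alg complex_alg by (rule star_alg_complex_alg)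
  have "(\<Oplus>\<^bsub>complex_alg\<^esub>k\<in>{1..N}. \<epsilon> (a i k g)) = 1" if "i \<in> {1..N}" "g \<in> L" for i g
  proof -
    have "(\<Oplus>\<^bsub>complex_alg\<^esub>k\<in>{1..N}. \<epsilon> (a i k g)) = (\<Oplus>\<^bsub>complex_alg\<^esub>k\<in>{1..N}. if i = k then 1 else 0)"
      using that L.mem_carrier by (intro C.sum_cong) (auto simp: \<epsilon>_gen)
    also have "\<dots> = 1" using C.sum_delta[of i "{1..N}" "\<lambda>_. 1"] that by (simp cong: if_cong)
    finally show ?thesis .
  qed
  then show "\<epsilon> x = 0"
    using vanish_I[OF star_alg_complex_alg \<epsilon>_hom _ x] by simp
qed

text \<open>The column sums of \<open>\<alpha>\<close> over \<open>L\<close> agree with the row sums, so the antipode preserves \<open>I\<close>.\<close>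

lemma S_I: "S ` I \<subseteq> I"
proof
  have "(+>\<^bsub>H\<^esub>) I \<in> star_hom (op_alg H) (op_alg K)"
    using star_homD[OF I.rcos_star_hom] by (intro star_homI) simp_all
  then have hom: "(\<lambda>x. I +>\<^bsub>H\<^esub> S x) \<in> star_hom H (op_alg K)"
    by (rule star_hom_comp[OF S_hom])
  \<comment> \<open>\<open>S\<close> transposes and inverts, so the sum over row \<open>i\<close> at
    \<open>g\<close> becomes the sum over column \<open>i\<close> at the inverse of
    \<open>g\<close>, which again lies in \<open>L\<close>.\<close>
  have key: "(\<Oplus>\<^bsub>op_alg K\<^esub>k\<in>{1..N}. I +>\<^bsub>H\<^esub> S (a i k g)) = \<alpha>.row_sum 1 (inv\<^bsub>G\<^esub> g)"
    if "i \<in> {1..N}" "g \<in> L" for i g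
  proof -
    have g: "g \<in> carrier G" "inv\<^bsub>G\<^esub> g \<in> L" "inv\<^bsub>G\<^esub> g \<in> carrier G" and one: "1 \<in> {1..N}"
      using that L.mem_carrier L.m_inv_closed by auto
    have "(\<Oplus>\<^bsub>op_alg K\<^esub>k\<in>{1..N}. I +>\<^bsub>H\<^esub> S (a i k g)) = (\<Oplus>\<^bsub>K\<^esub>k\<in>{1..N}. \<alpha> k i (inv\<^bsub>G\<^esub> g))"
      using that g \<alpha>.closed by (simp add: S_gen \<alpha>_def cong: K.finsum_cong)
    also have "\<dots> = \<alpha>.row_sum 1 (inv\<^bsub>G\<^esub> g)"
      by (intro \<alpha>.col_sum_eq_row_sum \<alpha>.row_sum_closed that(1) g one)
        (unfold \<alpha>.row_sum_def, rule row_sum_\<alpha>_eq[OF _ one g(2)])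
    finally show ?thesis .
  qed
  fix y assume "y \<in> S ` I"
  then obtain x where x: "x \<in> I" "y = S x" by blast
  have "I +>\<^bsub>H\<^esub> S x = \<zero>\<^bsub>op_alg K\<^esub>"
    by (rule vanish_I[OF star_alg_op_alg[OF star_alg_K] hom _ x(1)]) (simp only: key)
  then show "y \<in> I" using x I.Icarr by (simp add: I.rcos_eq_zero_iff S_closed)
qed

lemma hopf_star_ideal_I: "hopf_star_ideal I H \<Delta>"
  unfolding hopf_star_ideal_def
  using I.star_ideal \<Delta>_I is_counit_\<epsilon> is_antipode_S \<epsilon>_I S_I by blast

text \<open>\<open>I\<close> is one of the ideals intersected, because it is a Hopf *-ideal, and it
  lies in each of them, because they are *-ideals containing the relations.\<close>

lemma refl_sub_ideal_eq: "refl_sub_ideal G L N = I"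
proof -
  have "refl_sub_ideal G L N = \<Inter>{J. hopf_star_ideal J H \<Delta> \<and> differences H R \<subseteq> J}"
    by (simp add: refl_sub_ideal_def Let_def hopf_star_ideal_gen_def R_def)
  also have "\<dots> = I"
  proof
    show "\<Inter>{J. hopf_star_ideal J H \<Delta> \<and> differences H R \<subseteq> J} \<subseteq> I"
      using hopf_star_ideal_I star_ideal_gen_superset[of "differences H R" H] by (auto simp: I_def)
    show "I \<subseteq> \<Inter>{J. hopf_star_ideal J H \<Delta> \<and> differences H R \<subseteq> J}"
      unfolding I_def by (auto simp: hopf_star_ideal_def dest: star_ideal_gen_least)
  qed
  finally show ?thesis .
qed

lemma refl_sub_algebra_eq: "refl_sub_algebra G L N = K"
  by (simp add: refl_sub_algebra_def refl_sub_ideal_eq)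

lemma refl_sub_gen_eq: "refl_sub_gen G L N i j g = \<alpha> i j g"
  by (simp add: refl_sub_gen_def refl_sub_ideal_eq \<alpha>_def)

end

section \<open>The universal property of the free wreath product\<close>

context
  fixes A :: "'a star_algebra" and F :: "'f star_algebra" and u :: "'a \<Rightarrow> 'f"
  assumes A: "star_alg A" and F: "star_alg F" and u: "\<And>x. x \<in> carrier A \<Longrightarrow> u x \<in> carrier F"
begin

interpretation A: star_alg A by (rule A)
interpretation F: star_alg F by (rule F)

lemma hom_relations_closed: "hom_relations A F u \<subseteq> carrier F \<times> carrier F"
  by (auto simp: hom_relations_def u)

text \<open>In the applications \<open>u\<close> maps elements of \<open>A\<close> to free
  generators and is not a homomorphism itself. The composite becomes one once \<open>f\<close>
  identifies the two sides of each relation.\<close>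

lemma hom_relations_imp_star_hom:
  assumes "f \<in> star_hom F B" "\<forall>z\<in>hom_relations A F u. f (fst z) = f (snd z)"
  shows "(\<lambda>x. f (u x)) \<in> star_hom A B"
proof -
  note rels = assms(2)[unfolded hom_relations_def ball_Un ball_setcompr fst_conv snd_conv]
  show ?thesis
    by (rule star_homI) (use rels in \<open>simp_all add: u star_homD[OF assms(1)]\<close>)
qed

lemma star_hom_imp_hom_relations:
  assumes "f \<in> star_hom F B" "h \<in> star_hom A B" "\<And>x. x \<in> carrier A \<Longrightarrow> f (u x) = h x"
  shows "\<forall>z\<in>hom_relations A F u. f (fst z) = f (snd z)"
  unfolding hom_relations_def ball_Un ball_setcompr fst_conv snd_conv
  by (simp add: u star_homD[OF assms(1)] star_homD[OF assms(2)] assms(3))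

end

section \<open>The free product of two *-algebras\<close>

context star_alg_pair
begin

lemma free_prod_gen_closed:
  "x \<in> carrier A \<Longrightarrow> free_gen (Inl x) \<in> carrier (free_star_algebra (free_prod_gens A B))"
  "y \<in> carrier B \<Longrightarrow> free_gen (Inr y) \<in> carrier (free_star_algebra (free_prod_gens A B))"
  by (auto intro!: free_gen_closed simp: free_prod_gens_def)

lemma free_prod_rels_closed: "free_prod_rels A B \<subseteq>
    carrier (free_star_algebra (free_prod_gens A B)) \<times> carrier (free_star_algebra (free_prod_gens A B))"
  unfolding free_prod_rels_def Let_def
  by (intro Un_least hom_relations_closed A.star_alg_axioms B.star_alg_axioms
      star_alg_free_star_algebra free_prod_gen_closed)

lemma star_alg_free_prod: "star_alg (free_prod A B)"
  unfolding free_prod_def by (rule star_alg_presented[OF free_prod_rels_closed])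

lemma free_prod_proj_rels:
  "\<forall>z\<in>free_prod_rels A B.
     impose_proj (free_star_algebra (free_prod_gens A B)) (free_prod_rels A B) (fst z) =
     impose_proj (free_star_algebra (free_prod_gens A B)) (free_prod_rels A B) (snd z)"
  using star_alg.impose_proj_eq[OF star_alg_free_star_algebra free_prod_rels_closed] by force

lemma free_prod_inl_hom: "free_prod_inl A B \<in> star_hom A (free_prod A B)"
  using hom_relations_imp_star_hom[OF A.star_alg_axioms star_alg_free_star_algebra
      free_prod_gen_closed(1) presented_proj[OF free_prod_rels_closed]] free_prod_proj_rels
  by (simp add: free_prod_rels_def Let_def ball_Un free_prod_def free_prod_inl_def[abs_def]
      presented_gen_def)

lemma free_prod_inr_hom: "free_prod_inr A B \<in> star_hom B (free_prod A B)"
  using hom_relations_imp_star_hom[OF B.star_alg_axioms star_alg_free_star_algebra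
      free_prod_gen_closed(2) presented_proj[OF free_prod_rels_closed]] free_prod_proj_rels
  by (simp add: free_prod_rels_def Let_def ball_Un free_prod_def free_prod_inr_def[abs_def]
      presented_gen_def)

lemma free_prod_lift:
  assumes "star_alg C" "f \<in> star_hom A C" "g \<in> star_hom B C"
  shows "\<exists>h\<in>star_hom (free_prod A B) C.
    (\<forall>x\<in>carrier A. h (free_prod_inl A B x) = f x) \<and> (\<forall>y\<in>carrier B. h (free_prod_inr A B y) = g y)"
proof -
  let ?X = "free_prod_gens A B"
  have "\<exists>h\<in>star_hom (presented ?X (free_prod_rels A B)) C.
      \<forall>x\<in>?X. h (presented_gen ?X (free_prod_rels A B) x) = case_sum f g x"
  proof (rule presented_lift[OF free_prod_rels_closed assms(1)])
    show "case_sum f g \<in> ?X \<rightarrow> carrier C"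
      using star_homD(1)[OF assms(2)] star_homD(1)[OF assms(3)] by (auto simp: free_prod_gens_def)
    fix k l r assume k: "k \<in> star_hom (free_star_algebra ?X) C"
      "\<And>x. x \<in> ?X \<Longrightarrow> k (free_gen x) = case_sum f g x" and lr: "(l, r) \<in> free_prod_rels A B"
    have inl: "k (free_gen (Inl x)) = f x" if "x \<in> carrier A" for x
      using k(2)[of "Inl x"] that by (auto simp: free_prod_gens_def)
    have inr: "k (free_gen (Inr y)) = g y" if "y \<in> carrier B" for y
      using k(2)[of "Inr y"] that by (auto simp: free_prod_gens_def)
    have "\<forall>z\<in>free_prod_rels A B. k (fst z) = k (snd z)"
      unfolding free_prod_rels_def Let_def ball_Un
      by (intro conjI star_hom_imp_hom_relations[OF A.star_alg_axioms star_alg_free_star_algebra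
            free_prod_gen_closed(1) k(1) assms(2) inl]
          star_hom_imp_hom_relations[OF B.star_alg_axioms star_alg_free_star_algebra
            free_prod_gen_closed(2) k(1) assms(3) inr])
    then show "k l = k r" using lr by force
  qed
  then obtain h where h: "h \<in> star_hom (free_prod A B) C"
    "\<forall>x\<in>?X. h (presented_gen ?X (free_prod_rels A B) x) = case_sum f g x"
    unfolding free_prod_def by blast
  have "h (free_prod_inl A B x) = f x" if "x \<in> carrier A" for x
    using bspec[OF h(2), of "Inl x"] that by (auto simp: free_prod_inl_def free_prod_gens_def)
  moreover have "h (free_prod_inr A B y) = g y" if "y \<in> carrier B" for y
    using bspec[OF h(2), of "Inr y"] that by (auto simp: free_prod_inr_def free_prod_gens_def)
  ultimately show ?thesis using h(1) by blast
qed

lemma free_prod_hom_eqI: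
  assumes "f \<in> star_hom (free_prod A B) C" "g \<in> star_hom (free_prod A B) C"
    "\<And>x. x \<in> carrier A \<Longrightarrow> f (free_prod_inl A B x) = g (free_prod_inl A B x)"
    "\<And>y. y \<in> carrier B \<Longrightarrow> f (free_prod_inr A B y) = g (free_prod_inr A B y)"
    "z \<in> carrier (free_prod A B)"
  shows "f z = g z"
  using presented_generates[OF free_prod_rels_closed] assms(1,2) _ assms(5)
  unfolding free_prod_def[symmetric]
  by (rule star_hom_eqI)
    (use assms(3,4) in \<open>auto simp: free_prod_gens_def free_prod_inl_def free_prod_inr_def\<close>)

end

section \<open>Amalgamated free products\<close>

locale amalgam =
  fixes I :: "'i set" and A :: "'i \<Rightarrow> 'a star_algebra" and B :: "'b star_algebra" and j
  assumes star_alg_A: "i \<in> I \<Longrightarrow> star_alg (A i)"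
    and j_closed: "i \<in> I \<Longrightarrow> x \<in> carrier B \<Longrightarrow> j i x \<in> carrier (A i)"
begin

abbreviation "gens \<equiv> amalg_gens I A"
abbreviation "amalg_relations \<equiv> amalg_rels I A B j"

lemma amalg_gen_closed:
  "i \<in> I \<Longrightarrow> x \<in> carrier (A i) \<Longrightarrow> free_gen (i, x) \<in> carrier (free_star_algebra gens)"
  by (auto intro!: free_gen_closed simp: amalg_gens_def)

lemma amalg_rels_closed:
  "amalg_relations \<subseteq> carrier (free_star_algebra gens) \<times> carrier (free_star_algebra gens)"
  unfolding amalg_rels_def
  by (intro Un_least UN_least hom_relations_closed star_alg_A star_alg_free_star_algebra amalg_gen_closed)
    (auto simp: amalg_gen_closed j_closed)

lemma star_alg_amalg: "star_alg (amalg_free_prod I A B j)"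
  unfolding amalg_free_prod_def by (rule star_alg_presented[OF amalg_rels_closed])

lemma amalg_proj_rels:
  "\<forall>z\<in>amalg_relations. impose_proj (free_star_algebra gens) amalg_relations (fst z) =
     impose_proj (free_star_algebra gens) amalg_relations (snd z)"
  using star_alg.impose_proj_eq[OF star_alg_free_star_algebra amalg_rels_closed] by force

lemma amalg_inj_hom:
  assumes "i \<in> I" shows "amalg_inj I A B j i \<in> star_hom (A i) (amalg_free_prod I A B j)"
proof -
  have "hom_relations (A i) (free_star_algebra gens) (\<lambda>x. free_gen (i, x)) \<subseteq> amalg_relations"
    using assms unfolding amalg_rels_def by blast
  then show ?thesis
    using hom_relations_imp_star_hom[OF star_alg_A[OF assms] star_alg_free_star_algebra
        amalg_gen_closed[OF assms] presented_proj[OF amalg_rels_closed]] amalg_proj_rels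
    by (fastforce simp: amalg_free_prod_def amalg_inj_def[abs_def] presented_gen_def)
qed

lemma amalg_inj_eq:
  assumes "i \<in> I" "k \<in> I" "x \<in> carrier B"
  shows "amalg_inj I A B j i (j i x) = amalg_inj I A B j k (j k x)"
proof -
  have "(free_gen (i, j i x), free_gen (k, j k x)) \<in> amalg_relations"
    using assms unfolding amalg_rels_def by blast
  then show ?thesis using amalg_proj_rels by (force simp: amalg_inj_def presented_gen_def)
qed

lemma amalg_lift:
  assumes "star_alg C" "\<And>i. i \<in> I \<Longrightarrow> \<phi> i \<in> star_hom (A i) C"
    "\<And>i k x. i \<in> I \<Longrightarrow> k \<in> I \<Longrightarrow> x \<in> carrier B \<Longrightarrow> \<phi> i (j i x) = \<phi> k (j k x)"
  shows "\<exists>h\<in>star_hom (amalg_free_prod I A B j) C.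
    \<forall>i\<in>I. \<forall>x\<in>carrier (A i). h (amalg_inj I A B j i x) = \<phi> i x"
proof -
  have "\<exists>h\<in>star_hom (presented gens amalg_relations) C.
      \<forall>x\<in>gens. h (presented_gen gens amalg_relations x) = (\<lambda>(i, x). \<phi> i x) x"
  proof (rule presented_lift[OF amalg_rels_closed assms(1)])
    show "(\<lambda>(i, x). \<phi> i x) \<in> gens \<rightarrow> carrier C"
      using star_homD(1)[OF assms(2)] by (auto simp: amalg_gens_def)
    fix k l r assume k: "k \<in> star_hom (free_star_algebra gens) C"
      "\<And>x. x \<in> gens \<Longrightarrow> k (free_gen x) = (\<lambda>(i, x). \<phi> i x) x" and lr: "(l, r) \<in> amalg_relations"
    have eq: "k (free_gen (i, x)) = \<phi> i x" if "i \<in> I" "x \<in> carrier (A i)" for i x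
      using k(2)[of "(i, x)"] that by (simp add: amalg_gens_def)
    have "\<forall>z\<in>hom_relations (A i) (free_star_algebra gens) (\<lambda>x. free_gen (i, x)). k (fst z) = k (snd z)"
      if "i \<in> I" for i
      by (rule star_hom_imp_hom_relations[OF star_alg_A[OF that] star_alg_free_star_algebra
          amalg_gen_closed[OF that] k(1) assms(2)[OF that] eq[OF that]])
    then have "\<forall>z\<in>amalg_relations. k (fst z) = k (snd z)"
      unfolding amalg_rels_def ball_Un ball_setcompr fst_conv snd_conv ball_UN
      using assms(3) by (simp add: eq j_closed)
    then show "k l = k r" using lr by force
  qed
  then show ?thesis
    by (auto simp: amalg_free_prod_def amalg_inj_def amalg_gens_def)
qed

lemma amalg_hom_eqI:
  assumes "f \<in> star_hom (amalg_free_prod I A B j) C" "g \<in> star_hom (amalg_free_prod I A B j) C"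
    "\<And>i x. i \<in> I \<Longrightarrow> x \<in> carrier (A i) \<Longrightarrow> f (amalg_inj I A B j i x) = g (amalg_inj I A B j i x)"
    "z \<in> carrier (amalg_free_prod I A B j)"
  shows "f z = g z"
  using presented_generates[OF amalg_rels_closed] assms(1,2) _ assms(4)
  unfolding amalg_free_prod_def[symmetric]
  by (rule star_hom_eqI) (use assms(3) in \<open>auto simp: amalg_gens_def amalg_inj_def\<close>)

end

text \<open>Magic unitaries in \<open>B\<close>, which amount to *-homomorphisms from
  \<open>perm_algebra N\<close>. Idempotence of the entries is the case \<open>j = k\<close> of
  \<open>row\<close>.\<close>

locale perm_family = B: star_alg B
  for N :: nat and B :: "'b star_algebra" and p :: "nat \<Rightarrow> nat \<Rightarrow> 'b" +
  assumes closed: "i \<in> {1..N} \<Longrightarrow> j \<in> {1..N} \<Longrightarrow> p i j \<in> carrier B"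
    and star_p: "i \<in> {1..N} \<Longrightarrow> j \<in> {1..N} \<Longrightarrow> star B (p i j) = p i j"
    and row: "i \<in> {1..N} \<Longrightarrow> j \<in> {1..N} \<Longrightarrow> k \<in> {1..N} \<Longrightarrow>
      p i j \<otimes>\<^bsub>B\<^esub> p i k = (if j = k then p i j else \<zero>\<^bsub>B\<^esub>)"
    and col: "i \<in> {1..N} \<Longrightarrow> j \<in> {1..N} \<Longrightarrow> k \<in> {1..N} \<Longrightarrow>
      p j i \<otimes>\<^bsub>B\<^esub> p k i = (if j = k then p j i else \<zero>\<^bsub>B\<^esub>)"
    and row_sum_one: "i \<in> {1..N} \<Longrightarrow> (\<Oplus>\<^bsub>B\<^esub>k\<in>{1..N}. p i k) = \<one>\<^bsub>B\<^esub>"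
    and col_sum_one: "j \<in> {1..N} \<Longrightarrow> (\<Oplus>\<^bsub>B\<^esub>k\<in>{1..N}. p k j) = \<one>\<^bsub>B\<^esub>"

lemma perm_family_image:
  assumes "perm_family N A b" "star_alg B" "f \<in> star_hom A B"
  shows "perm_family N B (\<lambda>i j. f (b i j))"
proof -
  interpret b: perm_family N A b by fact
  interpret B: star_alg B by fact
  note f = star_homD[OF assms(3)] star_hom_zero[OF b.B.star_alg_axioms assms(2,3)]
    star_hom_finsum[OF b.B.star_alg_axioms assms(2,3), symmetric]
  show ?thesis
    by (intro perm_family.intro perm_family_axioms.intro assms(2))
      (auto simp: f(1,4,7,8) b.closed b.star_p b.row b.col b.row_sum_one b.col_sum_one Pi_iff
        simp flip: f(3,6))
qed

text \<open>The identity of the group is idempotent and its own inverse, so at this element the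
  reflection relations become those of a magic unitary.\<close>

lemma (in refl_family) perm_family_one: "perm_family N B (\<lambda>i j. b i j \<one>\<^bsub>G\<^esub>)"
  by (intro perm_family.intro perm_family_axioms.intro B.star_alg_axioms)
    (auto simp: closed star_b row col row_sum_one col_sum_one)

section \<open>The universal property of the quantum permutation algebra\<close>

lemma perm_free_gen_closed:
  "i \<in> {1..N} \<Longrightarrow> j \<in> {1..N} \<Longrightarrow> free_gen (i, j) \<in> carrier (free_star_algebra (perm_gens N))"
  by (intro free_gen_closed) (auto simp: perm_gens_def)

lemma perm_rels_closed:
  "perm_rels N \<subseteq> carrier (free_star_algebra (perm_gens N)) \<times> carrier (free_star_algebra (perm_gens N))"
proof -
  interpret F: star_alg "free_star_algebra (perm_gens N)" by (rule star_alg_free_star_algebra)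
  show ?thesis
    by (auto simp: perm_rels_def Let_def perm_free_gen_closed intro!: F.sum_closed)
qed

context
  fixes N :: nat and B :: "'b star_algebra" and f
  assumes B: "star_alg B" and f_hom: "f \<in> star_hom (free_star_algebra (perm_gens N)) B"
begin

interpretation F: star_alg "free_star_algebra (perm_gens N)" by (rule star_alg_free_star_algebra)

lemmas perm_rel_simps = star_homD[OF f_hom] star_hom_zero[OF F.star_alg_axioms B f_hom]
  star_hom_finsum[OF F.star_alg_axioms B f_hom]

lemma perm_family_rels:
  assumes "perm_family N B (\<lambda>i j. f (free_gen (i, j)))"
  shows "\<forall>z\<in>perm_rels N. f (fst z) = f (snd z)"
proof -
  interpret b: perm_family N B "\<lambda>i j. f (free_gen (i, j))" by fact
  show ?thesis
    unfolding perm_rels_def Let_def ball_Un ball_setcompr fst_conv snd_conv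
    by (intro conjI allI impI)
      (simp_all add: perm_rel_simps perm_free_gen_closed b.star_p b.row b.col b.row_sum_one b.col_sum_one
        Pi_iff del: atLeastAtMost_iff)
qed

lemma rels_perm_family:
  assumes "\<forall>z\<in>perm_rels N. f (fst z) = f (snd z)"
  shows "perm_family N B (\<lambda>i j. f (free_gen (i, j)))"
proof -
  note rels = assms[unfolded perm_rels_def Let_def ball_Un ball_setcompr fst_conv snd_conv]
  note closed = perm_free_gen_closed
  show ?thesis
  proof (intro perm_family.intro perm_family_axioms.intro B)
    fix i j k
    assume i: "i \<in> {1..N}"
    show "(\<Oplus>\<^bsub>B\<^esub>k\<in>{1..N}. f (free_gen (i, k))) = \<one>\<^bsub>B\<^esub>"
      using rels i by (simp add: perm_rel_simps(4,8)[symmetric] closed Pi_iff)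
    show "(\<Oplus>\<^bsub>B\<^esub>k\<in>{1..N}. f (free_gen (k, i))) = \<one>\<^bsub>B\<^esub>"
      using rels i by (simp add: perm_rel_simps(4,8)[symmetric] closed Pi_iff)
    assume j: "j \<in> {1..N}"
    show "f (free_gen (i, j)) \<in> carrier B" using i j by (intro perm_rel_simps closed)
    show "star B (f (free_gen (i, j))) = f (free_gen (i, j))"
      using rels i j by (simp add: perm_rel_simps(6)[symmetric] closed)
    assume k: "k \<in> {1..N}"
    show "f (free_gen (i, j)) \<otimes>\<^bsub>B\<^esub> f (free_gen (i, k)) = (if j = k then f (free_gen (i, j)) else \<zero>\<^bsub>B\<^esub>)"
      using rels i j k by (simp add: perm_rel_simps(3)[symmetric] perm_rel_simps(7) closed)
    show "f (free_gen (j, i)) \<otimes>\<^bsub>B\<^esub> f (free_gen (k, i)) = (if j = k then f (free_gen (j, i)) else \<zero>\<^bsub>B\<^esub>)"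
      using rels i j k by (simp add: perm_rel_simps(3)[symmetric] perm_rel_simps(7) closed)
  qed
qed

end

lemma star_alg_perm_algebra: "star_alg (perm_algebra N)"
  unfolding perm_algebra_def by (rule star_alg_presented[OF perm_rels_closed])

lemma perm_family_perm_p: "perm_family N (perm_algebra N) (perm_p N)"
  using rels_perm_family[OF star_alg_perm_algebra, of "impose_proj (free_star_algebra (perm_gens N)) (perm_rels N)" N]
    presented_proj[OF perm_rels_closed, of N]
    star_alg.impose_proj_eq[OF star_alg_free_star_algebra perm_rels_closed, of _ _ N]
  by (simp add: perm_algebra_def perm_p_def[abs_def] presented_gen_def)

lemma perm_lift:
  assumes "perm_family N B p"
  shows "\<exists>h\<in>star_hom (perm_algebra N) B. \<forall>i\<in>{1..N}. \<forall>j\<in>{1..N}. h (perm_p N i j) = p i j"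
proof -
  interpret p: perm_family N B p by fact
  have "\<exists>h\<in>star_hom (presented (perm_gens N) (perm_rels N)) B.
      \<forall>x\<in>perm_gens N. h (presented_gen (perm_gens N) (perm_rels N) x) = (\<lambda>(i, j). p i j) x"
  proof (rule presented_lift[OF perm_rels_closed])
    fix f l r
    assume f: "f \<in> star_hom (free_star_algebra (perm_gens N)) B"
      "\<And>x. x \<in> perm_gens N \<Longrightarrow> f (free_gen x) = (\<lambda>(i, j). p i j) x" and lr: "(l, r) \<in> perm_rels N"
    have eq: "f (free_gen (i, j)) = p i j" if "i \<in> {1..N}" "j \<in> {1..N}" for i j
      using f(2)[of "(i, j)"] that by (simp add: perm_gens_def)
    have "perm_family N B (\<lambda>i j. f (free_gen (i, j)))"
      using p.closed p.star_p p.row p.col p.row_sum_one p.col_sum_one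
      by (intro perm_family.intro perm_family_axioms.intro p.B.star_alg_axioms)
        (simp_all add: eq cong: p.B.finsum_cong)
    then show "f l = f r"
      using perm_family_rels[OF p.B.star_alg_axioms f(1)] lr by force
  qed (auto simp: p.B.star_alg_axioms perm_gens_def p.closed)
  then show ?thesis by (auto simp: perm_algebra_def perm_p_def perm_gens_def)
qed

lemma perm_hom_eqI:
  assumes "f \<in> star_hom (perm_algebra N) B" "g \<in> star_hom (perm_algebra N) B"
    "\<And>i j. i \<in> {1..N} \<Longrightarrow> j \<in> {1..N} \<Longrightarrow> f (perm_p N i j) = g (perm_p N i j)"
    "x \<in> carrier (perm_algebra N)"
  shows "f x = g x"
  using presented_generates[OF perm_rels_closed] assms(1,2) _ assms(4)
  unfolding perm_algebra_def[symmetric]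
  by (rule star_hom_eqI) (use assms(3) in \<open>auto simp: perm_gens_def perm_p_def\<close>)

section \<open>The three layers of the free wreath product\<close>

locale wreath = G: group G + L: subgroup L G
  for G :: "('g, 'r) monoid_scheme" and N :: nat and L :: "'g set"
begin

abbreviation "CG \<equiv> group_star_algebra G"
abbreviation "CL \<equiv> group_star_algebra (G\<lparr>carrier := L\<rparr>)"

sublocale CG: star_monoid G "m_inv G"
  rewrites "monoid_star_algebra G (m_inv G) = CG"
  by (rule G.group_star_monoid) (simp add: group_star_algebra_def)

lemma carrier_CL: "carrier CL = {f. Poly_Mapping.keys f \<subseteq> L}"
  by (simp add: group_star_algebra_def monoid_star_algebra_def)

lemma CL_subset: "carrier CL \<subseteq> carrier CG"
  unfolding carrier_CL CG.carrier_MA using L.subset by auto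

sublocale AM: amalgam "{1..N}" "\<lambda>_. CG" CL "\<lambda>_. id"
  by unfold_locales (use CL_subset CG.star_alg_MA in auto)

abbreviation "M \<equiv> wreath_amalg G L N"

sublocale FP: star_alg_pair M "perm_algebra N"
  unfolding wreath_amalg_def
  by (intro star_alg_pair.intro AM.star_alg_amalg star_alg_perm_algebra)

abbreviation "WF \<equiv> wreath_free G L N"

lemma star_alg_WF: "star_alg WF"
  unfolding wreath_free_def by (rule FP.star_alg_free_prod)

sublocale WF: star_alg WF by (rule star_alg_WF)

abbreviation "\<nu>' i x \<equiv> free_prod_inl M (perm_algebra N) (wreath_amalg_nu G L N i x)"
abbreviation "p' i j \<equiv> free_prod_inr M (perm_algebra N) (perm_p N i j)"

lemma wreath_amalg_nu_hom: "i \<in> {1..N} \<Longrightarrow> wreath_amalg_nu G L N i \<in> star_hom CG M"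
  unfolding wreath_amalg_def wreath_amalg_nu_def[abs_def] by (rule AM.amalg_inj_hom)

lemma \<nu>'_hom: "i \<in> {1..N} \<Longrightarrow> \<nu>' i \<in> star_hom CG WF"
  unfolding wreath_free_def by (intro star_hom_comp[OF wreath_amalg_nu_hom FP.free_prod_inl_hom])

lemma perm_family_p': "perm_family N WF p'"
  unfolding wreath_free_def
  by (rule perm_family_image[OF perm_family_perm_p FP.star_alg_free_prod FP.free_prod_inr_hom])

lemma wreath_rels_closed: "wreath_rels G L N \<subseteq> carrier WF \<times> carrier WF"
  using star_homD(1)[OF \<nu>'_hom] perm_family.closed[OF perm_family_p']
  by (auto simp: wreath_rels_def Let_def simp del: atLeastAtMost_iff)

abbreviation "W \<equiv> wreath_algebra G L N"
abbreviation "\<nu> \<equiv> wreath_nu G L N"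
abbreviation "p \<equiv> wreath_p G L N"

lemma star_alg_W: "star_alg W"
  unfolding wreath_algebra_def by (rule WF.star_alg_impose[OF wreath_rels_closed])

sublocale W: star_alg W by (rule star_alg_W)

lemma proj_W: "impose_proj WF (wreath_rels G L N) \<in> star_hom WF W"
  unfolding wreath_algebra_def by (rule WF.impose_proj_star_hom[OF wreath_rels_closed])

lemma \<nu>_hom: "i \<in> {1..N} \<Longrightarrow> \<nu> i \<in> star_hom CG W"
  unfolding wreath_nu_def[abs_def] by (rule star_hom_comp[OF \<nu>'_hom proj_W])

lemma perm_family_p: "perm_family N W p"
  using perm_family_image[OF perm_family_p' star_alg_W proj_W] by (simp add: wreath_p_def[abs_def])

lemma \<nu>_eq:
  assumes "i \<in> {1..N}" "k \<in> {1..N}" "x \<in> carrier CL" shows "\<nu> i x = \<nu> k x"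
  using AM.amalg_inj_eq[OF assms] by (simp add: wreath_nu_def wreath_amalg_nu_def)

lemma \<nu>_p_commute:
  assumes "i \<in> {1..N}" "j \<in> {1..N}" "x \<in> carrier CG"
  shows "\<nu> i x \<otimes>\<^bsub>W\<^esub> p i j = p i j \<otimes>\<^bsub>W\<^esub> \<nu> i x"
proof -
  have "(\<nu>' i x \<otimes>\<^bsub>WF\<^esub> p' i j, p' i j \<otimes>\<^bsub>WF\<^esub> \<nu>' i x) \<in> wreath_rels G L N"
    using assms unfolding wreath_rels_def Let_def by blast
  from WF.impose_proj_eq[OF wreath_rels_closed this] show ?thesis
    using star_homD(1)[OF \<nu>'_hom[OF assms(1)] assms(3)] perm_family.closed[OF perm_family_p' assms(1,2)]
    by (simp add: star_homD(3)[OF proj_W] wreath_nu_def wreath_p_def)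
qed

text \<open>Each layer consumes its own hypotheses: the homomorphisms \<open>\<phi> i\<close>,
  agreeing on \<open>CL\<close>, give a map on the amalgamated free product, \<open>q\<close> gives
  one on \<open>perm_algebra N\<close>, the free product joins the two, and commutation lets the
  result pass to the last quotient.\<close>

lemma wreath_lift:
  assumes "\<And>i. i \<in> {1..N} \<Longrightarrow> \<phi> i \<in> star_hom CG B" "perm_family N B q"
    "\<And>i k x. i \<in> {1..N} \<Longrightarrow> k \<in> {1..N} \<Longrightarrow> x \<in> carrier CL \<Longrightarrow> \<phi> i x = \<phi> k x"
    "\<And>i j x. i \<in> {1..N} \<Longrightarrow> j \<in> {1..N} \<Longrightarrow> x \<in> carrier CG \<Longrightarrow> \<phi> i x \<otimes>\<^bsub>B\<^esub> q i j = q i j \<otimes>\<^bsub>B\<^esub> \<phi> i x"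
  shows "\<exists>h\<in>star_hom W B. (\<forall>i\<in>{1..N}. \<forall>x\<in>carrier CG. h (\<nu> i x) = \<phi> i x) \<and>
    (\<forall>i\<in>{1..N}. \<forall>j\<in>{1..N}. h (p i j) = q i j)"
proof -
  interpret q: perm_family N B q by fact
  have B: "star_alg B" by (rule q.B.star_alg_axioms)
  have "\<exists>f\<in>star_hom (amalg_free_prod {1..N} (\<lambda>_. CG) CL (\<lambda>_. id)) B. \<forall>i\<in>{1..N}. \<forall>x\<in>carrier CG.
      f (amalg_inj {1..N} (\<lambda>_. CG) CL (\<lambda>_. id) i x) = \<phi> i x"
    by (rule AM.amalg_lift[OF B assms(1)]) (assumption, unfold id_apply, rule assms(3))
  then obtain f where f: "f \<in> star_hom M B"
    "\<forall>i\<in>{1..N}. \<forall>x\<in>carrier CG. f (wreath_amalg_nu G L N i x) = \<phi> i x"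
    unfolding wreath_amalg_def wreath_amalg_nu_def by blast
  obtain g where g: "g \<in> star_hom (perm_algebra N) B" "\<forall>i\<in>{1..N}. \<forall>j\<in>{1..N}. g (perm_p N i j) = q i j"
    using perm_lift[OF assms(2)] by blast
  obtain h where h: "h \<in> star_hom WF B" "\<forall>x\<in>carrier M. h (free_prod_inl M (perm_algebra N) x) = f x"
    "\<forall>x\<in>carrier (perm_algebra N). h (free_prod_inr M (perm_algebra N) x) = g x"
    using FP.free_prod_lift[OF B f(1) g(1)] unfolding wreath_free_def by blast
  have h_\<nu>: "h (\<nu>' i x) = \<phi> i x" if "i \<in> {1..N}" "x \<in> carrier CG" for i x
    using that h(2) f(2) star_homD(1)[OF wreath_amalg_nu_hom] by simp
  have h_p: "h (p' i j) = q i j" if "i \<in> {1..N}" "j \<in> {1..N}" for i j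
    using that h(3) g(2) perm_family.closed[OF perm_family_perm_p] by simp
  have "h l = h r" if lr_in: "(l, r) \<in> wreath_rels G L N" for l r
  proof -
    obtain i j x where ij: "i \<in> {1..N}" "j \<in> {1..N}" "x \<in> carrier CG"
      and lr: "l = \<nu>' i x \<otimes>\<^bsub>WF\<^esub> p' i j" "r = p' i j \<otimes>\<^bsub>WF\<^esub> \<nu>' i x"
      using lr_in unfolding wreath_rels_def Let_def by blast
    have "\<nu>' i x \<in> carrier WF" "p' i j \<in> carrier WF"
      using ij star_homD(1)[OF \<nu>'_hom] perm_family.closed[OF perm_family_p'] by auto
    then show ?thesis
      using assms(4)[OF ij] ij by (simp add: lr star_homD(3)[OF h(1)] h_\<nu> h_p)
  qed
  then obtain k where "k \<in> star_hom W B" "\<forall>x\<in>carrier WF. k (impose_proj WF (wreath_rels G L N) x) = h x"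
    using WF.impose_lift[OF wreath_rels_closed B h(1)] unfolding wreath_algebra_def by blast
  then show ?thesis
    using star_homD(1)[OF \<nu>'_hom] perm_family.closed[OF perm_family_p'] h_\<nu> h_p
    by (intro bexI[of _ k]) (auto simp: wreath_nu_def wreath_p_def simp del: atLeastAtMost_iff)
qed

abbreviation "n i g \<equiv> \<nu> i (Poly_Mapping.single g 1)"

text \<open>The layers are peeled off in reverse: equality is pulled back from the quotient to the
  free product, tested there on both factors, and on each copy of the group algebra reduced to group
  elements.\<close>

lemma wreath_hom_eqI:
  assumes "f \<in> star_hom W B" "f' \<in> star_hom W B"
    "\<And>i g. i \<in> {1..N} \<Longrightarrow> g \<in> carrier G \<Longrightarrow> f (n i g) = f' (n i g)"
    "\<And>i j. i \<in> {1..N} \<Longrightarrow> j \<in> {1..N} \<Longrightarrow> f (p i j) = f' (p i j)"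
    "x \<in> carrier W"
  shows "f x = f' x"
proof -
  let ?\<pi> = "impose_proj WF (wreath_rels G L N)"
  have \<nu>: "f (\<nu> i x) = f' (\<nu> i x)" if "i \<in> {1..N}" "x \<in> carrier CG" for i x
    by (rule star_hom_eqI[OF CG.star_generates_MA star_hom_comp[OF \<nu>_hom assms(1)]
          star_hom_comp[OF \<nu>_hom assms(2)] _ that(2)])
      (use that assms(3) in auto)
  have hom: "(\<lambda>x. f (?\<pi> x)) \<in> star_hom WF B" "(\<lambda>x. f' (?\<pi> x)) \<in> star_hom WF B"
    by (rule star_hom_comp[OF proj_W assms(1)], rule star_hom_comp[OF proj_W assms(2)])
  obtain y where y: "y \<in> carrier WF" "x = ?\<pi> y"
    using assms(5) WF.carrier_impose[OF wreath_rels_closed] unfolding wreath_algebra_def by auto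
  show ?thesis unfolding y(2)
  proof (rule FP.free_prod_hom_eqI[OF hom[unfolded wreath_free_def], folded wreath_free_def])
    fix m assume "m \<in> carrier M"
    then show "f (?\<pi> (free_prod_inl M (perm_algebra N) m)) = f' (?\<pi> (free_prod_inl M (perm_algebra N) m))"
      unfolding wreath_amalg_def
      by (rule AM.amalg_hom_eqI[rotated 3,
          OF _ star_hom_comp[OF FP.free_prod_inl_hom[folded wreath_free_def] hom(1), unfolded wreath_amalg_def]
            star_hom_comp[OF FP.free_prod_inl_hom[folded wreath_free_def] hom(2), unfolded wreath_amalg_def]])
        (use \<nu> in \<open>simp add: wreath_nu_def wreath_amalg_nu_def wreath_amalg_def\<close>)
  next
    fix m assume "m \<in> carrier (perm_algebra N)"
    then show "f (?\<pi> (free_prod_inr M (perm_algebra N) m)) = f' (?\<pi> (free_prod_inr M (perm_algebra N) m))"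
      by (rule perm_hom_eqI[rotated 3,
          OF _ star_hom_comp[OF FP.free_prod_inr_hom[folded wreath_free_def] hom(1)]
            star_hom_comp[OF FP.free_prod_inr_hom[folded wreath_free_def] hom(2)]])
        (use assms(4) in \<open>simp add: wreath_p_def\<close>)
  qed (rule y(1))
qed

end

section \<open>The isomorphism\<close>

locale wreath_reflection = reflection_sub G N L + wreath G N L
  for G :: "('g, 'r) monoid_scheme" and N :: nat and L :: "'g set"
begin

sublocale p: perm_family N W p by (rule perm_family_p)

sublocale WW: star_alg_pair W W by unfold_locales

sublocale KK: star_alg_pair K K by unfold_locales

lemma n_closed: "i \<in> {1..N} \<Longrightarrow> g \<in> carrier G \<Longrightarrow> n i g \<in> carrier W"
  by (intro star_homD(1)[OF \<nu>_hom] CG.single_in_MA)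

lemma n_mult:
  "i \<in> {1..N} \<Longrightarrow> g \<in> carrier G \<Longrightarrow> h \<in> carrier G \<Longrightarrow> n i g \<otimes>\<^bsub>W\<^esub> n i h = n i (g \<otimes>\<^bsub>G\<^esub> h)"
  by (simp add: CG.single_in_MA CG.mult_MA_single flip: star_homD(3)[OF \<nu>_hom])

lemma n_star: "i \<in> {1..N} \<Longrightarrow> g \<in> carrier G \<Longrightarrow> star W (n i g) = n i (inv\<^bsub>G\<^esub> g)"
  by (simp add: CG.single_in_MA CG.star_MA_single flip: star_homD(6)[OF \<nu>_hom])

lemma n_one: "i \<in> {1..N} \<Longrightarrow> n i \<one>\<^bsub>G\<^esub> = \<one>\<^bsub>W\<^esub>"
  using star_homD(4)[OF \<nu>_hom] by (simp add: CG.one_MA)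

lemma n_eq: "i \<in> {1..N} \<Longrightarrow> k \<in> {1..N} \<Longrightarrow> g \<in> L \<Longrightarrow> n i g = n k g"
  by (rule \<nu>_eq) (auto simp: carrier_CL)

lemma n_p: "i \<in> {1..N} \<Longrightarrow> j \<in> {1..N} \<Longrightarrow> g \<in> carrier G \<Longrightarrow>
    n i g \<otimes>\<^bsub>W\<^esub> p i j = p i j \<otimes>\<^bsub>W\<^esub> n i g"
  by (intro \<nu>_p_commute CG.single_in_MA)

definition \<beta> where "\<beta> i j g = n i g \<otimes>\<^bsub>W\<^esub> p i j"

lemma \<beta>_closed: "i \<in> {1..N} \<Longrightarrow> j \<in> {1..N} \<Longrightarrow> g \<in> carrier G \<Longrightarrow> \<beta> i j g \<in> carrier W"
  unfolding \<beta>_def by (intro W.m_closed n_closed p.closed)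

lemma row_sum_\<beta>:
  assumes "i \<in> {1..N}" "g \<in> carrier G"
  shows "(\<Oplus>\<^bsub>W\<^esub>k\<in>{1..N}. \<beta> i k g) = n i g"
proof -
  have "(\<Oplus>\<^bsub>W\<^esub>k\<in>{1..N}. \<beta> i k g) = n i g \<otimes>\<^bsub>W\<^esub> (\<Oplus>\<^bsub>W\<^esub>k\<in>{1..N}. p i k)"
    unfolding \<beta>_def using assms by (intro W.sum_mult_l[symmetric] n_closed p.closed) auto
  then show ?thesis using assms n_closed by (simp add: p.row_sum_one)
qed

lemma \<beta>_one: "i \<in> {1..N} \<Longrightarrow> j \<in> {1..N} \<Longrightarrow> \<beta> i j \<one>\<^bsub>G\<^esub> = p i j"
  using p.closed by (simp add: \<beta>_def n_one)

lemma refl_family_\<beta>: "refl_family G N W \<beta>"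
proof (intro refl_family.intro refl_family_axioms.intro star_alg_W G.group_axioms)
  fix i j k g h
  assume i: "i \<in> {1..N}"
  show "(\<Oplus>\<^bsub>W\<^esub>k\<in>{1..N}. \<beta> i k \<one>\<^bsub>G\<^esub>) = \<one>\<^bsub>W\<^esub>" using i by (simp add: row_sum_\<beta> n_one)
  show "(\<Oplus>\<^bsub>W\<^esub>k\<in>{1..N}. \<beta> k i \<one>\<^bsub>G\<^esub>) = \<one>\<^bsub>W\<^esub>"
    using i p.col_sum_one[OF i] p.closed by (simp add: \<beta>_one cong: W.finsum_cong)
  assume j: "j \<in> {1..N}" and g: "g \<in> carrier G"
  show "\<beta> i j g \<in> carrier W" using i j g by (rule \<beta>_closed)
  show "star W (\<beta> i j g) = \<beta> i j (inv\<^bsub>G\<^esub> g)"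
    using i j g by (simp add: \<beta>_def W.star_mult n_closed p.closed n_star p.star_p n_p)
  assume k: "k \<in> {1..N}" and h: "h \<in> carrier G"
  \<comment> \<open>In a row, \<open>p i j\<close> and \<open>n i h\<close> share the index
    \<open>i\<close>, so the commutation relation applies directly.\<close>
  have "\<beta> i j g \<otimes>\<^bsub>W\<^esub> \<beta> i k h = (n i g \<otimes>\<^bsub>W\<^esub> n i h) \<otimes>\<^bsub>W\<^esub> (p i j \<otimes>\<^bsub>W\<^esub> p i k)"
    unfolding \<beta>_def using i j k g h by (intro W.mult_exchange n_closed p.closed n_p[symmetric])
  then show "\<beta> i j g \<otimes>\<^bsub>W\<^esub> \<beta> i k h = (if j = k then \<beta> i j (g \<otimes>\<^bsub>G\<^esub> h) else \<zero>\<^bsub>W\<^esub>)"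
    using i j k g h by (simp add: \<beta>_def n_mult p.row n_closed)
  \<comment> \<open>The second factor is rewritten with its projection in front, so that two
    projections of the same column meet in the middle. This settles the case
    \<open>j \<noteq> k\<close>, in which \<open>p j i\<close> and \<open>n k h\<close> belong to
    different rows and are not known to commute.\<close>
  have "\<beta> j i g \<otimes>\<^bsub>W\<^esub> \<beta> k i h = (n j g \<otimes>\<^bsub>W\<^esub> p j i) \<otimes>\<^bsub>W\<^esub> (p k i \<otimes>\<^bsub>W\<^esub> n k h)"
    using i j k g h by (simp add: \<beta>_def n_p)
  also have "\<dots> = n j g \<otimes>\<^bsub>W\<^esub> (p j i \<otimes>\<^bsub>W\<^esub> p k i) \<otimes>\<^bsub>W\<^esub> n k h"
    using i j k g h by (simp add: W.m_assoc n_closed p.closed)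
  also have "\<dots> = (if j = k then n j g \<otimes>\<^bsub>W\<^esub> (n j h \<otimes>\<^bsub>W\<^esub> p j i) else \<zero>\<^bsub>W\<^esub>)"
    using i j k g h by (simp add: p.col W.m_assoc n_closed p.closed n_p)
  also have "\<dots> = (if j = k then \<beta> j i (g \<otimes>\<^bsub>G\<^esub> h) else \<zero>\<^bsub>W\<^esub>)"
    using i j k g h by (simp add: \<beta>_def n_closed p.closed n_mult W.m_assoc[symmetric])
  finally show "\<beta> j i g \<otimes>\<^bsub>W\<^esub> \<beta> k i h = (if j = k then \<beta> j i (g \<otimes>\<^bsub>G\<^esub> h) else \<zero>\<^bsub>W\<^esub>)" .
qed

text \<open>The row sums of \<open>\<beta>\<close> are the elements \<open>n i g\<close>, and for
  \<open>g\<close> in the subgroup amalgamation makes these independent of \<open>i\<close>; that is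
  the relation imposed on \<open>K\<close>.\<close>

lemma \<Psi>_exists: "\<exists>\<Psi>\<in>star_hom K W.
    \<forall>i\<in>{1..N}. \<forall>j\<in>{1..N}. \<forall>g\<in>carrier G. \<Psi> (\<alpha> i j g) = \<beta> i j g"
  by (rule K_lift[OF refl_family_\<beta>]) (simp only: row_sum_\<beta> L.mem_carrier, rule n_eq)

definition \<phi> where "\<phi> i = lin_ext K (\<alpha>.row_sum i)"

lemma \<phi>_hom: "i \<in> {1..N} \<Longrightarrow> \<phi> i \<in> star_hom CG K"
  unfolding \<phi>_def
  by (intro CG.lin_ext_star_hom star_alg_K)
    (simp_all add: \<alpha>.row_sum_closed \<alpha>.row_sum_one' \<alpha>.row_sum_mult \<alpha>.star_row_sum
      del: atLeastAtMost_iff)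

lemma \<phi>_single: "i \<in> {1..N} \<Longrightarrow> g \<in> carrier G \<Longrightarrow> \<phi> i (Poly_Mapping.single g c) = c \<odot>\<^bsub>K\<^esub> \<alpha>.row_sum i g"
  unfolding \<phi>_def by (intro K.lin_ext_single \<alpha>.row_sum_closed)

lemma \<phi>_eq:
  assumes "i \<in> {1..N}" "k \<in> {1..N}" "x \<in> carrier CL" shows "\<phi> i x = \<phi> k x"
proof -
  have L: "g \<in> L" if "g \<in> Poly_Mapping.keys x" for g using assms(3) that by (auto simp: carrier_CL)
  have "\<alpha>.row_sum i g = \<alpha>.row_sum k g" if "g \<in> Poly_Mapping.keys x" for g
    unfolding \<alpha>.row_sum_def by (rule row_sum_\<alpha>_eq[OF assms(1,2) L[OF that]])
  then show ?thesis
    unfolding \<phi>_def lin_ext_def using assms(2)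
    by (intro K.sum_cong K.smult_closed \<alpha>.row_sum_closed) (simp_all add: L L.mem_carrier)
qed

lemma \<phi>_commute:
  assumes "i \<in> {1..N}" "j \<in> {1..N}" "x \<in> carrier CG"
  shows "\<phi> i x \<otimes>\<^bsub>K\<^esub> \<alpha> i j \<one>\<^bsub>G\<^esub> = \<alpha> i j \<one>\<^bsub>G\<^esub> \<otimes>\<^bsub>K\<^esub> \<phi> i x"
  using assms(3)
proof (induction rule: CG.MA_induct)
  case zero
  then show ?case
    using assms \<alpha>.closed star_hom_zero[OF CG.star_alg_MA star_alg_K \<phi>_hom] by (simp add: CG.zero_MA)
next
  case (single g c)
  then show ?case
    using assms by (simp add: \<phi>_single K.smult_mult_l K.smult_mult_r \<alpha>.closed \<alpha>.row_sum_closed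
        \<alpha>.row_sum_mult_b \<alpha>.b_mult_row_sum)
next
  case (add x y)
  then show ?case
    using assms star_homD(1,2)[OF \<phi>_hom]
    by (simp add: K.l_distr K.r_distr \<alpha>.closed flip: CG.add_MA)
qed

lemma \<Phi>_exists: "\<exists>\<Phi>\<in>star_hom W K.
    (\<forall>i\<in>{1..N}. \<forall>g\<in>carrier G. \<Phi> (n i g) = \<alpha>.row_sum i g) \<and>
    (\<forall>i\<in>{1..N}. \<forall>j\<in>{1..N}. \<Phi> (p i j) = \<alpha> i j \<one>\<^bsub>G\<^esub>)"
proof -
  have "\<exists>\<Phi>\<in>star_hom W K. (\<forall>i\<in>{1..N}. \<forall>x\<in>carrier CG. \<Phi> (\<nu> i x) = \<phi> i x) \<and>
      (\<forall>i\<in>{1..N}. \<forall>j\<in>{1..N}. \<Phi> (p i j) = \<alpha> i j \<one>\<^bsub>G\<^esub>)"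
    by (intro wreath_lift \<phi>_hom \<alpha>.perm_family_one \<phi>_eq \<phi>_commute)
  then obtain \<Phi> where \<Phi>: "\<Phi> \<in> star_hom W K" "\<forall>i\<in>{1..N}. \<forall>x\<in>carrier CG. \<Phi> (\<nu> i x) = \<phi> i x"
    "\<forall>i\<in>{1..N}. \<forall>j\<in>{1..N}. \<Phi> (p i j) = \<alpha> i j \<one>\<^bsub>G\<^esub>" by blast
  then show ?thesis
    by (intro bexI[of _ \<Phi>])
      (simp_all add: CG.single_in_MA \<phi>_single \<alpha>.row_sum_closed del: atLeastAtMost_iff)
qed

text \<open>The values on generators stay in the statement because the push-forward of the coproduct
  depends on which isomorphism is used, and these values determine it on the carrier.\<close>

lemma isomorphism:
  "\<exists>\<Phi>\<in>star_iso W K.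
     (\<forall>i\<in>{1..N}. \<forall>g\<in>carrier G. \<Phi> (n i g) = \<alpha>.row_sum i g) \<and>
     (\<forall>i\<in>{1..N}. \<forall>j\<in>{1..N}. \<Phi> (p i j) = \<alpha> i j \<one>\<^bsub>G\<^esub>)"
proof -
  obtain \<Psi> where \<Psi>: "\<Psi> \<in> star_hom K W"
    "\<forall>i\<in>{1..N}. \<forall>j\<in>{1..N}. \<forall>g\<in>carrier G. \<Psi> (\<alpha> i j g) = \<beta> i j g" using \<Psi>_exists by blast
  obtain \<Phi> where \<Phi>: "\<Phi> \<in> star_hom W K" "\<forall>i\<in>{1..N}. \<forall>g\<in>carrier G. \<Phi> (n i g) = \<alpha>.row_sum i g"
    "\<forall>i\<in>{1..N}. \<forall>j\<in>{1..N}. \<Phi> (p i j) = \<alpha> i j \<one>\<^bsub>G\<^esub>" using \<Phi>_exists by blast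
  have "\<Phi> (\<Psi> x) = x" if "x \<in> carrier K" for x
  proof (rule K_hom_eqI[OF star_hom_comp[OF \<Psi>(1) \<Phi>(1)] star_hom_id _ that])
    fix i j g assume "i \<in> {1..N}" "j \<in> {1..N}" "g \<in> carrier G"
    then show "\<Phi> (\<Psi> (\<alpha> i j g)) = \<alpha> i j g"
      using \<Psi>(2) \<Phi>(2,3)
      by (simp add: \<beta>_def star_homD(3)[OF \<Phi>(1)] n_closed p.closed \<alpha>.row_sum_mult_b)
  qed
  moreover have "\<Psi> (\<Phi> x) = x" if "x \<in> carrier W" for x
  proof (rule wreath_hom_eqI[OF star_hom_comp[OF \<Phi>(1) \<Psi>(1)] star_hom_id _ _ that])
    fix i assume i: "i \<in> {1..N}"
    show "\<Psi> (\<Phi> (n i g)) = n i g" if g: "g \<in> carrier G" for g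
    proof -
      have "\<Psi> (\<Phi> (n i g)) = (\<Oplus>\<^bsub>W\<^esub>k\<in>{1..N}. \<Psi> (\<alpha> i k g))"
        using i g \<Phi>(2)
        by (simp add: \<alpha>.row_sum_def star_hom_finsum[OF star_alg_K star_alg_W \<Psi>(1)] \<alpha>.closed Pi_iff)
      also have "\<dots> = (\<Oplus>\<^bsub>W\<^esub>k\<in>{1..N}. \<beta> i k g)"
        using i g \<Psi>(2) by (intro W.sum_cong \<beta>_closed) auto
      finally show ?thesis using i g by (simp add: row_sum_\<beta>)
    qed
    show "\<Psi> (\<Phi> (p i j)) = p i j" if "j \<in> {1..N}" for j
      using i that \<Phi>(3) \<Psi>(2) by (simp add: \<beta>_one)
  qed
  ultimately have "bij_betw \<Phi> (carrier W) (carrier K)"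
    using star_homD(1)[OF \<Phi>(1)] star_homD(1)[OF \<Psi>(1)]
    by (intro bij_betw_byWitness[of _ \<Psi>]) auto
  then show ?thesis using \<Phi> by (auto simp: star_iso_def)
qed

text \<open>The coproduct of \<open>W\<close> is obtained by way of \<open>K\<close>, whose
  universal property asks only for a reflection family with matching row sums. Composition with
  \<open>\<Phi>\<close> then gives the map on \<open>W\<close>, and the commutation relations of
  \<open>W\<close> are never verified in its tensor square.\<close>

lemma comult_K_W: "\<exists>\<delta>\<in>star_hom K (tensor W W). \<forall>i\<in>{1..N}. \<forall>j\<in>{1..N}. \<forall>g\<in>carrier G.
    \<delta> (\<alpha> i j g) = (\<Oplus>\<^bsub>tensor W W\<^esub>k\<in>{1..N}. pure_tensor W W (\<beta> i k g) (\<beta> k j g))"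
proof (rule K_lift[OF WW.refl_family_tensor[OF refl_family_\<beta> refl_family_\<beta>]])
  have "(\<Oplus>\<^bsub>tensor W W\<^esub>j\<in>{1..N}. \<Oplus>\<^bsub>tensor W W\<^esub>k\<in>{1..N}. pure_tensor W W (\<beta> i k g) (\<beta> k j g)) =
      pure_tensor W W (n 1 g) (n 1 g)" if i: "i \<in> {1..N}" and g: "g \<in> L" for i g
  proof -
    have g': "g \<in> carrier G" and one: "1 \<in> {1..N}" using i g L.mem_carrier by auto
    have "(\<Oplus>\<^bsub>tensor W W\<^esub>j\<in>{1..N}. \<Oplus>\<^bsub>tensor W W\<^esub>k\<in>{1..N}. pure_tensor W W (\<beta> i k g) (\<beta> k j g)) =
        (\<Oplus>\<^bsub>tensor W W\<^esub>k\<in>{1..N}. pure_tensor W W (\<beta> i k g) (\<Oplus>\<^bsub>W\<^esub>j\<in>{1..N}. \<beta> k j g))"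
      by (rule WW.row_sum_tensor[OF refl_family_\<beta> refl_family_\<beta> i g'])
    \<comment> \<open>For \<open>g\<close> in the subgroup amalgamation replaces
      \<open>n k g\<close> by \<open>n 1 g\<close>; here this is an equality in the algebra, not one
      modulo an ideal.\<close>
    also have "\<dots> = (\<Oplus>\<^bsub>tensor W W\<^esub>k\<in>{1..N}. pure_tensor W W (\<beta> i k g) (n 1 g))"
      using i g' one
      by (intro WW.T.sum_cong WW.pure_closed \<beta>_closed n_closed arg_cong2[of _ _ _ _ "pure_tensor W W"] refl)
        (simp only: row_sum_\<beta>, rule n_eq[OF _ one g])
    also have "\<dots> = pure_tensor W W (n i g) (n 1 g)"
      using i g' one
      by (subst WW.pure_sum_l[symmetric]) (auto intro!: \<beta>_closed n_closed simp: row_sum_\<beta>)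
    also have "n i g = n 1 g" by (rule n_eq[OF i one g])
    finally show ?thesis .
  qed
  note const = this
  fix i j g assume "i \<in> {1..N}" "j \<in> {1..N}" "g \<in> L"
  then show "(\<Oplus>\<^bsub>tensor W W\<^esub>k\<in>{1..N}. \<Oplus>\<^bsub>tensor W W\<^esub>l\<in>{1..N}. pure_tensor W W (\<beta> i l g) (\<beta> l k g)) =
      (\<Oplus>\<^bsub>tensor W W\<^esub>k\<in>{1..N}. \<Oplus>\<^bsub>tensor W W\<^esub>l\<in>{1..N}. pure_tensor W W (\<beta> j l g) (\<beta> l k g))"
    by (simp only: const)
qed

section \<open>The coproduct of the free wreath product and its push-forward\<close>

definition is_wreath_comult where
  "is_wreath_comult f \<longleftrightarrow>
     (\<forall>i\<in>{1..N}. \<forall>j\<in>{1..N}.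
        f (p i j) = (\<Oplus>\<^bsub>tensor W W\<^esub>k\<in>{1..N}. pure_tensor W W (p i k) (p k j))) \<and>
     (\<forall>i\<in>{1..N}. \<forall>g\<in>carrier G.
        f (n i g) = (\<Oplus>\<^bsub>tensor W W\<^esub>k\<in>{1..N}. pure_tensor W W (n i g \<otimes>\<^bsub>W\<^esub> p i k) (n k g)))"

lemma wreath_comult_unique:
  assumes "f \<in> star_hom W (tensor W W)" "is_wreath_comult f"
    "f' \<in> star_hom W (tensor W W)" "is_wreath_comult f'" "x \<in> carrier W"
  shows "f x = f' x"
  by (rule wreath_hom_eqI[OF assms(1,3) _ _ assms(5)])
    (use assms(2,4) in \<open>simp_all add: is_wreath_comult_def\<close>)

text \<open>\<open>\<Phi>\<close> turns \<open>n i g\<close> into a row sum. Summing the matrix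
  coproduct over the columns makes the second leg a row sum of \<open>\<beta>\<close>, that is
  \<open>n k g\<close>, while the first leg stays \<open>\<beta> i k g\<close>.\<close>

lemma is_wreath_comult_comp:
  assumes \<delta>: "\<delta> \<in> star_hom K (tensor W W)" "\<forall>i\<in>{1..N}. \<forall>j\<in>{1..N}. \<forall>g\<in>carrier G.
      \<delta> (\<alpha> i j g) = (\<Oplus>\<^bsub>tensor W W\<^esub>k\<in>{1..N}. pure_tensor W W (\<beta> i k g) (\<beta> k j g))"
    and \<Phi>: "\<forall>i\<in>{1..N}. \<forall>g\<in>carrier G. \<Phi> (n i g) = \<alpha>.row_sum i g"
      "\<forall>i\<in>{1..N}. \<forall>j\<in>{1..N}. \<Phi> (p i j) = \<alpha> i j \<one>\<^bsub>G\<^esub>"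
  shows "is_wreath_comult (\<lambda>x. \<delta> (\<Phi> x))"
  unfolding is_wreath_comult_def
proof (intro conjI ballI)
  fix i j assume "i \<in> {1..N}" "j \<in> {1..N}"
  then show "\<delta> (\<Phi> (p i j)) = (\<Oplus>\<^bsub>tensor W W\<^esub>k\<in>{1..N}. pure_tensor W W (p i k) (p k j))"
    using \<delta>(2) \<Phi>(2) p.closed WW.pure_closed by (simp add: \<beta>_one cong: WW.T.finsum_cong)
next
  fix i g assume i: "i \<in> {1..N}" and g: "g \<in> carrier G"
  have "\<delta> (\<Phi> (n i g)) = (\<Oplus>\<^bsub>tensor W W\<^esub>j\<in>{1..N}. \<delta> (\<alpha> i j g))"
    using i g \<Phi>(1) by (simp add: \<alpha>.row_sum_def \<alpha>.closed Pi_iff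
        star_hom_finsum[OF star_alg_K WW.star_alg_tensor \<delta>(1)])
  also have "\<dots> = (\<Oplus>\<^bsub>tensor W W\<^esub>j\<in>{1..N}. \<Oplus>\<^bsub>tensor W W\<^esub>k\<in>{1..N}. pure_tensor W W (\<beta> i k g) (\<beta> k j g))"
    using i g \<delta>(2) by (intro WW.T.sum_cong WW.T.sum_closed WW.pure_closed \<beta>_closed) auto
  also have "\<dots> = (\<Oplus>\<^bsub>tensor W W\<^esub>k\<in>{1..N}. pure_tensor W W (\<beta> i k g) (\<Oplus>\<^bsub>W\<^esub>j\<in>{1..N}. \<beta> k j g))"
    by (rule WW.row_sum_tensor[OF refl_family_\<beta> refl_family_\<beta> i g])
  also have "\<dots> = (\<Oplus>\<^bsub>tensor W W\<^esub>k\<in>{1..N}. pure_tensor W W (n i g \<otimes>\<^bsub>W\<^esub> p i k) (n k g))"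
    unfolding \<beta>_def[symmetric] using i g
    by (intro WW.T.sum_cong WW.pure_closed \<beta>_closed n_closed) (simp_all add: row_sum_\<beta>)
  finally show "\<delta> (\<Phi> (n i g)) =
      (\<Oplus>\<^bsub>tensor W W\<^esub>k\<in>{1..N}. pure_tensor W W (n i g \<otimes>\<^bsub>W\<^esub> p i k) (n k g))" .
qed

text \<open>Evaluates the definite description: a *-homomorphism with the prescribed values
  qualifies after restriction to the carrier, and it is the only candidate because the values on all
  \<open>n i g\<close> and \<open>p i j\<close> determine it.\<close>

lemma wreath_comult_eq:
  assumes "f \<in> star_hom W (tensor W W)" "is_wreath_comult f"
  shows "wreath_comult G L N = restrict f (carrier W)"
  unfolding wreath_comult_def Let_def is_wreath_comult_def[symmetric]
proof (rule the_equality)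
  have "restrict f (carrier W) \<in> star_hom W (tensor W W)"
    by (rule star_hom_cong[OF star_alg_W assms(1)]) simp
  then show "restrict f (carrier W) \<in> star_hom W (tensor W W) \<inter> extensional (carrier W) \<and>
      is_wreath_comult (restrict f (carrier W))"
    using assms(2) p.closed n_closed by (simp add: is_wreath_comult_def)
next
  fix f' assume f': "f' \<in> star_hom W (tensor W W) \<inter> extensional (carrier W) \<and> is_wreath_comult f'"
  then have "f' x = f x" if "x \<in> carrier W" for x
    using wreath_comult_unique[of f' f x] assms that by simp
  then show "f' = restrict f (carrier W)"
    using f' by (intro extensionalityI[of f' "carrier W"]) auto
qed

text \<open>The preimage of \<open>\<alpha> i j g\<close> is \<open>\<beta> i j g\<close>, since
  \<open>\<Phi>\<close> maps the latter to a row sum times a projection of that row. On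
  \<open>\<beta>\<close> the coproduct has matrix form, so applying \<open>\<Phi>\<close> in both
  legs gives the claim term by term.\<close>

lemma pushforward_wreath_comult:
  assumes iso: "\<Phi> \<in> star_iso W K"
    and \<Phi>: "\<forall>i\<in>{1..N}. \<forall>g\<in>carrier G. \<Phi> (n i g) = \<alpha>.row_sum i g"
      "\<forall>i\<in>{1..N}. \<forall>j\<in>{1..N}. \<Phi> (p i j) = \<alpha> i j \<one>\<^bsub>G\<^esub>"
    and ij: "i \<in> {1..N}" "j \<in> {1..N}" and g: "g \<in> carrier G"
  shows "pushforward_comult W K \<Phi> (wreath_comult G L N) (\<alpha> i j g) =
    (\<Oplus>\<^bsub>tensor K K\<^esub>k\<in>{1..N}. pure_tensor K K (\<alpha> i k g) (\<alpha> k j g))"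
proof -
  have hom: "\<Phi> \<in> star_hom W K" and inj: "inj_on \<Phi> (carrier W)"
    using iso by (auto simp: star_iso_def bij_betw_def)
  have \<Phi>_\<beta>: "\<Phi> (\<beta> i j g) = \<alpha> i j g" if "i \<in> {1..N}" "j \<in> {1..N}" for i j
    using that g \<Phi> by (simp add: \<beta>_def star_homD(3)[OF hom] n_closed p.closed \<alpha>.row_sum_mult_b)
  have inv: "inv_into (carrier W) \<Phi> (\<alpha> i j g) = \<beta> i j g"
    using inj ij g by (intro inv_into_f_eq \<beta>_closed \<Phi>_\<beta>)
  obtain \<delta> where \<delta>: "\<delta> \<in> star_hom K (tensor W W)" "\<forall>i\<in>{1..N}. \<forall>j\<in>{1..N}. \<forall>g\<in>carrier G.
      \<delta> (\<alpha> i j g) = (\<Oplus>\<^bsub>tensor W W\<^esub>k\<in>{1..N}. pure_tensor W W (\<beta> i k g) (\<beta> k j g))"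
    using comult_K_W by blast
  have "wreath_comult G L N (\<beta> i j g) = \<delta> (\<Phi> (\<beta> i j g))"
    using ij g by (simp add: \<beta>_closed
        wreath_comult_eq[OF star_hom_comp[OF hom \<delta>(1)] is_wreath_comult_comp[OF \<delta> \<Phi>]])
  then have comult: "wreath_comult G L N (\<beta> i j g) =
      (\<Oplus>\<^bsub>tensor W W\<^esub>k\<in>{1..N}. pure_tensor W W (\<beta> i k g) (\<beta> k j g))"
    using ij g \<delta>(2) by (simp add: \<Phi>_\<beta>)
  have bil: "bilinear_into W W (tensor K K) (\<lambda>x y. pure_tensor K K (\<Phi> x) (\<Phi> y))"
    unfolding bilinear_into_def
    by (simp add: star_homD[OF hom] KK.pure_closed KK.pure_add_l KK.pure_add_r KK.pure_smult_l
        KK.pure_smult_r)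
  have "tensor_map K K \<Phi> \<Phi> (wreath_comult G L N (\<beta> i j g)) = (\<Oplus>\<^bsub>tensor K K\<^esub>k\<in>{1..N}.
      tensor_lift (tensor K K) (\<lambda>x y. pure_tensor K K (\<Phi> x) (\<Phi> y)) (pure_tensor W W (\<beta> i k g) (\<beta> k j g)))"
    unfolding tensor_map_def comult using ij g
    by (intro WW.tensor_lift_finsum[OF KK.star_alg_tensor bil] Pi_I WW.pure_closed \<beta>_closed)
  also have "\<dots> = (\<Oplus>\<^bsub>tensor K K\<^esub>k\<in>{1..N}. pure_tensor K K (\<alpha> i k g) (\<alpha> k j g))"
    using ij g
    by (intro KK.T.sum_cong KK.pure_closed \<alpha>.closed)
      (simp_all add: WW.tensor_lift_pure[OF KK.star_alg_tensor bil] \<beta>_closed \<Phi>_\<beta>)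
  finally show ?thesis by (simp add: pushforward_comult_def inv)
qed

end

theorem proposition3p8:
  fixes G :: "('g, 'r) monoid_scheme" and L :: "'g set" and N :: nat
  assumes "N \<ge> 1" and "group G" and "subgroup L G"
  shows "\<exists>\<Phi> \<in> star_iso (wreath_algebra G L N) (refl_sub_algebra G L N).
           \<forall>i\<in>{1..N}. \<forall>j\<in>{1..N}. \<forall>g\<in>carrier G.
             pushforward_comult (wreath_algebra G L N) (refl_sub_algebra G L N) \<Phi>
               (wreath_comult G L N) (refl_sub_gen G L N i j g) =
             (\<Oplus>\<^bsub>tensor (refl_sub_algebra G L N) (refl_sub_algebra G L N)\<^esub>k\<in>{1..N}.
                pure_tensor (refl_sub_algebra G L N) (refl_sub_algebra G L N)
                  (refl_sub_gen G L N i k g) (refl_sub_gen G L N k j g))"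
proof -
  interpret wreath_reflection G N L
    using assms(2,3)
    by (intro wreath_reflection.intro reflection_sub.intro reflection.intro wreath.intro)
  show ?thesis
    unfolding refl_sub_algebra_eq refl_sub_gen_eq
    using isomorphism pushforward_wreath_comult by blast
qed

end
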